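(* Let $\mathbf{k}$ be a unitary commutative ring and $\Omega$ a nonempty set. (a) The sextuple $(H_{LR}(\Omega),\ast,|,\Delta_{LR(\Omega)},\varepsilon_{LR(\Omega)},\vee_\Omega)$ is the free cocycle $\vee_\Omega$-bialgebra on the empty set, that is, the initial object in the category of cocycle $\vee_\Omega$-bialgebras. (b) The sextuple $(H_{LR}(\Omega),\ast,|,\Delta_{LR(\Omega)},\varepsilon_{LR(\Omega)},\vee_\Omega)$ is the free cocycle $\vee_\Omega$-Hopf algebra on the empty set, that is, the initial object in the category of cocycle $\vee_\Omega$-Hopf algebras.
   Context: All modules, algebras, coalgebras, bialgebras, Hopf algebras, linear maps and tensor products are over $\mathbf{k}$; algebras are associative and unitary but not necessarily commutative. Decorated trees. For $n\ge 0$, $Y_n(\Omega)$ is the set of planar binary rooted trees with $n$ interior vertices (each interior vertex has exactly a left and a right child), each interior vertex being decorated by an element of $\Omega$; leaves are not decorated. $Y_0(\Omega)=\{|\}$, where $|$ is the unique tree with one leaf and no interior vertex. $Y_\infty(\Omega)=\bigsqcup_{n\ge0}Y_n(\Omega)$ and $H_{LR}(\Omega)=\mathbf{k}Y_\infty(\Omega)$ is the free $\mathbf{k}$-module on it. For $\alpha\in\Omega$ and trees $T_1,T_2$, $T_1\vee_\alpha T_2$ is the tree whose root vertex is decorated by $\alpha$, with left subtree $T_1$ and right subtree $T_2$; $\vee_\alpha$ is extended to a linear map $H_{LR}(\Omega)\otimes H_{LR}(\Omega)\to H_{LR}(\Omega)$, and $\vee_\Omega=\{\vee_\alpha\mid\alpha\in\Omega\}$.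 Every tree $T\neq|$ is uniquely $T=T^l\vee_\alpha T^r$. Product: $\ast$ is the bilinear product on $H_{LR}(\Omega)$, with unit $|$, defined recursively by $|\ast T=T\ast|=T$ and, for $T=T^l\vee_\alpha T^r$, $T'=T'^l\vee_\beta T'^r$, $T\ast T'=T^l\vee_\alpha(T^r\ast T')+(T\ast T'^l)\vee_\beta T'^r$. Coproduct and counit: $\Delta_{LR(\Omega)}$ is the linear map defined recursively by $\Delta_{LR(\Omega)}(|)=|\otimes|$ and $\Delta_{LR(\Omega)}(T^l\vee_\alpha T^r)=(T^l\vee_\alpha T^r)\otimes|+(\ast,\vee_\alpha)\bigl(\Delta_{LR(\Omega)}(T^l)\otimes\Delta_{LR(\Omega)}(T^r)\bigr)$, where $(\ast,\vee_\alpha)=(\ast\otimes\vee_\alpha)\circ\tau_{23}$ and $\tau_{23}$ exchanges the second and third tensor factors. $\varepsilon_{LR(\Omega)}$ is the linear map with $|\mapsto1_{\mathbf{k}}$ and $T\mapsto0$ for every tree $T\neq|$. A $\vee_\Omega$-algebra $(A,\ast_A,1_A,\vee_\Omega)$ is an algebra $(A,\ast_A,1_A)$ with a set of binary operations (linear maps) $\vee_\alpha:A\otimes A\to A$, $\alpha\in\Omega$, such that for all $\alpha,\alpha'\in\Omega$ and $a=a_1\vee_\alpha a_2$, $a'=a_1'\vee_{\alpha'}a_2'$ (with $a_1,a_2,a_1',a_2'\in A$), $a\ast_A a'=a_1\vee_\alpha(a_2\ast_A a')+(a\ast_A a_1')\vee_{\alpha'}a_2'$. A $\vee_\Omega$-bialgebra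 (resp. $\vee_\Omega$-Hopf algebra) is a bialgebra (resp. Hopf algebra) $(H,\ast_H,1_H,\Delta_H,\varepsilon_H)$ which is also a $\vee_\Omega$-algebra $(H,\ast_H,1_H,\vee_\Omega)$. It is called cocycle if for all $\alpha\in\Omega$ and $h,h'\in H$, $$\Delta_H(h\vee_\alpha h')=(h\vee_\alpha h')\otimes1_H+(\ast_H,\vee_\alpha)\bigl(\Delta_H(h)\otimes\Delta_H(h')\bigr),\qquad(\ast_H,\vee_\alpha)=(\ast_H\otimes\vee_\alpha)\circ\tau_{23}.$$ A $\vee_\Omega$-bialgebra (resp. $\vee_\Omega$-Hopf algebra) morphism $\phi:(H,\vee_\Omega)\to(H',\vee'_\Omega)$ is a bialgebra (resp. Hopf algebra) morphism with $\phi\circ\vee_\alpha=\vee'_\alpha\circ(\phi\otimes\phi)$ for all $\alpha\in\Omega$; these are the morphisms in the respective categories. A free cocycle $\vee_\Omega$-bialgebra (resp. Hopf algebra) on a set $X$ is a cocycle $\vee_\Omega$-bialgebra (resp. Hopf algebra) $H$ with a set map $j:X\to H$ such that for every cocycle $\vee_\Omega$-bialgebra (resp. Hopf algebra) $H'$ and set map $\phi:X\to H'$ there is a unique $\vee_\Omega$-bialgebra (resp. Hopf algebra) morphism $\bar\phi:H\to H'$ with $\bar\phi\circ j=\phi$. *)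

theory Defs
  imports "HOL-Algebra.Module" "HOL-Algebra.AbelCoset" "HOL-Library.Tree"
begin

section \<open>Linear maps and free modules\<close>

text \<open>The ground ring is a commutative ring \<open>R\<close>; as in HOL-Algebra, modules and (not necessarily
  commutative) algebras over it share the record type \<^typ>\<open>('k, 'a) module\<close>. For a record that is
  used only as a module, the fields \<open>mult\<close> and \<open>one\<close> are irrelevant and left undefined.\<close>

definition linear_maps ::
  "('k, 'r) ring_scheme \<Rightarrow> ('k, 'a, 'm) module_scheme \<Rightarrow> ('k, 'b, 'n) module_scheme \<Rightarrow> ('a \<Rightarrow> 'b) set" where
  "linear_maps R M N = {f \<in> carrier M \<rightarrow> carrier N.
     (\<forall>x\<in>carrier M. \<forall>y\<in>carrier M. f (x \<oplus>\<^bsub>M\<^esub> y) = f x \<oplus>\<^bsub>N\<^esub> f y) \<and>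
     (\<forall>r\<in>carrier R. \<forall>x\<in>carrier M. f (r \<odot>\<^bsub>M\<^esub> x) = r \<odot>\<^bsub>N\<^esub> f x)}"

definition bilinear_maps ::
  "('k, 'r) ring_scheme \<Rightarrow> ('k, 'a, 'm) module_scheme \<Rightarrow> ('k, 'b, 'n) module_scheme \<Rightarrow>
   ('k, 'c, 'p) module_scheme \<Rightarrow> ('a \<Rightarrow> 'b \<Rightarrow> 'c) set" where
  "bilinear_maps R M N P = {f.
     (\<forall>a\<in>carrier M. (\<lambda>b. f a b) \<in> linear_maps R N P) \<and>
     (\<forall>b\<in>carrier N. (\<lambda>a. f a b) \<in> linear_maps R M P)}"

definition base_algebra :: "('k, 'r) ring_scheme \<Rightarrow> ('k, 'k) module" where
  "base_algebra R = \<lparr>carrier = carrier R, mult = mult R, one = one R, zero = zero R, add = add R,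
     smult = mult R\<rparr>"

definition free_module :: "('k, 'r) ring_scheme \<Rightarrow> 'x set \<Rightarrow> ('k, 'x \<Rightarrow> 'k) module" where
  "free_module R X =
    \<lparr>carrier = {u. (\<forall>x\<in>X. u x \<in> carrier R) \<and> (\<forall>x. x \<notin> X \<longrightarrow> u x = \<zero>\<^bsub>R\<^esub>) \<and> finite {x. u x \<noteq> \<zero>\<^bsub>R\<^esub>}},
     mult = undefined, one = undefined,
     zero = (\<lambda>_. \<zero>\<^bsub>R\<^esub>),
     add = (\<lambda>u v x. u x \<oplus>\<^bsub>R\<^esub> v x),
     smult = (\<lambda>r u x. r \<otimes>\<^bsub>R\<^esub> u x)\<rparr>"

definition free_basis :: "('k, 'r) ring_scheme \<Rightarrow> 'x \<Rightarrow> ('x \<Rightarrow> 'k)" where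
  "free_basis R x = (\<lambda>y. if y = x then \<one>\<^bsub>R\<^esub> else \<zero>\<^bsub>R\<^esub>)"

text \<open>The linear (bilinear) map on free modules with prescribed values in \<open>M\<close> on basis elements.\<close>

definition lin_ext ::
  "('k, 'r) ring_scheme \<Rightarrow> ('k, 'a, 'm) module_scheme \<Rightarrow> ('x \<Rightarrow> 'a) \<Rightarrow> ('x \<Rightarrow> 'k) \<Rightarrow> 'a" where
  "lin_ext R M f u = (\<Oplus>\<^bsub>M\<^esub>x\<in>{x. u x \<noteq> \<zero>\<^bsub>R\<^esub>}. u x \<odot>\<^bsub>M\<^esub> f x)"

definition bilin_ext ::
  "('k, 'r) ring_scheme \<Rightarrow> ('k, 'a, 'm) module_scheme \<Rightarrow> ('x \<Rightarrow> 'y \<Rightarrow> 'a) \<Rightarrow>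
   ('x \<Rightarrow> 'k) \<Rightarrow> ('y \<Rightarrow> 'k) \<Rightarrow> 'a" where
  "bilin_ext R M f u v = lin_ext R M (\<lambda>x. lin_ext R M (f x) v) u"

section \<open>Tensor products\<close>

text \<open>\<open>M \<otimes> N\<close> is the quotient of the free module on \<open>carrier M \<times> carrier N\<close> by the submodule
  generated by the bilinearity relations; its elements are cosets.\<close>

definition module_span ::
  "('k, 'r) ring_scheme \<Rightarrow> ('k, 'a, 'm) module_scheme \<Rightarrow> 'a set \<Rightarrow> 'a set" where
  "module_span R M S = \<Inter>{K. submodule K R M \<and> S \<subseteq> K}"

definition quotient_module ::
  "('k, 'a, 'm) module_scheme \<Rightarrow> 'a set \<Rightarrow> ('k, 'a set) module" where
  "quotient_module M K =
    \<lparr>carrier = a_rcosets\<^bsub>M\<^esub> K, mult = undefined, one = undefined,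
     zero = K,
     add = set_add M,
     smult = (\<lambda>r C. \<Union>x\<in>C. K +>\<^bsub>M\<^esub> (r \<odot>\<^bsub>M\<^esub> x))\<rparr>"

definition tensor_free ::
  "('k, 'r) ring_scheme \<Rightarrow> ('k, 'a, 'm) module_scheme \<Rightarrow> ('k, 'b, 'n) module_scheme \<Rightarrow>
   ('k, 'a \<times> 'b \<Rightarrow> 'k) module" where
  "tensor_free R M N = free_module R (carrier M \<times> carrier N)"

definition tensor_relations ::
  "('k, 'r) ring_scheme \<Rightarrow> ('k, 'a, 'm) module_scheme \<Rightarrow> ('k, 'b, 'n) module_scheme \<Rightarrow>
   ('a \<times> 'b \<Rightarrow> 'k) set" where
  "tensor_relations R M N =
    (let F = tensor_free R M N; e = free_basis R in
      {e (a \<oplus>\<^bsub>M\<^esub> a', b) \<ominus>\<^bsub>F\<^esub> (e (a, b) \<oplus>\<^bsub>F\<^esub> e (a', b)) | a a' b.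
         a \<in> carrier M \<and> a' \<in> carrier M \<and> b \<in> carrier N} \<union>
      {e (a, b \<oplus>\<^bsub>N\<^esub> b') \<ominus>\<^bsub>F\<^esub> (e (a, b) \<oplus>\<^bsub>F\<^esub> e (a, b')) | a b b'.
         a \<in> carrier M \<and> b \<in> carrier N \<and> b' \<in> carrier N} \<union>
      {e (r \<odot>\<^bsub>M\<^esub> a, b) \<ominus>\<^bsub>F\<^esub> (r \<odot>\<^bsub>F\<^esub> e (a, b)) | r a b.
         r \<in> carrier R \<and> a \<in> carrier M \<and> b \<in> carrier N} \<union>
      {e (a, r \<odot>\<^bsub>N\<^esub> b) \<ominus>\<^bsub>F\<^esub> (r \<odot>\<^bsub>F\<^esub> e (a, b)) | r a b.
         r \<in> carrier R \<and> a \<in> carrier M \<and> b \<in> carrier N})"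

definition tensor_kernel ::
  "('k, 'r) ring_scheme \<Rightarrow> ('k, 'a, 'm) module_scheme \<Rightarrow> ('k, 'b, 'n) module_scheme \<Rightarrow>
   ('a \<times> 'b \<Rightarrow> 'k) set" where
  "tensor_kernel R M N = module_span R (tensor_free R M N) (tensor_relations R M N)"

definition tensor_module ::
  "('k, 'r) ring_scheme \<Rightarrow> ('k, 'a, 'm) module_scheme \<Rightarrow> ('k, 'b, 'n) module_scheme \<Rightarrow>
   ('k, ('a \<times> 'b \<Rightarrow> 'k) set) module" where
  "tensor_module R M N = quotient_module (tensor_free R M N) (tensor_kernel R M N)"

definition pure_tensor ::
  "('k, 'r) ring_scheme \<Rightarrow> ('k, 'a, 'm) module_scheme \<Rightarrow> ('k, 'b, 'n) module_scheme \<Rightarrow>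
   'a \<Rightarrow> 'b \<Rightarrow> ('a \<times> 'b \<Rightarrow> 'k) set" where
  "pure_tensor R M N a b = tensor_kernel R M N +>\<^bsub>tensor_free R M N\<^esub> free_basis R (a, b)"

text \<open>The linear map \<open>M \<otimes> N \<rightarrow> P\<close> induced by a map \<open>f\<close> that is bilinear on the carriers: its value at a
  coset is the common value of the linear extension of \<open>f\<close> at all representatives.\<close>

definition tensor_lift ::
  "('k, 'r) ring_scheme \<Rightarrow> ('k, 'c, 'p) module_scheme \<Rightarrow> ('a \<Rightarrow> 'b \<Rightarrow> 'c) \<Rightarrow>
   ('a \<times> 'b \<Rightarrow> 'k) set \<Rightarrow> 'c" where
  "tensor_lift R P f t = (THE c. \<forall>u\<in>t. lin_ext R P (\<lambda>(a, b). f a b) u = c)"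

text \<open>\<open>f \<otimes> g : M \<otimes> N \<rightarrow> M' \<otimes> N'\<close>; only the target modules enter the formula.\<close>

definition tensor_map ::
  "('k, 'r) ring_scheme \<Rightarrow> ('k, 'c, 'm) module_scheme \<Rightarrow> ('k, 'd, 'n) module_scheme \<Rightarrow>
   ('a \<Rightarrow> 'c) \<Rightarrow> ('b \<Rightarrow> 'd) \<Rightarrow> ('a \<times> 'b \<Rightarrow> 'k) set \<Rightarrow> ('c \<times> 'd \<Rightarrow> 'k) set" where
  "tensor_map R M' N' f g =
     tensor_lift R (tensor_module R M' N') (\<lambda>a b. pure_tensor R M' N' (f a) (g b))"

text \<open>The isomorphism \<open>(M \<otimes> N) \<otimes> P \<rightarrow> M \<otimes> (N \<otimes> P)\<close>.\<close>

definition tensor_assoc ::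
  "('k, 'r) ring_scheme \<Rightarrow> ('k, 'a, 'm) module_scheme \<Rightarrow> ('k, 'b, 'n) module_scheme \<Rightarrow>
   ('k, 'c, 'p) module_scheme \<Rightarrow>
   (('a \<times> 'b \<Rightarrow> 'k) set \<times> 'c \<Rightarrow> 'k) set \<Rightarrow> ('a \<times> ('b \<times> 'c \<Rightarrow> 'k) set \<Rightarrow> 'k) set" where
  "tensor_assoc R M N P =
     (let NP = tensor_module R N P; Q = tensor_module R M NP in
      tensor_lift R Q
        (\<lambda>t c. tensor_lift R Q (\<lambda>a b. pure_tensor R M NP a (pure_tensor R N P b c)) t))"

text \<open>For bilinear \<open>f\<close> on \<open>M\<close> and \<open>g\<close> on \<open>N\<close>, the map \<open>(f \<otimes> g) \<circ> \<tau>\<^sub>2\<^sub>3\<close> on \<open>(M \<otimes> N) \<otimes> (M \<otimes> N)\<close>, as a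
  bilinear map of two arguments: \<open>(a \<otimes> b, c \<otimes> d) \<mapsto> f(a, c) \<otimes> g(b, d)\<close>. With \<open>f\<close> and \<open>g\<close> the products
  of two algebras this is the product of their tensor product; with \<open>f = \<ast>\<close> and \<open>g = \<or>\<^sub>\<alpha>\<close> it
  is the map \<open>(\<ast>, \<or>\<^sub>\<alpha>)\<close>.\<close>

definition tensor_op ::
  "('k, 'r) ring_scheme \<Rightarrow> ('k, 'a, 'm) module_scheme \<Rightarrow> ('k, 'b, 'n) module_scheme \<Rightarrow>
   ('a \<Rightarrow> 'a \<Rightarrow> 'a) \<Rightarrow> ('b \<Rightarrow> 'b \<Rightarrow> 'b) \<Rightarrow>
   ('a \<times> 'b \<Rightarrow> 'k) set \<Rightarrow> ('a \<times> 'b \<Rightarrow> 'k) set \<Rightarrow> ('a \<times> 'b \<Rightarrow> 'k) set" where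
  "tensor_op R M N f g s t =
     (let T = tensor_module R M N in
      tensor_lift R T (\<lambda>a b. tensor_lift R T (\<lambda>c d. pure_tensor R M N (f a c) (g b d)) t) s)"

definition tensor_algebra ::
  "('k, 'r) ring_scheme \<Rightarrow> ('k, 'a, 'm) module_scheme \<Rightarrow> ('k, 'b, 'n) module_scheme \<Rightarrow>
   ('k, ('a \<times> 'b \<Rightarrow> 'k) set) module" where
  "tensor_algebra R A B = (tensor_module R A B)
     \<lparr>mult := tensor_op R A B (mult A) (mult B), one := pure_tensor R A B \<one>\<^bsub>A\<^esub> \<one>\<^bsub>B\<^esub>\<rparr>"

section \<open>Algebras, bialgebras and Hopf algebras\<close>

text \<open>The locale \<^locale>\<open>algebra\<close> of HOL-Algebra requires commutativity, which is not assumed here.\<close>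

locale unital_algebra = module R A + ring A for R (structure) and A (structure) +
  assumes smult_mult_left:
      "\<lbrakk>r \<in> carrier R; x \<in> carrier A; y \<in> carrier A\<rbrakk> \<Longrightarrow>
       (r \<odot>\<^bsub>A\<^esub> x) \<otimes>\<^bsub>A\<^esub> y = r \<odot>\<^bsub>A\<^esub> (x \<otimes>\<^bsub>A\<^esub> y)"
    and smult_mult_right:
      "\<lbrakk>r \<in> carrier R; x \<in> carrier A; y \<in> carrier A\<rbrakk> \<Longrightarrow>
       x \<otimes>\<^bsub>A\<^esub> (r \<odot>\<^bsub>A\<^esub> y) = r \<odot>\<^bsub>A\<^esub> (x \<otimes>\<^bsub>A\<^esub> y)"

definition algebra_hom ::
  "('k, 'r) ring_scheme \<Rightarrow> ('k, 'a, 'm) module_scheme \<Rightarrow> ('k, 'b, 'n) module_scheme \<Rightarrow> ('a \<Rightarrow> 'b) set" where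
  "algebra_hom R A B = ring_hom A B \<inter> linear_maps R A B"

record ('k, 'a) bialgebra = "('k, 'a) module" +
  comult :: "'a \<Rightarrow> ('a \<times> 'a \<Rightarrow> 'k) set"
  counit :: "'a \<Rightarrow> 'k"

text \<open>The counit axioms are \<open>\<Sum> \<epsilon>(h\<^sub>1) h\<^sub>2 = h = \<Sum> \<epsilon>(h\<^sub>2) h\<^sub>1\<close>, that is, \<open>(\<epsilon> \<otimes> id) \<circ> \<Delta> = id = (id \<otimes> \<epsilon>) \<circ> \<Delta>\<close>
  after identifying \<open>R \<otimes> H\<close> and \<open>H \<otimes> R\<close> with \<open>H\<close>.\<close>

locale bialgebra = unital_algebra R H for R (structure) and H (structure) +
  assumes comult_hom: "comult H \<in> algebra_hom R H (tensor_algebra R H H)"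
    and counit_hom: "counit H \<in> algebra_hom R H (base_algebra R)"
    and coassoc:
      "h \<in> carrier H \<Longrightarrow>
       tensor_assoc R H H H (tensor_map R (tensor_module R H H) H (comult H) (\<lambda>x. x) (comult H h)) =
       tensor_map R H (tensor_module R H H) (\<lambda>x. x) (comult H) (comult H h)"
    and counit_left:
      "h \<in> carrier H \<Longrightarrow> tensor_lift R H (\<lambda>a b. counit H a \<odot>\<^bsub>H\<^esub> b) (comult H h) = h"
    and counit_right:
      "h \<in> carrier H \<Longrightarrow> tensor_lift R H (\<lambda>a b. counit H b \<odot>\<^bsub>H\<^esub> a) (comult H h) = h"

definition antipode ::
  "('k, 'r) ring_scheme \<Rightarrow> ('k, 'a, 'm) bialgebra_scheme \<Rightarrow> ('a \<Rightarrow> 'a) \<Rightarrow> bool" where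
  "antipode R H S \<longleftrightarrow> S \<in> linear_maps R H H \<and>
     (\<forall>h\<in>carrier H.
        tensor_lift R H (\<lambda>a b. S a \<otimes>\<^bsub>H\<^esub> b) (comult H h) = counit H h \<odot>\<^bsub>H\<^esub> \<one>\<^bsub>H\<^esub> \<and>
        tensor_lift R H (\<lambda>a b. a \<otimes>\<^bsub>H\<^esub> S b) (comult H h) = counit H h \<odot>\<^bsub>H\<^esub> \<one>\<^bsub>H\<^esub>)"

locale hopf_algebra = bialgebra +
  assumes ex_antipode: "\<exists>S. antipode R H S"

text \<open>Homomorphisms are required to be \<^const>\<open>undefined\<close> outside the carrier of the source, so that
  equality of HOL functions is equality of maps between the carriers.\<close>

definition bialgebra_hom ::
  "('k, 'r) ring_scheme \<Rightarrow> ('k, 'a, 'm) bialgebra_scheme \<Rightarrow> ('k, 'b, 'n) bialgebra_scheme \<Rightarrow>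
   ('a \<Rightarrow> 'b) set" where
  "bialgebra_hom R H H' = {\<phi> \<in> algebra_hom R H H' \<inter> extensional (carrier H).
     \<forall>h\<in>carrier H. comult H' (\<phi> h) = tensor_map R H' H' \<phi> \<phi> (comult H h) \<and>
                    counit H' (\<phi> h) = counit H h}"

definition hopf_hom ::
  "('k, 'r) ring_scheme \<Rightarrow> ('k, 'a, 'm) bialgebra_scheme \<Rightarrow> ('k, 'b, 'n) bialgebra_scheme \<Rightarrow>
   ('a \<Rightarrow> 'b) set" where
  "hopf_hom R H H' = {\<phi> \<in> bialgebra_hom R H H'.
     \<forall>S S'. antipode R H S \<and> antipode R H' S' \<longrightarrow> (\<forall>h\<in>carrier H. \<phi> (S h) = S' (\<phi> h))}"

section \<open>\<open>\<or>\<^sub>\<Omega>\<close>-algebras and cocycle \<open>\<or>\<^sub>\<Omega>\<close>-bialgebras\<close>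

locale vee_algebra = unital_algebra R A for R (structure) and A (structure) +
  fixes \<Omega> :: "'w set" and V :: "'w \<Rightarrow> 'b \<Rightarrow> 'b \<Rightarrow> 'b"
  assumes vee_bilinear: "\<alpha> \<in> \<Omega> \<Longrightarrow> V \<alpha> \<in> bilinear_maps R A A A"
    and vee_mult:
      "\<lbrakk>\<alpha> \<in> \<Omega>; \<alpha>' \<in> \<Omega>; a1 \<in> carrier A; a2 \<in> carrier A; a1' \<in> carrier A; a2' \<in> carrier A\<rbrakk> \<Longrightarrow>
       V \<alpha> a1 a2 \<otimes>\<^bsub>A\<^esub> V \<alpha>' a1' a2' =
         V \<alpha> a1 (a2 \<otimes>\<^bsub>A\<^esub> V \<alpha>' a1' a2') \<oplus>\<^bsub>A\<^esub> V \<alpha>' (V \<alpha> a1 a2 \<otimes>\<^bsub>A\<^esub> a1') a2'"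

record ('k, 'a, 'w) vee_bialgebra = "('k, 'a) bialgebra" +
  vee :: "'w \<Rightarrow> 'a \<Rightarrow> 'a \<Rightarrow> 'a"

locale vee_bialgebra = bialgebra R H + vee_algebra R H \<Omega> "vee H"
  for R (structure) and \<Omega> and H (structure)

locale cocycle_vee_bialgebra = vee_bialgebra +
  assumes cocycle:
    "\<lbrakk>\<alpha> \<in> \<Omega>; h \<in> carrier H; h' \<in> carrier H\<rbrakk> \<Longrightarrow>
     comult H (vee H \<alpha> h h') =
       pure_tensor R H H (vee H \<alpha> h h') \<one>\<^bsub>H\<^esub>
       \<oplus>\<^bsub>tensor_module R H H\<^esub> tensor_op R H H (mult H) (vee H \<alpha>) (comult H h) (comult H h')"

locale cocycle_vee_hopf_algebra = cocycle_vee_bialgebra + hopf_algebra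

definition vee_bialgebra_hom ::
  "('k, 'r) ring_scheme \<Rightarrow> 'w set \<Rightarrow> ('k, 'a, 'w) vee_bialgebra \<Rightarrow> ('k, 'b, 'w) vee_bialgebra \<Rightarrow>
   ('a \<Rightarrow> 'b) set" where
  "vee_bialgebra_hom R \<Omega> H H' = {\<phi> \<in> bialgebra_hom R H H'.
     \<forall>\<alpha>\<in>\<Omega>. \<forall>h\<in>carrier H. \<forall>h'\<in>carrier H. \<phi> (vee H \<alpha> h h') = vee H' \<alpha> (\<phi> h) (\<phi> h')}"

definition vee_hopf_hom ::
  "('k, 'r) ring_scheme \<Rightarrow> 'w set \<Rightarrow> ('k, 'a, 'w) vee_bialgebra \<Rightarrow> ('k, 'b, 'w) vee_bialgebra \<Rightarrow>
   ('a \<Rightarrow> 'b) set" where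
  "vee_hopf_hom R \<Omega> H H' = hopf_hom R H H' \<inter> vee_bialgebra_hom R \<Omega> H H'"

section \<open>Free and initial objects\<close>

text \<open>HOL cannot quantify over types inside a formula. The argument of type \<^typ>\<open>'h itself\<close> names the
  type in which the carriers of the test objects \<open>H'\<close> live; a theorem in which \<open>'h\<close> is a type
  variable asserts the universal property for all types.\<close>

definition free_cocycle_vee_bialgebra ::
  "'h itself \<Rightarrow> ('k, 'r) ring_scheme \<Rightarrow> 'w set \<Rightarrow> 'x set \<Rightarrow> ('x \<Rightarrow> 'a) \<Rightarrow>
   ('k, 'a, 'w) vee_bialgebra \<Rightarrow> bool" where
  "free_cocycle_vee_bialgebra _ R \<Omega> X j H \<longleftrightarrow>
     cocycle_vee_bialgebra R \<Omega> H \<and> j \<in> X \<rightarrow> carrier H \<and>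
     (\<forall>(H' :: ('k, 'h, 'w) vee_bialgebra) f.
        cocycle_vee_bialgebra R \<Omega> H' \<and> f \<in> X \<rightarrow> carrier H' \<longrightarrow>
        (\<exists>!\<phi>. \<phi> \<in> vee_bialgebra_hom R \<Omega> H H' \<and> (\<forall>x\<in>X. \<phi> (j x) = f x)))"

definition free_cocycle_vee_hopf_algebra ::
  "'h itself \<Rightarrow> ('k, 'r) ring_scheme \<Rightarrow> 'w set \<Rightarrow> 'x set \<Rightarrow> ('x \<Rightarrow> 'a) \<Rightarrow>
   ('k, 'a, 'w) vee_bialgebra \<Rightarrow> bool" where
  "free_cocycle_vee_hopf_algebra _ R \<Omega> X j H \<longleftrightarrow>
     cocycle_vee_hopf_algebra R \<Omega> H \<and> j \<in> X \<rightarrow> carrier H \<and>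
     (\<forall>(H' :: ('k, 'h, 'w) vee_bialgebra) f.
        cocycle_vee_hopf_algebra R \<Omega> H' \<and> f \<in> X \<rightarrow> carrier H' \<longrightarrow>
        (\<exists>!\<phi>. \<phi> \<in> vee_hopf_hom R \<Omega> H H' \<and> (\<forall>x\<in>X. \<phi> (j x) = f x)))"

definition initial_cocycle_vee_bialgebra ::
  "'h itself \<Rightarrow> ('k, 'r) ring_scheme \<Rightarrow> 'w set \<Rightarrow> ('k, 'a, 'w) vee_bialgebra \<Rightarrow> bool" where
  "initial_cocycle_vee_bialgebra _ R \<Omega> H \<longleftrightarrow>
     cocycle_vee_bialgebra R \<Omega> H \<and>
     (\<forall>H' :: ('k, 'h, 'w) vee_bialgebra.
        cocycle_vee_bialgebra R \<Omega> H' \<longrightarrow> (\<exists>!\<phi>. \<phi> \<in> vee_bialgebra_hom R \<Omega> H H'))"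

definition initial_cocycle_vee_hopf_algebra ::
  "'h itself \<Rightarrow> ('k, 'r) ring_scheme \<Rightarrow> 'w set \<Rightarrow> ('k, 'a, 'w) vee_bialgebra \<Rightarrow> bool" where
  "initial_cocycle_vee_hopf_algebra _ R \<Omega> H \<longleftrightarrow>
     cocycle_vee_hopf_algebra R \<Omega> H \<and>
     (\<forall>H' :: ('k, 'h, 'w) vee_bialgebra.
        cocycle_vee_hopf_algebra R \<Omega> H' \<longrightarrow> (\<exists>!\<phi>. \<phi> \<in> vee_hopf_hom R \<Omega> H H'))"

section \<open>The Loday--Ronco Hopf algebra of decorated trees\<close>

text \<open>Planar binary trees with interior vertices decorated by \<open>\<Omega>\<close> are the elements of
  \<^typ>\<open>'w tree\<close> with labels in \<open>\<Omega>\<close>: \<^const>\<open>Leaf\<close> is the tree \<open>|\<close>, and \<open>Node l \<alpha> r\<close> is \<open>l \<or>\<^sub>\<alpha> r\<close>.\<close>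

definition decorated_trees :: "'w set \<Rightarrow> 'w tree set" where
  "decorated_trees \<Omega> = {T. set_tree T \<subseteq> \<Omega>}"

definition LR_module :: "('k, 'r) ring_scheme \<Rightarrow> 'w set \<Rightarrow> ('k, 'w tree \<Rightarrow> 'k) module" where
  "LR_module R \<Omega> = free_module R (decorated_trees \<Omega>)"

definition LR_vee ::
  "('k, 'r) ring_scheme \<Rightarrow> 'w set \<Rightarrow> 'w \<Rightarrow> ('w tree \<Rightarrow> 'k) \<Rightarrow> ('w tree \<Rightarrow> 'k) \<Rightarrow> ('w tree \<Rightarrow> 'k)" where
  "LR_vee R \<Omega> \<alpha> = bilin_ext R (LR_module R \<Omega>) (\<lambda>l r. free_basis R (Node l \<alpha> r))"

fun LR_mult_tree ::
  "('k, 'r) ring_scheme \<Rightarrow> 'w set \<Rightarrow> 'w tree \<Rightarrow> 'w tree \<Rightarrow> ('w tree \<Rightarrow> 'k)" where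
  "LR_mult_tree R \<Omega> Leaf T = free_basis R T"
| "LR_mult_tree R \<Omega> T Leaf = free_basis R T"
| "LR_mult_tree R \<Omega> (Node l \<alpha> r) (Node l' \<beta> r') =
     LR_vee R \<Omega> \<alpha> (free_basis R l) (LR_mult_tree R \<Omega> r (Node l' \<beta> r'))
     \<oplus>\<^bsub>LR_module R \<Omega>\<^esub>
     LR_vee R \<Omega> \<beta> (LR_mult_tree R \<Omega> (Node l \<alpha> r) l') (free_basis R r')"

definition LR_mult ::
  "('k, 'r) ring_scheme \<Rightarrow> 'w set \<Rightarrow> ('w tree \<Rightarrow> 'k) \<Rightarrow> ('w tree \<Rightarrow> 'k) \<Rightarrow> ('w tree \<Rightarrow> 'k)" where
  "LR_mult R \<Omega> = bilin_ext R (LR_module R \<Omega>) (LR_mult_tree R \<Omega>)"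

primrec LR_comult_tree ::
  "('k, 'r) ring_scheme \<Rightarrow> 'w set \<Rightarrow> 'w tree \<Rightarrow> (('w tree \<Rightarrow> 'k) \<times> ('w tree \<Rightarrow> 'k) \<Rightarrow> 'k) set" where
  "LR_comult_tree R \<Omega> Leaf =
     pure_tensor R (LR_module R \<Omega>) (LR_module R \<Omega>) (free_basis R Leaf) (free_basis R Leaf)"
| "LR_comult_tree R \<Omega> (Node l \<alpha> r) =
     pure_tensor R (LR_module R \<Omega>) (LR_module R \<Omega>) (free_basis R (Node l \<alpha> r)) (free_basis R Leaf)
     \<oplus>\<^bsub>tensor_module R (LR_module R \<Omega>) (LR_module R \<Omega>)\<^esub>
     tensor_op R (LR_module R \<Omega>) (LR_module R \<Omega>) (LR_mult R \<Omega>) (LR_vee R \<Omega> \<alpha>)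
       (LR_comult_tree R \<Omega> l) (LR_comult_tree R \<Omega> r)"

definition LR :: "('k, 'r) ring_scheme \<Rightarrow> 'w set \<Rightarrow> ('k, 'w tree \<Rightarrow> 'k, 'w) vee_bialgebra" where
  "LR R \<Omega> =
    \<lparr>carrier = carrier (LR_module R \<Omega>),
     mult = LR_mult R \<Omega>,
     one = free_basis R Leaf,
     zero = zero (LR_module R \<Omega>),
     add = add (LR_module R \<Omega>),
     smult = smult (LR_module R \<Omega>),
     comult = lin_ext R (tensor_module R (LR_module R \<Omega>) (LR_module R \<Omega>)) (LR_comult_tree R \<Omega>),
     counit = lin_ext R (base_algebra R) (\<lambda>T. if T = Leaf then \<one>\<^bsub>R\<^esub> else \<zero>\<^bsub>R\<^esub>),
     vee = LR_vee R \<Omega>\<rparr>"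

end

theory Submission
  imports Defs
begin

text \<open>The tree module is spanned by \<open>|\<close> under the operations \<open>\<or>\<^sub>\<alpha>\<close>, so every identity is checked
  on trees by induction, the root being grafted by \<open>\<or>\<^sub>\<alpha>\<close>. What makes the inductions close are a few
  identities for the bilinear map \<open>G\<^sub>\<alpha> = (\<ast>, \<or>\<^sub>\<alpha>)\<close> on \<open>H \<otimes> H\<close>: it satisfies the \<open>\<or>\<^sub>\<Omega>\<close>-algebra law
  with respect to the product of \<open>H \<otimes> H\<close>, it is natural for \<open>\<Delta> \<otimes> id\<close> and for morphisms, and
  \<open>id \<otimes> \<Delta>\<close> turns it into the sum of its two iterated versions. The antipode is the locally finite
  geometric series in \<open>\<eta>\<epsilon> - id\<close>, which converges because \<open>\<Delta> T - T \<otimes> |\<close> has first components of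
  smaller size. A morphism out of the tree module is determined on trees by recursion; it is
  compatible with counits because the cocycle condition forces \<open>\<epsilon>(x \<or>\<^sub>\<alpha> y) = 0\<close>, and with
  antipodes because both composites are convolution inverses of it.\<close>

section \<open>Linear and bilinear maps\<close>

text \<open>Over an arbitrary commutative ring the elements of a tensor product are cosets without a
  normal form, so nothing is read off from coordinates: two linear maps on a tensor product are
  compared on pure tensors, whose sums exhaust it. There the identities for the grafting map reduce
  to associativity in the first factor and the \<or>-law in the second. Multiplicativity of \<Delta>
  then comes down to matching four terms: with X = l \<or> r, \<Delta> X is X \<otimes> 1 plus a
  grafted part, and in \<Delta> X \<Delta> Y each of the two mixed terms merges with one half of the
  product of the grafted parts. A second constraint is that these lemmas are applied to the trees
  before the trees are known to form a bialgebra. They are therefore stated for structures in which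
  \<Delta> and \<epsilon> are merely algebra homomorphisms. The vanishing of \<epsilon> on graftings
  accordingly has two proofs: for trees it is built into \<epsilon>, for a target it has to be
  extracted from its counit axioms.\<close>

lemma linear_mapsI:
  assumes "\<And>x. x \<in> carrier M \<Longrightarrow> f x \<in> carrier N"
    and "\<And>x y. \<lbrakk>x \<in> carrier M; y \<in> carrier M\<rbrakk> \<Longrightarrow> f (x \<oplus>\<^bsub>M\<^esub> y) = f x \<oplus>\<^bsub>N\<^esub> f y"
    and "\<And>r x. \<lbrakk>r \<in> carrier R; x \<in> carrier M\<rbrakk> \<Longrightarrow> f (r \<odot>\<^bsub>M\<^esub> x) = r \<odot>\<^bsub>N\<^esub> f x"
  shows "f \<in> linear_maps R M N"
  using assms by (simp add: linear_maps_def)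

lemma linear_closed: "\<lbrakk>f \<in> linear_maps R M N; x \<in> carrier M\<rbrakk> \<Longrightarrow> f x \<in> carrier N"
  by (auto simp: linear_maps_def)

lemma linear_add:
  "\<lbrakk>f \<in> linear_maps R M N; x \<in> carrier M; y \<in> carrier M\<rbrakk> \<Longrightarrow> f (x \<oplus>\<^bsub>M\<^esub> y) = f x \<oplus>\<^bsub>N\<^esub> f y"
  by (simp add: linear_maps_def)

lemma linear_smult:
  "\<lbrakk>f \<in> linear_maps R M N; r \<in> carrier R; x \<in> carrier M\<rbrakk> \<Longrightarrow> f (r \<odot>\<^bsub>M\<^esub> x) = r \<odot>\<^bsub>N\<^esub> f x"
  by (simp add: linear_maps_def)

text \<open>Functions are total but \<open>linear_maps\<close> constrains them on the carrier only,
  so linearity passes between functions that agree there. This is needed for lifts, whose values are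
  known only on the carrier, and for restricted maps.\<close>

lemma linear_cong:
  assumes "f \<in> linear_maps R M N" and "module R M" and "\<And>x. x \<in> carrier M \<Longrightarrow> f x = g x"
  shows "g \<in> linear_maps R M N"
proof -
  interpret M: module R M by fact
  show ?thesis using assms by (auto simp: linear_maps_def Pi_iff)
qed

lemma linear_zero:
  assumes "f \<in> linear_maps R M N" "module R M" "module R N"
  shows "f \<zero>\<^bsub>M\<^esub> = \<zero>\<^bsub>N\<^esub>"
proof -
  interpret M: module R M by fact
  interpret N: module R N by fact
  have "f \<zero>\<^bsub>M\<^esub> = f (\<zero>\<^bsub>R\<^esub> \<odot>\<^bsub>M\<^esub> \<zero>\<^bsub>M\<^esub>)" by simp
  also have "\<dots> = \<zero>\<^bsub>R\<^esub> \<odot>\<^bsub>N\<^esub> f \<zero>\<^bsub>M\<^esub>" by (rule linear_smult[OF assms(1)]) auto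
  also have "\<dots> = \<zero>\<^bsub>N\<^esub>" by (simp add: linear_closed[OF assms(1)])
  finally show ?thesis .
qed

lemma linear_minus:
  assumes "f \<in> linear_maps R M N" "module R M" "module R N" "x \<in> carrier M" "y \<in> carrier M"
  shows "f (x \<ominus>\<^bsub>M\<^esub> y) = f x \<ominus>\<^bsub>N\<^esub> f y"
proof -
  interpret M: module R M by fact
  interpret N: module R N by fact
  have "f x = f ((x \<ominus>\<^bsub>M\<^esub> y) \<oplus>\<^bsub>M\<^esub> y)"
    using assms(4,5) by (simp add: M.minus_eq M.a_assoc M.l_neg)
  also have "\<dots> = f (x \<ominus>\<^bsub>M\<^esub> y) \<oplus>\<^bsub>N\<^esub> f y"
    using assms(4,5) by (simp add: linear_add[OF assms(1)])
  finally show ?thesis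
    using assms(4,5) by (simp add: linear_closed[OF assms(1)] N.minus_eq N.a_assoc N.r_neg)
qed

lemma linear_id: "(\<lambda>x. x) \<in> linear_maps R M M"
  by (simp add: linear_maps_def)

lemma linear_compose:
  "\<lbrakk>f \<in> linear_maps R M N; g \<in> linear_maps R N P\<rbrakk> \<Longrightarrow> (\<lambda>x. g (f x)) \<in> linear_maps R M P"
  by (auto simp: linear_maps_def Pi_iff)

lemma linear_zero_fun: "module R N \<Longrightarrow> (\<lambda>_. \<zero>\<^bsub>N\<^esub>) \<in> linear_maps R M N"
proof -
  assume "module R N"
  then interpret N: module R N .
  show ?thesis by (rule linear_mapsI) auto
qed

lemma linear_add_fun:
  assumes "module R M" "module R N" "f \<in> linear_maps R M N" "g \<in> linear_maps R M N"
  shows "(\<lambda>x. f x \<oplus>\<^bsub>N\<^esub> g x) \<in> linear_maps R M N"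
proof -
  interpret M: module R M by fact
  interpret N: module R N by fact
  show ?thesis
    by (rule linear_mapsI)
      (simp_all add: assms linear_closed[OF assms(3)] linear_closed[OF assms(4)]
         linear_add[OF assms(3)] linear_add[OF assms(4)] linear_smult[OF assms(3)]
         linear_smult[OF assms(4)] N.a_ac N.smult_r_distr)
qed

lemma linear_smult_fun:
  assumes "module R M" "module R N" "f \<in> linear_maps R M N" "r \<in> carrier R"
  shows "(\<lambda>x. r \<odot>\<^bsub>N\<^esub> f x) \<in> linear_maps R M N"
proof -
  interpret M: module R M by fact
  interpret N: module R N by fact
  show ?thesis
    by (rule linear_mapsI)
      (simp_all add: assms linear_closed[OF assms(3)] linear_add[OF assms(3)]
         linear_smult[OF assms(3)] N.smult_r_distr N.smult_assoc1[symmetric] M.R.m_comm)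
qed

lemma linear_minus_fun:
  assumes "module R M" "module R N" "f \<in> linear_maps R M N" "g \<in> linear_maps R M N"
  shows "(\<lambda>x. f x \<ominus>\<^bsub>N\<^esub> g x) \<in> linear_maps R M N"
proof -
  interpret M: module R M by fact
  interpret N: module R N by fact
  show ?thesis
    by (rule linear_mapsI)
      (simp_all add: assms linear_closed[OF assms(3)] linear_closed[OF assms(4)] N.minus_eq
         linear_add[OF assms(3)] linear_add[OF assms(4)] linear_smult[OF assms(3)]
         linear_smult[OF assms(4)] N.a_ac N.smult_r_distr N.smult_r_minus N.minus_add)
qed

lemma linear_smult_vector:
  assumes "module R N" "module R M" "f \<in> linear_maps R M (base_algebra R)" "x \<in> carrier N"
  shows "(\<lambda>y. f y \<odot>\<^bsub>N\<^esub> x) \<in> linear_maps R M N"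
proof -
  interpret M: module R M by fact
  interpret N: module R N by fact
  show ?thesis
    using linear_closed[OF assms(3)]
    by (intro linear_mapsI)
      (simp_all add: assms linear_add[OF assms(3)] linear_smult[OF assms(3)] base_algebra_def
         N.smult_l_distr N.smult_assoc1)
qed

lemma bilinear_mapsI:
  assumes "\<And>a. a \<in> carrier M \<Longrightarrow> f a \<in> linear_maps R N P"
    and "\<And>b. b \<in> carrier N \<Longrightarrow> (\<lambda>a. f a b) \<in> linear_maps R M P"
  shows "f \<in> bilinear_maps R M N P"
  using assms by (simp add: bilinear_maps_def)

lemma bilinear_left:
  "\<lbrakk>f \<in> bilinear_maps R M N P; b \<in> carrier N\<rbrakk> \<Longrightarrow> (\<lambda>a. f a b) \<in> linear_maps R M P"
  by (simp add: bilinear_maps_def)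

lemma bilinear_right:
  "\<lbrakk>f \<in> bilinear_maps R M N P; a \<in> carrier M\<rbrakk> \<Longrightarrow> f a \<in> linear_maps R N P"
  by (simp add: bilinear_maps_def)

lemma bilinear_closed:
  "\<lbrakk>f \<in> bilinear_maps R M N P; a \<in> carrier M; b \<in> carrier N\<rbrakk> \<Longrightarrow> f a b \<in> carrier P"
  by (auto simp: bilinear_maps_def linear_maps_def)

lemma bilinear_add_left:
  "\<lbrakk>f \<in> bilinear_maps R M N P; a \<in> carrier M; a' \<in> carrier M; b \<in> carrier N\<rbrakk> \<Longrightarrow>
   f (a \<oplus>\<^bsub>M\<^esub> a') b = f a b \<oplus>\<^bsub>P\<^esub> f a' b"
  by (simp add: bilinear_maps_def linear_maps_def)

lemma bilinear_add_right:
  "\<lbrakk>f \<in> bilinear_maps R M N P; a \<in> carrier M; b \<in> carrier N; b' \<in> carrier N\<rbrakk> \<Longrightarrow>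
   f a (b \<oplus>\<^bsub>N\<^esub> b') = f a b \<oplus>\<^bsub>P\<^esub> f a b'"
  by (simp add: bilinear_maps_def linear_maps_def)

lemma bilinear_smult_left:
  "\<lbrakk>f \<in> bilinear_maps R M N P; r \<in> carrier R; a \<in> carrier M; b \<in> carrier N\<rbrakk> \<Longrightarrow>
   f (r \<odot>\<^bsub>M\<^esub> a) b = r \<odot>\<^bsub>P\<^esub> f a b"
  by (simp add: bilinear_maps_def linear_maps_def)

lemma bilinear_smult_right:
  "\<lbrakk>f \<in> bilinear_maps R M N P; r \<in> carrier R; a \<in> carrier M; b \<in> carrier N\<rbrakk> \<Longrightarrow>
   f a (r \<odot>\<^bsub>N\<^esub> b) = r \<odot>\<^bsub>P\<^esub> f a b"
  by (simp add: bilinear_maps_def linear_maps_def)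

lemma bilinear_compose:
  assumes "f \<in> bilinear_maps R M N P" "g \<in> linear_maps R M' M" "h \<in> linear_maps R N' N"
  shows "(\<lambda>a b. f (g a) (h b)) \<in> bilinear_maps R M' N' P"
proof (rule bilinear_mapsI)
  fix a assume "a \<in> carrier M'"
  then show "(\<lambda>b. f (g a) (h b)) \<in> linear_maps R N' P"
    by (rule linear_compose[OF assms(3) bilinear_right[OF assms(1) linear_closed[OF assms(2)]]])
next
  fix b assume "b \<in> carrier N'"
  then show "(\<lambda>a. f (g a) (h b)) \<in> linear_maps R M' P"
    by (rule linear_compose[OF assms(2) bilinear_left[OF assms(1) linear_closed[OF assms(3)]]])
qed

section \<open>Free modules\<close>

lemma free_module_simps:
  "carrier (free_module R X) =
     {u. (\<forall>x\<in>X. u x \<in> carrier R) \<and> (\<forall>x. x \<notin> X \<longrightarrow> u x = \<zero>\<^bsub>R\<^esub>) \<and> finite {x. u x \<noteq> \<zero>\<^bsub>R\<^esub>}}"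
  "\<zero>\<^bsub>free_module R X\<^esub> = (\<lambda>_. \<zero>\<^bsub>R\<^esub>)"
  "u \<oplus>\<^bsub>free_module R X\<^esub> v = (\<lambda>x. u x \<oplus>\<^bsub>R\<^esub> v x)"
  "r \<odot>\<^bsub>free_module R X\<^esub> u = (\<lambda>x. r \<otimes>\<^bsub>R\<^esub> u x)"
  by (simp_all add: free_module_def)

lemma free_module_closed: "\<lbrakk>cring R; u \<in> carrier (free_module R X)\<rbrakk> \<Longrightarrow> u x \<in> carrier R"
  by (cases "x \<in> X") (auto simp: free_module_simps cring.cring_simprules)

lemma free_module_module:
  assumes "cring R"
  shows "module R (free_module R X)"
proof -
  interpret cring R by fact
  let ?F = "free_module R X"
  note closed = free_module_closed[OF assms]
  have add: "u \<oplus>\<^bsub>?F\<^esub> v \<in> carrier ?F" if "u \<in> carrier ?F" "v \<in> carrier ?F" for u v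
    using that
    by (auto simp: free_module_simps
        intro: finite_subset[of _ "{x. u x \<noteq> \<zero>\<^bsub>R\<^esub>} \<union> {x. v x \<noteq> \<zero>\<^bsub>R\<^esub>}"])
  have smult: "r \<odot>\<^bsub>?F\<^esub> u \<in> carrier ?F" if "u \<in> carrier ?F" "r \<in> carrier R" for u r
    using that by (auto simp: free_module_simps intro: finite_subset[of _ "{x. u x \<noteq> \<zero>\<^bsub>R\<^esub>}"])
  have "abelian_group ?F"
  proof (rule abelian_groupI)
    fix u assume u: "u \<in> carrier ?F"
    have "(\<ominus>\<^bsub>R\<^esub> \<one>\<^bsub>R\<^esub>) \<odot>\<^bsub>?F\<^esub> u \<oplus>\<^bsub>?F\<^esub> u = \<zero>\<^bsub>?F\<^esub>"
      using closed[OF u] by (simp add: free_module_simps l_minus l_neg)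
    then show "\<exists>v\<in>carrier ?F. v \<oplus>\<^bsub>?F\<^esub> u = \<zero>\<^bsub>?F\<^esub>" using smult[OF u] by auto
  next
    fix u v w assume "u \<in> carrier ?F" "v \<in> carrier ?F" "w \<in> carrier ?F"
    then show "u \<oplus>\<^bsub>?F\<^esub> v \<oplus>\<^bsub>?F\<^esub> w = u \<oplus>\<^bsub>?F\<^esub> (v \<oplus>\<^bsub>?F\<^esub> w)" "u \<oplus>\<^bsub>?F\<^esub> v = v \<oplus>\<^bsub>?F\<^esub> u"
      by (auto simp: free_module_simps(2-) closed a_ac)
  next
    fix u assume "u \<in> carrier ?F"
    then show "\<zero>\<^bsub>?F\<^esub> \<oplus>\<^bsub>?F\<^esub> u = u" by (auto simp: free_module_simps(2-) closed)
  qed (auto simp: add, simp add: free_module_simps)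
  then show ?thesis
    by (intro moduleI)
      (auto simp: assms smult, auto simp: free_module_simps(2-) closed l_distr r_distr m_assoc)
qed

lemma free_basis_in_carrier: "\<lbrakk>cring R; x \<in> X\<rbrakk> \<Longrightarrow> free_basis R x \<in> carrier (free_module R X)"
proof -
  assume *: "cring R" "x \<in> X"
  interpret cring R by fact
  show ?thesis using *(2)
    by (auto simp: free_module_simps free_basis_def intro: finite_subset[of _ "{x}"])
qed

text \<open>A vector is reduced to zero by erasing one coefficient of its finite support at a
  time.\<close>

lemma free_module_induct:
  assumes R: "cring R" and u: "u \<in> carrier (free_module R X)"
    and zero: "P \<zero>\<^bsub>free_module R X\<^esub>"
    and step: "\<And>r x v. \<lbrakk>r \<in> carrier R; x \<in> X; v \<in> carrier (free_module R X); P v\<rbrakk> \<Longrightarrow>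
      P (r \<odot>\<^bsub>free_module R X\<^esub> free_basis R x \<oplus>\<^bsub>free_module R X\<^esub> v)"
  shows "P u"
proof -
  interpret cring R by fact
  \<comment> \<open>The induction runs over any finite set containing the support, so a point with
    zero coefficient, in particular one outside \<open>X\<close>, can simply be dropped.\<close>
  have "u \<in> carrier (free_module R X) \<Longrightarrow> {x. u x \<noteq> \<zero>\<^bsub>R\<^esub>} \<subseteq> A \<Longrightarrow> P u" if "finite A" for A
    using that
  proof (induction A arbitrary: u)
    case empty
    then have "u = \<zero>\<^bsub>free_module R X\<^esub>" by (auto simp: free_module_simps)
    then show ?case using zero by simp
  next
    case (insert x A)
    show ?case
    proof (cases "x \<in> X")
      case True
      let ?v = "u(x := \<zero>\<^bsub>R\<^esub>)"
      have v: "?v \<in> carrier (free_module R X)"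
        using insert.prems(1)
        by (auto simp: free_module_simps intro: finite_subset[of _ "{x. u x \<noteq> \<zero>\<^bsub>R\<^esub>}"])
      have "P ?v" by (rule insert.IH[OF v]) (use insert.prems in auto)
      then have "P (u x \<odot>\<^bsub>free_module R X\<^esub> free_basis R x \<oplus>\<^bsub>free_module R X\<^esub> ?v)"
        by (intro step v True free_module_closed[OF R insert.prems(1)])
      also have "u x \<odot>\<^bsub>free_module R X\<^esub> free_basis R x \<oplus>\<^bsub>free_module R X\<^esub> ?v = u"
        using free_module_closed[OF R insert.prems(1)]
        by (auto simp: free_module_simps free_basis_def)
      finally show ?thesis .
    next
      case False
      then have "u x = \<zero>\<^bsub>R\<^esub>" using insert.prems by (simp add: free_module_simps)
      then have "{x. u x \<noteq> \<zero>\<^bsub>R\<^esub>} \<subseteq> A" using insert.prems by auto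
      then show ?thesis using insert by blast
    qed
  qed
  moreover have "finite {x. u x \<noteq> \<zero>\<^bsub>R\<^esub>}" using u by (simp add: free_module_simps)
  ultimately show ?thesis using u by blast
qed

text \<open>The support, over which \<open>lin_ext\<close> sums, changes under addition and scaling.
  Summation over any larger finite set makes the sums for several vectors comparable
  termwise.\<close>

lemma lin_ext_finsum:
  assumes "module R M" "u \<in> carrier (free_module R X)" "f \<in> X \<rightarrow> carrier M"
    "finite A" "{x. u x \<noteq> \<zero>\<^bsub>R\<^esub>} \<subseteq> A" "A \<subseteq> X"
  shows "lin_ext R M f u = (\<Oplus>\<^bsub>M\<^esub>x\<in>A. u x \<odot>\<^bsub>M\<^esub> f x)"
proof -
  interpret module R M by fact
  have uc: "u x \<in> carrier R" for x using free_module_closed[OF R.cring_axioms assms(2)] .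
  show ?thesis
    unfolding lin_ext_def
    by (rule M.add.finprod_mono_neutral_cong_left) (use assms uc in \<open>auto simp: Pi_iff subset_iff\<close>)
qed

lemma lin_ext_linear:
  assumes "module R M" "f \<in> X \<rightarrow> carrier M"
  shows "lin_ext R M f \<in> linear_maps R (free_module R X) M"
proof -
  interpret module R M by fact
  interpret F: module R "free_module R X" by (rule free_module_module) (rule R.cring_axioms)
  let ?F = "free_module R X"
  note ext = lin_ext_finsum[OF assms(1) _ assms(2)]
  have uc: "u x \<in> carrier R" if "u \<in> carrier ?F" for u x
    using free_module_closed[OF R.cring_axioms that] .
  have fin: "finite {x. u x \<noteq> \<zero>\<^bsub>R\<^esub>}" "{x. u x \<noteq> \<zero>\<^bsub>R\<^esub>} \<subseteq> X" if "u \<in> carrier ?F" for u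
    using that by (auto simp: free_module_simps)
  have fc: "f x \<in> carrier M" if "x \<in> X" for x using assms(2) that by auto
  show ?thesis
  proof (rule linear_mapsI)
    fix u assume u: "u \<in> carrier ?F"
    show "lin_ext R M f u \<in> carrier M"
      unfolding lin_ext_def using fin[OF u] uc[OF u] fc by (intro M.finsum_closed) auto
  next
    fix u v assume u: "u \<in> carrier ?F" and v: "v \<in> carrier ?F"
    define A where "A = {x. u x \<noteq> \<zero>\<^bsub>R\<^esub>} \<union> {x. v x \<noteq> \<zero>\<^bsub>R\<^esub>}"
    have A: "finite A" "A \<subseteq> X" using fin u v by (auto simp: A_def)
    have uf: "(\<lambda>x. u x \<odot>\<^bsub>M\<^esub> f x) \<in> A \<rightarrow> carrier M" "(\<lambda>x. v x \<odot>\<^bsub>M\<^esub> f x) \<in> A \<rightarrow> carrier M"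
      using A uc[OF u] uc[OF v] fc by auto
    have "lin_ext R M f (u \<oplus>\<^bsub>?F\<^esub> v) = (\<Oplus>\<^bsub>M\<^esub>x\<in>A. (u \<oplus>\<^bsub>?F\<^esub> v) x \<odot>\<^bsub>M\<^esub> f x)"
      by (rule ext) (use u v A in \<open>auto simp: A_def\<close>, auto simp: free_module_simps)
    also have "\<dots> = (\<Oplus>\<^bsub>M\<^esub>x\<in>A. u x \<odot>\<^bsub>M\<^esub> f x \<oplus>\<^bsub>M\<^esub> v x \<odot>\<^bsub>M\<^esub> f x)"
      using A uc[OF u] uc[OF v] fc
      by (intro M.finsum_cong') (auto simp: free_module_simps smult_l_distr subset_iff)
    also have "\<dots> = (\<Oplus>\<^bsub>M\<^esub>x\<in>A. u x \<odot>\<^bsub>M\<^esub> f x) \<oplus>\<^bsub>M\<^esub> (\<Oplus>\<^bsub>M\<^esub>x\<in>A. v x \<odot>\<^bsub>M\<^esub> f x)"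
      using uf by (rule M.finsum_addf)
    also have "(\<Oplus>\<^bsub>M\<^esub>x\<in>A. u x \<odot>\<^bsub>M\<^esub> f x) = lin_ext R M f u"
      by (rule ext[symmetric]) (use u A in \<open>auto simp: A_def\<close>)
    also have "(\<Oplus>\<^bsub>M\<^esub>x\<in>A. v x \<odot>\<^bsub>M\<^esub> f x) = lin_ext R M f v"
      by (rule ext[symmetric]) (use v A in \<open>auto simp: A_def\<close>)
    finally show "lin_ext R M f (u \<oplus>\<^bsub>?F\<^esub> v) = lin_ext R M f u \<oplus>\<^bsub>M\<^esub> lin_ext R M f v" .
  next
    fix r u assume r: "r \<in> carrier R" and u: "u \<in> carrier ?F"
    define A where "A = {x. u x \<noteq> \<zero>\<^bsub>R\<^esub>}"
    have A: "finite A" "A \<subseteq> X" using fin u by (auto simp: A_def)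
    have uf: "(\<lambda>x. u x \<odot>\<^bsub>M\<^esub> f x) \<in> A \<rightarrow> carrier M" using A uc[OF u] fc by auto
    have "lin_ext R M f (r \<odot>\<^bsub>?F\<^esub> u) = (\<Oplus>\<^bsub>M\<^esub>x\<in>A. (r \<odot>\<^bsub>?F\<^esub> u) x \<odot>\<^bsub>M\<^esub> f x)"
      by (rule ext) (use u r A in \<open>auto simp: A_def\<close>, auto simp: free_module_simps)
    also have "\<dots> = (\<Oplus>\<^bsub>M\<^esub>x\<in>A. r \<odot>\<^bsub>M\<^esub> (u x \<odot>\<^bsub>M\<^esub> f x))"
      using A r uc[OF u] fc
      by (intro M.finsum_cong') (auto simp: free_module_simps smult_assoc1 subset_iff)
    also have "\<dots> = r \<odot>\<^bsub>M\<^esub> (\<Oplus>\<^bsub>M\<^esub>x\<in>A. u x \<odot>\<^bsub>M\<^esub> f x)"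
      using A r uf by (intro finsum_smult_ldistr[symmetric])
    also have "(\<Oplus>\<^bsub>M\<^esub>x\<in>A. u x \<odot>\<^bsub>M\<^esub> f x) = lin_ext R M f u"
      by (simp add: A_def lin_ext_def)
    finally show "lin_ext R M f (r \<odot>\<^bsub>?F\<^esub> u) = r \<odot>\<^bsub>M\<^esub> lin_ext R M f u" .
  qed
qed

lemma lin_ext_basis:
  assumes "module R M" "x \<in> X" "f x \<in> carrier M"
  shows "lin_ext R M f (free_basis R x) = f x"
proof -
  interpret module R M by fact
  have "lin_ext R M f (free_basis R x) = (\<Oplus>\<^bsub>M\<^esub>y\<in>{x}. free_basis R x y \<odot>\<^bsub>M\<^esub> f y)"
    by (rule lin_ext_finsum[OF assms(1) free_basis_in_carrier[of _ _ "{x}"]])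
      (use R.cring_axioms assms in \<open>auto simp: free_basis_def\<close>)
  also have "\<dots> = f x" using assms by (simp add: free_basis_def)
  finally show ?thesis .
qed

text \<open>The first vector is expanded outermost, so linearity in it is that of
  \<open>lin_ext\<close>. Linearity in the second is shown by induction on the first, starting from
  basis vectors, where a single \<open>lin_ext\<close> remains.\<close>

lemma bilin_ext_bilinear:
  assumes "module R M" "\<And>x y. \<lbrakk>x \<in> X; y \<in> Y\<rbrakk> \<Longrightarrow> f x y \<in> carrier M"
  shows "bilin_ext R M f \<in> bilinear_maps R (free_module R X) (free_module R Y) M"
proof -
  interpret M: module R M by fact
  have R: "cring R" by (rule M.R.cring_axioms)
  interpret F: module R "free_module R X" by (rule free_module_module[OF R])
  interpret G: module R "free_module R Y" by (rule free_module_module[OF R])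
  have inner: "lin_ext R M (f x) \<in> linear_maps R (free_module R Y) M" if "x \<in> X" for x
    using that assms by (intro lin_ext_linear) auto
  have left: "(\<lambda>u. bilin_ext R M f u v) \<in> linear_maps R (free_module R X) M"
    if v: "v \<in> carrier (free_module R Y)" for v
    unfolding bilin_ext_def by (rule lin_ext_linear) (use v assms(1) linear_closed[OF inner] in auto)
  have right: "bilin_ext R M f u \<in> linear_maps R (free_module R Y) M"
    if u: "u \<in> carrier (free_module R X)" for u
  proof (rule free_module_induct[OF R u])
    show "bilin_ext R M f \<zero>\<^bsub>free_module R X\<^esub> \<in> linear_maps R (free_module R Y) M"
      by (rule linear_cong[OF linear_zero_fun])
        (simp_all add: linear_zero[OF left] F.module_axioms G.module_axioms M.module_axioms)
  next
    fix r x v assume *: "r \<in> carrier R" "x \<in> X" "v \<in> carrier (free_module R X)"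
      "bilin_ext R M f v \<in> linear_maps R (free_module R Y) M"
    have basis: "bilin_ext R M f (free_basis R x) w = lin_ext R M (f x) w"
      if "w \<in> carrier (free_module R Y)" for w
      unfolding bilin_ext_def using * that linear_closed[OF inner] assms(1)
      by (subst lin_ext_basis[of R M x X]) auto
    show "bilin_ext R M f (r \<odot>\<^bsub>free_module R X\<^esub> free_basis R x \<oplus>\<^bsub>free_module R X\<^esub> v)
        \<in> linear_maps R (free_module R Y) M"
      by (rule linear_cong[OF linear_add_fun[OF G.module_axioms M.module_axioms
              linear_smult_fun[OF G.module_axioms M.module_axioms inner[OF *(2)] *(1)] *(4)]])
        (simp_all add: * linear_add[OF left] linear_smult[OF left] basis R free_basis_in_carrier
          G.module_axioms)
  qed
  show ?thesis using left right by (intro bilinear_mapsI)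
qed

lemma bilin_ext_basis:
  assumes "module R M" "\<And>x y. \<lbrakk>x \<in> X; y \<in> Y\<rbrakk> \<Longrightarrow> f x y \<in> carrier M" "x \<in> X" "y \<in> Y"
  shows "bilin_ext R M f (free_basis R x) (free_basis R y) = f x y"
proof -
  have "lin_ext R M (f z) (free_basis R y) = f z y" if "z \<in> X" for z
    using that assms by (intro lin_ext_basis[of R M y Y]) auto
  then show ?thesis
    unfolding bilin_ext_def using assms
    by (subst lin_ext_basis[of R M x X]) auto
qed

section \<open>Quotients and tensor products\<close>

lemma submodule_Inter:
  assumes "module R M" "\<S> \<noteq> {}" "\<And>K. K \<in> \<S> \<Longrightarrow> submodule K R M"
  shows "submodule (\<Inter>\<S>) R M"
proof -
  interpret module R M by fact
  note E = submoduleE[OF assms(3)]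
  have zero: "\<zero>\<^bsub>M\<^esub> \<in> K" if "K \<in> \<S>" for K
    using subgroup.one_closed[OF submodule.axioms(1)[OF assms(3)[OF that]]] by simp
  show ?thesis
  proof (rule submoduleI)
    show "\<Inter>\<S> \<subseteq> carrier M" using E(1) assms(2) by blast
  qed (auto simp: zero E(3-5))
qed

lemma module_span_submodule:
  assumes "module R M" "S \<subseteq> carrier M"
  shows "submodule (module_span R M S) R M"
  unfolding module_span_def
  using assms module.carrier_is_submodule[OF assms(1)] by (intro submodule_Inter) auto

lemma module_span_incl: "x \<in> S \<Longrightarrow> x \<in> module_span R M S"
  by (auto simp: module_span_def)

lemma module_span_minimal: "\<lbrakk>submodule K R M; S \<subseteq> K\<rbrakk> \<Longrightarrow> module_span R M S \<subseteq> K"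
  by (auto simp: module_span_def)

lemma linear_kernel_submodule:
  assumes "module R M" "module R N" "f \<in> linear_maps R M N"
  shows "submodule {x \<in> carrier M. f x = \<zero>\<^bsub>N\<^esub>} R M"
proof -
  interpret M: module R M by fact
  interpret N: module R N by fact
  have "f (\<ominus>\<^bsub>M\<^esub> x) = \<zero>\<^bsub>N\<^esub>" if "x \<in> carrier M" "f x = \<zero>\<^bsub>N\<^esub>" for x
    using linear_minus[OF assms(3,1,2), of "\<zero>\<^bsub>M\<^esub>" x] linear_zero[OF assms(3,1,2)] that
    by (simp add: M.minus_eq N.minus_eq)
  then show ?thesis
    by (intro M.submoduleI)
      (auto simp: linear_zero[OF assms(3,1,2)] linear_add[OF assms(3)] linear_smult[OF assms(3)])
qed

lemma quotient_module_simps: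
  "carrier (quotient_module M K) = a_rcosets\<^bsub>M\<^esub> K"
  "\<zero>\<^bsub>quotient_module M K\<^esub> = K"
  "C \<oplus>\<^bsub>quotient_module M K\<^esub> D = C <+>\<^bsub>M\<^esub> D"
  "r \<odot>\<^bsub>quotient_module M K\<^esub> C = (\<Union>x\<in>C. K +>\<^bsub>M\<^esub> (r \<odot>\<^bsub>M\<^esub> x))"
  by (simp_all add: quotient_module_def)

section \<open>Cosets of a submodule and the quotient module\<close>

context
  fixes R :: "('k, 'r) ring_scheme" and M :: "('k, 'a, 'm) module_scheme" and K
  assumes M: "module R M" and K: "submodule K R M"
begin

interpretation M: module R M by (rule M)

interpretation K: abelian_subgroup K M
  using submodule.axioms(1)[OF K]
  by (intro abelian_subgroupI3 additive_subgroup.intro M.abelian_group_axioms)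

lemma coset_in_quotient: "u \<in> carrier M \<Longrightarrow> K +>\<^bsub>M\<^esub> u \<in> carrier (quotient_module M K)"
  by (simp add: quotient_module_simps M.a_rcosetsI K.a_subset)

lemma quotient_cases:
  assumes "C \<in> carrier (quotient_module M K)"
  obtains u where "u \<in> carrier M" "C = K +>\<^bsub>M\<^esub> u"
  using assms by (auto simp: quotient_module_simps A_RCOSETS_def' a_r_coset_def')

lemma coset_add:
  "\<lbrakk>u \<in> carrier M; v \<in> carrier M\<rbrakk> \<Longrightarrow>
   (K +>\<^bsub>M\<^esub> u) \<oplus>\<^bsub>quotient_module M K\<^esub> (K +>\<^bsub>M\<^esub> v) = K +>\<^bsub>M\<^esub> (u \<oplus>\<^bsub>M\<^esub> v)"
  by (simp add: quotient_module_simps K.a_rcos_sum)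

lemma coset_elem:
  assumes "u \<in> carrier M" "x \<in> K +>\<^bsub>M\<^esub> u"
  obtains k where "k \<in> K" "x = k \<oplus>\<^bsub>M\<^esub> u"
  using assms by (auto simp: a_r_coset_def')

lemma coset_self: "u \<in> carrier M \<Longrightarrow> u \<in> K +>\<^bsub>M\<^esub> u"
  by (rule K.a_rcos_self)

lemma coset_shift: "\<lbrakk>k \<in> K; u \<in> carrier M\<rbrakk> \<Longrightarrow> K +>\<^bsub>M\<^esub> (k \<oplus>\<^bsub>M\<^esub> u) = K +>\<^bsub>M\<^esub> u"
  by (rule M.a_repr_independence[symmetric]) (auto simp: a_r_coset_def' intro: K.additive_subgroup_axioms additive_subgroup.a_subgroup)

text \<open>The union defining the scalar multiple has equal members: another representative is k
  \<oplus> u with k in K, and r k lies in K again.\<close>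

lemma coset_smult:
  assumes "r \<in> carrier R" "u \<in> carrier M"
  shows "r \<odot>\<^bsub>quotient_module M K\<^esub> (K +>\<^bsub>M\<^esub> u) = K +>\<^bsub>M\<^esub> (r \<odot>\<^bsub>M\<^esub> u)"
proof -
  have "K +>\<^bsub>M\<^esub> (r \<odot>\<^bsub>M\<^esub> x) = K +>\<^bsub>M\<^esub> (r \<odot>\<^bsub>M\<^esub> u)" if x: "x \<in> K +>\<^bsub>M\<^esub> u" for x
  proof -
    obtain k where k: "k \<in> K" "x = k \<oplus>\<^bsub>M\<^esub> u" using assms(2) x by (rule coset_elem)
    then show ?thesis
      using assms K.a_subset
      by (auto simp: M.smult_r_distr coset_shift M.submoduleE(4)[OF K])
  qed
  then have "(\<Union>x\<in>K +>\<^bsub>M\<^esub> u. K +>\<^bsub>M\<^esub> (r \<odot>\<^bsub>M\<^esub> x)) = (\<Union>x\<in>K +>\<^bsub>M\<^esub> u. K +>\<^bsub>M\<^esub> (r \<odot>\<^bsub>M\<^esub> u))"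
    by (rule SUP_cong[OF refl])
  \<comment> \<open>The union of a constant family is its common value only over a nonempty index
    set.\<close>
  moreover have "K +>\<^bsub>M\<^esub> u \<noteq> {}" using coset_self[OF assms(2)] by blast
  ultimately show ?thesis unfolding quotient_module_simps by simp
qed

lemma coset_zero: "K +>\<^bsub>M\<^esub> \<zero>\<^bsub>M\<^esub> = \<zero>\<^bsub>quotient_module M K\<^esub>"
  using K.a_subset by (simp add: quotient_module_simps)

lemma quotient_module_module: "module R (quotient_module M K)"
proof -
  let ?Q = "quotient_module M K"
  note [simp] = coset_add coset_smult coset_zero[symmetric] coset_in_quotient
  have "abelian_group ?Q"
  proof (rule abelian_groupI)
    fix C assume "C \<in> carrier ?Q"
    then obtain u where u: "u \<in> carrier M" "C = K +>\<^bsub>M\<^esub> u" by (rule quotient_cases)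
    then have "(K +>\<^bsub>M\<^esub> (\<ominus>\<^bsub>M\<^esub> u)) \<oplus>\<^bsub>?Q\<^esub> C = \<zero>\<^bsub>?Q\<^esub>" by (simp add: M.l_neg)
    with u show "\<exists>D\<in>carrier ?Q. D \<oplus>\<^bsub>?Q\<^esub> C = \<zero>\<^bsub>?Q\<^esub>" by (meson M.a_inv_closed coset_in_quotient)
  qed (auto elim!: quotient_cases simp: M.a_ac)
  then show ?thesis
    by (intro moduleI)
      (auto elim!: quotient_cases simp: M.R.cring_axioms M.smult_l_distr M.smult_r_distr M.smult_assoc1)
qed

lemma coset_eqI:
  assumes "u \<in> carrier M" "v \<in> carrier M" "u \<ominus>\<^bsub>M\<^esub> v \<in> K"
  shows "K +>\<^bsub>M\<^esub> u = K +>\<^bsub>M\<^esub> v"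
proof -
  have "u = (u \<ominus>\<^bsub>M\<^esub> v) \<oplus>\<^bsub>M\<^esub> v" using assms by (simp add: M.minus_eq M.a_assoc M.l_neg)
  then show ?thesis using coset_shift[OF assms(3,2)] by simp
qed

end

section \<open>The tensor product of two modules and its universal property\<close>

context
  fixes R :: "('k, 'r) ring_scheme" and M :: "('k, 'a, 'm) module_scheme"
    and N :: "('k, 'b, 'n) module_scheme"
  assumes M: "module R M" and N: "module R N"
begin

interpretation M: module R M by (rule M)
interpretation N: module R N by (rule N)

interpretation F: module R "tensor_free R M N"
  unfolding tensor_free_def by (rule free_module_module) (rule M.R.cring_axioms)

lemma tensor_free_basis:
  "\<lbrakk>a \<in> carrier M; b \<in> carrier N\<rbrakk> \<Longrightarrow> free_basis R (a, b) \<in> carrier (tensor_free R M N)"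
  unfolding tensor_free_def by (rule free_basis_in_carrier) (auto simp: M.R.cring_axioms)

lemma tensor_relations_subset: "tensor_relations R M N \<subseteq> carrier (tensor_free R M N)"
  by (auto simp: tensor_relations_def Let_def tensor_free_basis)

lemma tensor_kernel_submodule: "submodule (tensor_kernel R M N) R (tensor_free R M N)"
  unfolding tensor_kernel_def
  by (rule module_span_submodule[OF F.module_axioms tensor_relations_subset])

lemma tensor_module_module: "module R (tensor_module R M N)"
  unfolding tensor_module_def
  by (rule quotient_module_module[OF F.module_axioms tensor_kernel_submodule])

interpretation T: module R "tensor_module R M N" by (rule tensor_module_module)

text \<open>Each of the four laws compares two cosets whose representatives differ by a member of
  one of the four families generating the kernel; the remaining goals are closure.\<close>

lemma pure_tensor_bilinear:
  "pure_tensor R M N \<in> bilinear_maps R M N (tensor_module R M N)"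
proof -
  note eq = coset_eqI[OF F.module_axioms tensor_kernel_submodule]
  note [simp] = tensor_free_basis coset_in_quotient[OF F.module_axioms tensor_kernel_submodule]
  note [simp] = coset_add[OF F.module_axioms tensor_kernel_submodule]
    coset_smult[OF F.module_axioms tensor_kernel_submodule]
  note incl = module_span_incl[of _ "tensor_relations R M N" R "tensor_free R M N", folded tensor_kernel_def]
  show ?thesis
    unfolding pure_tensor_def tensor_module_def
  proof (intro bilinear_mapsI linear_mapsI, goal_cases)
    case (2 a b b')
    then show ?case
      by (simp, intro eq incl) (auto simp: tensor_relations_def Let_def)
  next
    case (3 a r b)
    then show ?case
      by (simp, intro eq incl) (auto simp: tensor_relations_def Let_def)
  next
    case (5 b a a')
    then show ?case
      by (simp, intro eq incl) (auto simp: tensor_relations_def Let_def)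
  next
    case (6 b r a)
    then show ?case
      by (simp, intro eq incl) (auto simp: tensor_relations_def Let_def)
  qed auto
qed

lemmas pure_tensor_closed = bilinear_closed[OF pure_tensor_bilinear]

text \<open>Clauses for zero and for scalars are absent because the zero tensor and every multiple
  of a pure tensor are pure again: a scalar is absorbed into the first component.\<close>

lemma tensor_induct [consumes 1, case_names pure add]:
  assumes t: "t \<in> carrier (tensor_module R M N)"
    and pure: "\<And>a b. \<lbrakk>a \<in> carrier M; b \<in> carrier N\<rbrakk> \<Longrightarrow> P (pure_tensor R M N a b)"
    and add: "\<And>s t. \<lbrakk>s \<in> carrier (tensor_module R M N); t \<in> carrier (tensor_module R M N); P s; P t\<rbrakk>
      \<Longrightarrow> P (s \<oplus>\<^bsub>tensor_module R M N\<^esub> t)"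
  shows "P t"
proof -
  let ?F = "tensor_free R M N" let ?K = "tensor_kernel R M N"
  note [simp] = coset_in_quotient[OF F.module_axioms tensor_kernel_submodule, folded tensor_module_def]
    coset_add[OF F.module_axioms tensor_kernel_submodule, folded tensor_module_def, symmetric]
    coset_smult[OF F.module_axioms tensor_kernel_submodule, folded tensor_module_def, symmetric]
  obtain u where u: "u \<in> carrier ?F" and tu: "t = ?K +>\<^bsub>?F\<^esub> u"
    using quotient_cases[OF F.module_axioms tensor_kernel_submodule] t by (auto simp: tensor_module_def)
  have "P (?K +>\<^bsub>?F\<^esub> u)"
  proof (rule free_module_induct[OF M.R.cring_axioms u[unfolded tensor_free_def], folded tensor_free_def])
    have "pure_tensor R M N \<zero>\<^bsub>M\<^esub> \<zero>\<^bsub>N\<^esub> = \<zero>\<^bsub>tensor_module R M N\<^esub>"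
      by (rule linear_zero[OF bilinear_right[OF pure_tensor_bilinear]])
        (auto simp: M N tensor_module_module)
    then show "P (?K +>\<^bsub>?F\<^esub> \<zero>\<^bsub>?F\<^esub>)"
      using pure[of "\<zero>\<^bsub>M\<^esub>" "\<zero>\<^bsub>N\<^esub>"]
      by (simp add: coset_zero[OF F.module_axioms tensor_kernel_submodule] tensor_module_def)
  next
    fix r x v assume *: "r \<in> carrier R" "x \<in> carrier M \<times> carrier N" "v \<in> carrier ?F"
      "P (?K +>\<^bsub>?F\<^esub> v)"
    obtain a b where x: "x = (a, b)" "a \<in> carrier M" "b \<in> carrier N" using *(2) by auto
    have "?K +>\<^bsub>?F\<^esub> (r \<odot>\<^bsub>?F\<^esub> free_basis R x) = pure_tensor R M N (r \<odot>\<^bsub>M\<^esub> a) b"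
      using *(1) x
      by (simp add: bilinear_smult_left[OF pure_tensor_bilinear] tensor_free_basis
          flip: pure_tensor_def)
    then have "P (?K +>\<^bsub>?F\<^esub> (r \<odot>\<^bsub>?F\<^esub> free_basis R x))" using pure * x by simp
    then show "P (?K +>\<^bsub>?F\<^esub> (r \<odot>\<^bsub>?F\<^esub> free_basis R x \<oplus>\<^bsub>?F\<^esub> v))"
      using * x
      by (simp add: tensor_free_basis del: coset_smult[OF F.module_axioms tensor_kernel_submodule, folded tensor_module_def, symmetric])
        (intro add, auto simp: tensor_free_basis)
  qed
  then show ?thesis using tu by simp
qed

lemma tensor_linear_eqI:
  assumes "f \<in> linear_maps R (tensor_module R M N) P" "g \<in> linear_maps R (tensor_module R M N) P"
    and "\<And>a b. \<lbrakk>a \<in> carrier M; b \<in> carrier N\<rbrakk> \<Longrightarrow> f (pure_tensor R M N a b) = g (pure_tensor R M N a b)"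
    and "t \<in> carrier (tensor_module R M N)"
  shows "f t = g t"
  using assms(4)
  by (induction rule: tensor_induct) (simp_all add: assms(3) linear_add[OF assms(1)] linear_add[OF assms(2)])

context
  fixes P :: "('k, 'c, 'p) module_scheme" and f
  assumes P: "module R P" and f: "f \<in> bilinear_maps R M N P"
begin

interpretation P: module R P by (rule P)

lemma tensor_free_lift_linear:
  "lin_ext R P (\<lambda>(a, b). f a b) \<in> linear_maps R (tensor_free R M N) P"
  unfolding tensor_free_def
  by (rule lin_ext_linear[OF P]) (auto simp: bilinear_closed[OF f])

lemma tensor_free_lift_basis:
  "\<lbrakk>a \<in> carrier M; b \<in> carrier N\<rbrakk> \<Longrightarrow> lin_ext R P (\<lambda>(a, b). f a b) (free_basis R (a, b)) = f a b"
  by (subst lin_ext_basis[OF P, of _ "carrier M \<times> carrier N"]) (auto simp: bilinear_closed[OF f])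

text \<open>Bilinearity of f says exactly that the linear extension kills the generating relations.
  Its kernel is a submodule, hence contains their span.\<close>

lemma tensor_kernel_lift:
  "k \<in> tensor_kernel R M N \<Longrightarrow> lin_ext R P (\<lambda>(a, b). f a b) k = \<zero>\<^bsub>P\<^esub>"
proof -
  let ?L = "lin_ext R P (\<lambda>(a, b). f a b)"
  have "tensor_relations R M N \<subseteq> {u \<in> carrier (tensor_free R M N). ?L u = \<zero>\<^bsub>P\<^esub>}"
  proof
    fix u assume u: "u \<in> tensor_relations R M N"
    then have "?L u = \<zero>\<^bsub>P\<^esub>"
      unfolding tensor_relations_def Let_def
      by (auto simp: tensor_free_basis linear_minus[OF tensor_free_lift_linear F.module_axioms P]
          linear_add[OF tensor_free_lift_linear] linear_smult[OF tensor_free_lift_linear]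
          tensor_free_lift_basis bilinear_add_left[OF f] bilinear_add_right[OF f]
          bilinear_smult_left[OF f] bilinear_smult_right[OF f] P.minus_eq P.r_neg bilinear_closed[OF f])
    then show "u \<in> {u \<in> carrier (tensor_free R M N). ?L u = \<zero>\<^bsub>P\<^esub>}"
      using u tensor_relations_subset by auto
  qed
  then have "tensor_kernel R M N \<subseteq> {u \<in> carrier (tensor_free R M N). ?L u = \<zero>\<^bsub>P\<^esub>}"
    unfolding tensor_kernel_def
    by (intro module_span_minimal linear_kernel_submodule F.module_axioms P tensor_free_lift_linear)
  then show "k \<in> tensor_kernel R M N \<Longrightarrow> ?L k = \<zero>\<^bsub>P\<^esub>" by auto
qed

lemma tensor_lift_coset:
  assumes u: "u \<in> carrier (tensor_free R M N)"
  shows "tensor_lift R P f (tensor_kernel R M N +>\<^bsub>tensor_free R M N\<^esub> u) =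
    lin_ext R P (\<lambda>(a, b). f a b) u"
proof -
  let ?L = "lin_ext R P (\<lambda>(a, b). f a b)" and ?K = "tensor_kernel R M N" and ?F = "tensor_free R M N"
  have "?L w = ?L u" if w: "w \<in> ?K +>\<^bsub>?F\<^esub> u" for w
  proof -
    obtain k where k: "k \<in> ?K" "w = k \<oplus>\<^bsub>?F\<^esub> u"
      using coset_elem[OF F.module_axioms tensor_kernel_submodule u w] by blast
    then have "k \<in> carrier ?F" using F.submoduleE(1)[OF tensor_kernel_submodule] by auto
    with k u show ?thesis
      by (simp add: linear_add[OF tensor_free_lift_linear] tensor_kernel_lift
          linear_closed[OF tensor_free_lift_linear])
  qed
  \<comment> \<open>The coset has a member, which makes the value in the definite description
    unique; over an empty set every c would qualify.\<close>
  moreover have "u \<in> ?K +>\<^bsub>?F\<^esub> u"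
    by (rule coset_self[OF F.module_axioms tensor_kernel_submodule u])
  ultimately have "\<And>c. (\<forall>w\<in>?K +>\<^bsub>?F\<^esub> u. ?L w = c) \<longleftrightarrow> c = ?L u" by (metis (lifting))
  then show ?thesis unfolding tensor_lift_def by simp
qed

lemma tensor_lift_pure:
  "\<lbrakk>a \<in> carrier M; b \<in> carrier N\<rbrakk> \<Longrightarrow> tensor_lift R P f (pure_tensor R M N a b) = f a b"
  unfolding pure_tensor_def by (simp add: tensor_lift_coset tensor_free_basis tensor_free_lift_basis)

lemma tensor_lift_linear: "tensor_lift R P f \<in> linear_maps R (tensor_module R M N) P"
proof -
  note cases = quotient_cases[OF F.module_axioms tensor_kernel_submodule, folded tensor_module_def]
  note [simp] = coset_in_quotient[OF F.module_axioms tensor_kernel_submodule, folded tensor_module_def]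
    coset_add[OF F.module_axioms tensor_kernel_submodule, folded tensor_module_def]
    coset_smult[OF F.module_axioms tensor_kernel_submodule, folded tensor_module_def]
  show ?thesis
    by (rule linear_mapsI)
      (auto elim!: cases simp: tensor_lift_coset linear_closed[OF tensor_free_lift_linear]
        linear_add[OF tensor_free_lift_linear] linear_smult[OF tensor_free_lift_linear])
qed

end

text \<open>For nested lifts: \<open>tensor_op\<close> and \<open>tensor_assoc\<close> lift a
  function that is itself a lift depending on a parameter, and bilinearity of the outer function
  requires the inner lift to be linear in that parameter.\<close>

lemma tensor_lift_linear_param:
  assumes Q: "module R Q" and P: "module R P"
    and bil: "\<And>x. x \<in> carrier Q \<Longrightarrow> f x \<in> bilinear_maps R M N P"
    and lin: "\<And>a b. \<lbrakk>a \<in> carrier M; b \<in> carrier N\<rbrakk> \<Longrightarrow> (\<lambda>x. f x a b) \<in> linear_maps R Q P"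
    and t: "t \<in> carrier (tensor_module R M N)"
  shows "(\<lambda>x. tensor_lift R P (f x) t) \<in> linear_maps R Q P"
  using t
proof (induction rule: tensor_induct)
  case (pure a b)
  show ?case
    by (rule linear_cong[OF lin[OF pure] Q]) (simp add: tensor_lift_pure[OF P bil] pure)
next
  case (add s t)
  show ?case
    by (rule linear_cong[OF linear_add_fun[OF Q P add.IH] Q])
      (simp add: linear_add[OF tensor_lift_linear[OF P bil]] add)
qed

end

text \<open>Agreement on the carriers first transfers bilinearity to g, without which its lift could
  not be evaluated on pure tensors.\<close>

lemma tensor_lift_cong:
  assumes "\<And>a b. \<lbrakk>a \<in> carrier M; b \<in> carrier N\<rbrakk> \<Longrightarrow> f a b = g a b"
    and "module R M" "module R N" "module R P" "f \<in> bilinear_maps R M N P"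
    and "t \<in> carrier (tensor_module R M N)"
  shows "tensor_lift R P f t = tensor_lift R P g t"
proof -
  interpret M: module R M by fact
  interpret N: module R N by fact
  have g: "g \<in> bilinear_maps R M N P"
  proof (rule bilinear_mapsI)
    fix a assume "a \<in> carrier M"
    then show "g a \<in> linear_maps R N P"
      by (intro linear_cong[OF bilinear_right[OF assms(5)] assms(3)]) (auto simp: assms(1))
  next
    fix b assume "b \<in> carrier N"
    then show "(\<lambda>a. g a b) \<in> linear_maps R M P"
      by (intro linear_cong[OF bilinear_left[OF assms(5)] assms(2)]) (auto simp: assms(1))
  qed
  show ?thesis
    by (rule tensor_linear_eqI[OF assms(2,3) tensor_lift_linear[OF assms(2,3,4,5)]
          tensor_lift_linear[OF assms(2,3,4) g] _ assms(6)])
      (simp add: tensor_lift_pure[OF assms(2,3,4,5)] tensor_lift_pure[OF assms(2,3,4) g] assms(1))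
qed

section \<open>Maps between tensor products\<close>

lemma tensor_map_bilinear:
  assumes "module R M" "module R N" "module R M'" "module R N'"
    and "f \<in> linear_maps R M M'" "g \<in> linear_maps R N N'"
  shows "(\<lambda>a b. pure_tensor R M' N' (f a) (g b)) \<in> bilinear_maps R M N (tensor_module R M' N')"
  by (rule bilinear_compose[OF pure_tensor_bilinear[OF assms(3,4)] assms(5,6)])

lemma tensor_map_linear:
  assumes "module R M" "module R N" "module R M'" "module R N'"
    and "f \<in> linear_maps R M M'" "g \<in> linear_maps R N N'"
  shows "tensor_map R M' N' f g \<in> linear_maps R (tensor_module R M N) (tensor_module R M' N')"
  unfolding tensor_map_def
  by (rule tensor_lift_linear[OF assms(1,2) tensor_module_module[OF assms(3,4)] tensor_map_bilinear[OF assms]])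

lemma tensor_map_pure:
  assumes "module R M" "module R N" "module R M'" "module R N'"
    and "f \<in> linear_maps R M M'" "g \<in> linear_maps R N N'" "a \<in> carrier M" "b \<in> carrier N"
  shows "tensor_map R M' N' f g (pure_tensor R M N a b) = pure_tensor R M' N' (f a) (g b)"
  unfolding tensor_map_def
  by (rule tensor_lift_pure[OF assms(1,2) tensor_module_module[OF assms(3,4)]
        tensor_map_bilinear[OF assms(1-6)] assms(7,8)])

section \<open>Componentwise bilinear operations on a tensor product\<close>

context
  fixes R :: "('k, 'r) ring_scheme" and M :: "('k, 'a, 'm) module_scheme"
    and N :: "('k, 'b, 'n) module_scheme" and f g
  assumes M: "module R M" and N: "module R N"
    and f: "f \<in> bilinear_maps R M M M" and g: "g \<in> bilinear_maps R N N N"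
begin

interpretation T: module R "tensor_module R M N" by (rule tensor_module_module[OF M N])

lemma tensor_op_inner_bilinear:
  "\<lbrakk>a \<in> carrier M; b \<in> carrier N\<rbrakk> \<Longrightarrow>
   (\<lambda>c d. pure_tensor R M N (f a c) (g b d)) \<in> bilinear_maps R M N (tensor_module R M N)"
  by (rule bilinear_compose[OF pure_tensor_bilinear[OF M N] bilinear_right[OF f] bilinear_right[OF g]])

lemma tensor_op_outer_bilinear:
  assumes t: "t \<in> carrier (tensor_module R M N)"
  shows "(\<lambda>a b. tensor_lift R (tensor_module R M N) (\<lambda>c d. pure_tensor R M N (f a c) (g b d)) t)
    \<in> bilinear_maps R M N (tensor_module R M N)"
proof (rule bilinear_mapsI)
  fix a assume a: "a \<in> carrier M"
  show "(\<lambda>b. tensor_lift R (tensor_module R M N) (\<lambda>c d. pure_tensor R M N (f a c) (g b d)) t)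
    \<in> linear_maps R N (tensor_module R M N)"
  proof (rule tensor_lift_linear_param[OF M N N T.module_axioms _ _ t])
    fix c d assume "c \<in> carrier M" "d \<in> carrier N"
    then show "(\<lambda>b. pure_tensor R M N (f a c) (g b d)) \<in> linear_maps R N (tensor_module R M N)"
      using a by (intro linear_compose[OF bilinear_left[OF g] bilinear_right[OF pure_tensor_bilinear[OF M N]]]
        bilinear_closed[OF f])
  qed (use a tensor_op_inner_bilinear in blast)
next
  fix b assume b: "b \<in> carrier N"
  show "(\<lambda>a. tensor_lift R (tensor_module R M N) (\<lambda>c d. pure_tensor R M N (f a c) (g b d)) t)
    \<in> linear_maps R M (tensor_module R M N)"
  proof (rule tensor_lift_linear_param[OF M N M T.module_axioms _ _ t])
    fix c d assume "c \<in> carrier M" "d \<in> carrier N"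
    then show "(\<lambda>a. pure_tensor R M N (f a c) (g b d)) \<in> linear_maps R M (tensor_module R M N)"
      using b by (intro linear_compose[OF bilinear_left[OF f] bilinear_left[OF pure_tensor_bilinear[OF M N]]]
        bilinear_closed[OF g])
  qed (use b tensor_op_inner_bilinear in blast)
qed

lemma tensor_op_bilinear:
  "tensor_op R M N f g
    \<in> bilinear_maps R (tensor_module R M N) (tensor_module R M N) (tensor_module R M N)"
  unfolding tensor_op_def Let_def
proof (rule bilinear_mapsI)
  fix t assume t: "t \<in> carrier (tensor_module R M N)"
  show "(\<lambda>s. tensor_lift R (tensor_module R M N) (\<lambda>a b. tensor_lift R (tensor_module R M N)
          (\<lambda>c d. pure_tensor R M N (f a c) (g b d)) t) s)
        \<in> linear_maps R (tensor_module R M N) (tensor_module R M N)"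
    by (rule tensor_lift_linear[OF M N T.module_axioms tensor_op_outer_bilinear[OF t]])
next
  fix s assume s: "s \<in> carrier (tensor_module R M N)"
  show "(\<lambda>t. tensor_lift R (tensor_module R M N) (\<lambda>a b. tensor_lift R (tensor_module R M N)
          (\<lambda>c d. pure_tensor R M N (f a c) (g b d)) t) s)
        \<in> linear_maps R (tensor_module R M N) (tensor_module R M N)"
    by (rule tensor_lift_linear_param[OF M N T.module_axioms T.module_axioms tensor_op_outer_bilinear
          tensor_lift_linear[OF M N T.module_axioms tensor_op_inner_bilinear] s])
qed

lemma tensor_op_pure:
  assumes "a \<in> carrier M" "b \<in> carrier N" "c \<in> carrier M" "d \<in> carrier N"
  shows "tensor_op R M N f g (pure_tensor R M N a b) (pure_tensor R M N c d) =
    pure_tensor R M N (f a c) (g b d)"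
  unfolding tensor_op_def Let_def
  using assms
  by (simp add: tensor_lift_pure[OF M N T.module_axioms] tensor_op_outer_bilinear
      tensor_op_inner_bilinear pure_tensor_closed[OF M N])

end

section \<open>The associativity isomorphism\<close>

context
  fixes R :: "('k, 'r) ring_scheme" and M :: "('k, 'a, 'm) module_scheme"
    and N :: "('k, 'b, 'n) module_scheme" and P :: "('k, 'c, 'p) module_scheme"
  assumes M: "module R M" and N: "module R N" and P: "module R P"
begin

text \<open>A map that is linear in each of three arguments factors through the tensor product of
  the first two and stays bilinear in the result and the third.\<close>

lemma tensor_assoc_inner:
  assumes Q: "module R Q"
    and 1: "\<And>b c. \<lbrakk>b \<in> carrier N; c \<in> carrier P\<rbrakk> \<Longrightarrow> (\<lambda>a. f a b c) \<in> linear_maps R M Q"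
    and 2: "\<And>a c. \<lbrakk>a \<in> carrier M; c \<in> carrier P\<rbrakk> \<Longrightarrow> (\<lambda>b. f a b c) \<in> linear_maps R N Q"
    and 3: "\<And>a b. \<lbrakk>a \<in> carrier M; b \<in> carrier N\<rbrakk> \<Longrightarrow> (\<lambda>c. f a b c) \<in> linear_maps R P Q"
  shows "(\<lambda>t c. tensor_lift R Q (\<lambda>a b. f a b c) t) \<in> bilinear_maps R (tensor_module R M N) P Q"
proof (rule bilinear_mapsI)
  have bil: "(\<lambda>a b. f a b c) \<in> bilinear_maps R M N Q" if "c \<in> carrier P" for c
    using that 1 2 by (intro bilinear_mapsI)
  fix t assume "t \<in> carrier (tensor_module R M N)"
  then show "(\<lambda>c. tensor_lift R Q (\<lambda>a b. f a b c) t) \<in> linear_maps R P Q"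
    by (intro tensor_lift_linear_param[OF M N P Q bil 3])
next
  fix c assume "c \<in> carrier P"
  then show "(\<lambda>t. tensor_lift R Q (\<lambda>a b. f a b c) t) \<in> linear_maps R (tensor_module R M N) Q"
    by (intro tensor_lift_linear[OF M N Q] bilinear_mapsI 1 2)
qed

lemma tensor_assoc_bilinear:
  "(\<lambda>t c. tensor_lift R (tensor_module R M (tensor_module R N P))
      (\<lambda>a b. pure_tensor R M (tensor_module R N P) a (pure_tensor R N P b c)) t)
   \<in> bilinear_maps R (tensor_module R M N) P (tensor_module R M (tensor_module R N P))"
proof -
  let ?NP = "tensor_module R N P"
  have NP: "module R ?NP" by (rule tensor_module_module[OF N P])
  note b1 = pure_tensor_bilinear[OF M NP] and b2 = pure_tensor_bilinear[OF N P]
  show ?thesis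
    by (rule tensor_assoc_inner[OF tensor_module_module[OF M NP]
          bilinear_left[OF b1 bilinear_closed[OF b2]]
          linear_compose[OF bilinear_left[OF b2] bilinear_right[OF b1]]
          linear_compose[OF bilinear_right[OF b2] bilinear_right[OF b1]]])
qed

lemma tensor_assoc_linear:
  "tensor_assoc R M N P \<in> linear_maps R (tensor_module R (tensor_module R M N) P)
     (tensor_module R M (tensor_module R N P))"
  unfolding tensor_assoc_def Let_def
  by (rule tensor_lift_linear[OF tensor_module_module[OF M N] P
        tensor_module_module[OF M tensor_module_module[OF N P]] tensor_assoc_bilinear])

lemma tensor_assoc_pure:
  assumes "a \<in> carrier M" "b \<in> carrier N" "c \<in> carrier P"
  shows "tensor_assoc R M N P (pure_tensor R (tensor_module R M N) P (pure_tensor R M N a b) c) =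
    pure_tensor R M (tensor_module R N P) a (pure_tensor R N P b c)"
proof -
  let ?NP = "tensor_module R N P" let ?Q = "tensor_module R M ?NP"
  have NP: "module R ?NP" and MN: "module R (tensor_module R M N)"
    by (intro tensor_module_module M N P)+
  have Q: "module R ?Q" by (rule tensor_module_module[OF M NP])
  have bil: "(\<lambda>a b. pure_tensor R M ?NP a (pure_tensor R N P b c)) \<in> bilinear_maps R M N ?Q"
    by (rule bilinear_compose[OF pure_tensor_bilinear[OF M NP] linear_id
          bilinear_left[OF pure_tensor_bilinear[OF N P] assms(3)]])
  show ?thesis
    unfolding tensor_assoc_def Let_def
    by (simp add: tensor_lift_pure[OF MN P Q tensor_assoc_bilinear] assms
        pure_tensor_closed[OF M N] tensor_lift_pure[OF M N Q bil])
qed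

end

section \<open>Convolution\<close>

lemma base_algebra_simps:
  "carrier (base_algebra R) = carrier R" "\<zero>\<^bsub>base_algebra R\<^esub> = \<zero>\<^bsub>R\<^esub>" "\<one>\<^bsub>base_algebra R\<^esub> = \<one>\<^bsub>R\<^esub>"
  "x \<oplus>\<^bsub>base_algebra R\<^esub> y = x \<oplus>\<^bsub>R\<^esub> y" "x \<otimes>\<^bsub>base_algebra R\<^esub> y = x \<otimes>\<^bsub>R\<^esub> y"
  "x \<odot>\<^bsub>base_algebra R\<^esub> y = x \<otimes>\<^bsub>R\<^esub> y"
  by (simp_all add: base_algebra_def)

lemma base_algebra_module:
  assumes "cring R"
  shows "module R (base_algebra R)"
proof -
  interpret cring R by fact
  have "abelian_group (base_algebra R)"
    by (rule abelian_groupI) (auto simp: base_algebra_simps a_ac intro: bexI[of _ "\<ominus>\<^bsub>R\<^esub> _"] l_neg)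
  then show ?thesis
    by (intro moduleI) (auto simp: base_algebra_simps assms l_distr r_distr m_assoc)
qed

lemma tensor_algebra_simps:
  "carrier (tensor_algebra R A B) = carrier (tensor_module R A B)"
  "add (tensor_algebra R A B) = add (tensor_module R A B)"
  "smult (tensor_algebra R A B) = smult (tensor_module R A B)"
  "mult (tensor_algebra R A B) = tensor_op R A B (mult A) (mult B)"
  "one (tensor_algebra R A B) = pure_tensor R A B \<one>\<^bsub>A\<^esub> \<one>\<^bsub>B\<^esub>"
  by (simp_all add: tensor_algebra_def)

lemma algebra_hom_linear: "f \<in> algebra_hom R A B \<Longrightarrow> f \<in> linear_maps R A B"
  by (simp add: algebra_hom_def)

lemma algebra_hom_mult:
  "\<lbrakk>f \<in> algebra_hom R A B; x \<in> carrier A; y \<in> carrier A\<rbrakk> \<Longrightarrow> f (x \<otimes>\<^bsub>A\<^esub> y) = f x \<otimes>\<^bsub>B\<^esub> f y"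
  by (simp add: algebra_hom_def ring_hom_def)

lemma algebra_hom_one: "f \<in> algebra_hom R A B \<Longrightarrow> f \<one>\<^bsub>A\<^esub> = \<one>\<^bsub>B\<^esub>"
  by (simp add: algebra_hom_def ring_hom_def)

lemma algebra_homI:
  assumes "f \<in> linear_maps R A B" "f \<one>\<^bsub>A\<^esub> = \<one>\<^bsub>B\<^esub>"
    and "\<And>x y. \<lbrakk>x \<in> carrier A; y \<in> carrier A\<rbrakk> \<Longrightarrow> f (x \<otimes>\<^bsub>A\<^esub> y) = f x \<otimes>\<^bsub>B\<^esub> f y"
  shows "f \<in> algebra_hom R A B"
  using assms by (auto simp: algebra_hom_def ring_hom_def linear_maps_def)

lemma (in unital_algebra) module_A: "module R A"
  by (rule module_axioms)

lemma (in unital_algebra) mult_bilinear: "mult A \<in> bilinear_maps R A A A"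
  by (intro bilinear_mapsI linear_mapsI)
    (simp_all add: r_distr l_distr smult_mult_left smult_mult_right)

lemma (in unital_algebra) mult_linear_bilinear:
  assumes "f \<in> linear_maps R M A" "g \<in> linear_maps R N A"
  shows "(\<lambda>a b. f a \<otimes>\<^bsub>A\<^esub> g b) \<in> bilinear_maps R M N A"
  by (rule bilinear_compose[OF mult_bilinear assms])

text \<open>The target is an arbitrary algebra and not only \<open>H\<close>: the antipodes of two
  Hopf algebras are compared among the maps from one to the other.\<close>

definition convolution ::
  "('k, 'r) ring_scheme \<Rightarrow> ('k, 'a, 'm) bialgebra_scheme \<Rightarrow> ('k, 'b, 'n) module_scheme \<Rightarrow>
   ('a \<Rightarrow> 'b) \<Rightarrow> ('a \<Rightarrow> 'b) \<Rightarrow> 'a \<Rightarrow> 'b" where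
  "convolution R H A f g h = tensor_lift R A (\<lambda>a b. f a \<otimes>\<^bsub>A\<^esub> g b) (comult H h)"

definition convolution_unit ::
  "('k, 'a, 'm) bialgebra_scheme \<Rightarrow> ('k, 'b, 'n) module_scheme \<Rightarrow> 'a \<Rightarrow> 'b" where
  "convolution_unit H A h = counit H h \<odot>\<^bsub>A\<^esub> \<one>\<^bsub>A\<^esub>"

text \<open>Coassociativity and the counit laws are left out on purpose: the trees satisfy these two
  homomorphism conditions first, and the missing laws are then derived from lemmas proved at this
  level.\<close>

locale algebra_with_coproduct = unital_algebra R H for R (structure) and H (structure) +
  assumes comult_hom: "comult H \<in> algebra_hom R H (tensor_algebra R H H)"
    and counit_hom: "counit H \<in> algebra_hom R H (base_algebra R)"
begin

lemma module_H: "module R H"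
  by (rule module_axioms)

lemma module_HH: "module R (tensor_module R H H)"
  by (rule tensor_module_module[OF module_H module_H])

lemma comult_linear: "comult H \<in> linear_maps R H (tensor_module R H H)"
  using algebra_hom_linear[OF comult_hom] by (simp add: linear_maps_def tensor_algebra_simps)

lemma comult_closed: "h \<in> carrier H \<Longrightarrow> comult H h \<in> carrier (tensor_module R H H)"
  by (rule linear_closed[OF comult_linear])

lemma comult_one: "comult H \<one>\<^bsub>H\<^esub> = pure_tensor R H H \<one>\<^bsub>H\<^esub> \<one>\<^bsub>H\<^esub>"
  using algebra_hom_one[OF comult_hom] by (simp add: tensor_algebra_simps)

lemma comult_mult:
  "\<lbrakk>x \<in> carrier H; y \<in> carrier H\<rbrakk> \<Longrightarrow>
   comult H (x \<otimes>\<^bsub>H\<^esub> y) = tensor_op R H H (mult H) (mult H) (comult H x) (comult H y)"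
  using algebra_hom_mult[OF comult_hom] by (simp add: tensor_algebra_simps)

lemma counit_linear: "counit H \<in> linear_maps R H (base_algebra R)"
  by (rule algebra_hom_linear[OF counit_hom])

lemma counit_closed: "h \<in> carrier H \<Longrightarrow> counit H h \<in> carrier R"
  using linear_closed[OF counit_linear] by (simp add: base_algebra_simps)

lemma counit_smult: "\<lbrakk>r \<in> carrier R; h \<in> carrier H\<rbrakk> \<Longrightarrow> counit H (r \<odot>\<^bsub>H\<^esub> h) = r \<otimes>\<^bsub>R\<^esub> counit H h"
  using linear_smult[OF counit_linear] by (simp add: base_algebra_simps)

lemma counit_add:
  "\<lbrakk>x \<in> carrier H; y \<in> carrier H\<rbrakk> \<Longrightarrow> counit H (x \<oplus>\<^bsub>H\<^esub> y) = counit H x \<oplus>\<^bsub>R\<^esub> counit H y"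
  using linear_add[OF counit_linear] by (simp add: base_algebra_simps)

lemma counit_mult:
  "\<lbrakk>x \<in> carrier H; y \<in> carrier H\<rbrakk> \<Longrightarrow> counit H (x \<otimes>\<^bsub>H\<^esub> y) = counit H x \<otimes>\<^bsub>R\<^esub> counit H y"
  using algebra_hom_mult[OF counit_hom] by (simp add: base_algebra_simps)

lemma counit_one: "counit H \<one>\<^bsub>H\<^esub> = \<one>\<^bsub>R\<^esub>"
  using algebra_hom_one[OF counit_hom] by (simp add: base_algebra_simps)

end

sublocale bialgebra \<subseteq> algebra_with_coproduct
  by unfold_locales (rule comult_hom counit_hom)+

locale bialgebra_and_algebra = H: bialgebra R H + A: unital_algebra R A
  for R (structure) and H (structure) and A (structure)
begin

lemmas AH = H.module_H and AA = A.module_A and AHH = H.module_HH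

lemma convolution_unit_linear: "convolution_unit H A \<in> linear_maps R H A"
  unfolding convolution_unit_def[abs_def]
  by (rule linear_smult_vector[OF AA AH H.counit_linear]) simp

lemma convolution_linear:
  assumes "f \<in> linear_maps R H A" "g \<in> linear_maps R H A"
  shows "convolution R H A f g \<in> linear_maps R H A"
  unfolding convolution_def[abs_def]
  by (rule linear_compose[OF H.comult_linear
        tensor_lift_linear[OF AH AH AA A.mult_linear_bilinear[OF assms]]])

lemma convolution_cong:
  assumes "f \<in> linear_maps R H A" "g \<in> linear_maps R H A" "h \<in> carrier H"
    and "\<And>x. x \<in> carrier H \<Longrightarrow> f x = f' x" "\<And>x. x \<in> carrier H \<Longrightarrow> g x = g' x"
  shows "convolution R H A f g h = convolution R H A f' g' h"
  unfolding convolution_def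
  by (rule tensor_lift_cong[OF _ AH AH AA A.mult_linear_bilinear[OF assms(1,2)] H.comult_closed[OF assms(3)]])
    (simp add: assms(4,5))

text \<open>Since \<epsilon>(a) 1 \<otimes> f(b) multiplies to f(\<epsilon>(a) b), f can be pulled
  out of the lift, leaving the left counit law.\<close>

lemma convolution_unit_left:
  assumes f: "f \<in> linear_maps R H A" and h: "h \<in> carrier H"
  shows "convolution R H A (convolution_unit H A) f h = f h"
proof -
  have bil: "(\<lambda>a b. counit H a \<odot>\<^bsub>H\<^esub> b) \<in> bilinear_maps R H H H"
    by (intro bilinear_mapsI linear_smult_vector[OF AH AH H.counit_linear]
        linear_smult_fun[OF AH AH linear_id] H.counit_closed)
  note bil' = A.mult_linear_bilinear[OF convolution_unit_linear f]
  have "convolution R H A (convolution_unit H A) f h =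
      f (tensor_lift R H (\<lambda>a b. counit H a \<odot>\<^bsub>H\<^esub> b) (comult H h))"
    unfolding convolution_def
    by (rule tensor_linear_eqI[OF AH AH tensor_lift_linear[OF AH AH AA bil']
          linear_compose[OF tensor_lift_linear[OF AH AH AH bil] f] _ H.comult_closed[OF h]])
      (simp only: tensor_lift_pure[OF AH AH AA bil'] tensor_lift_pure[OF AH AH AH bil],
        simp add: convolution_unit_def linear_smult[OF f] H.counit_closed linear_closed[OF f] A.smult_mult_left)
  then show ?thesis by (simp add: H.counit_left h)
qed

lemma convolution_unit_right:
  assumes f: "f \<in> linear_maps R H A" and h: "h \<in> carrier H"
  shows "convolution R H A f (convolution_unit H A) h = f h"
proof -
  have bil: "(\<lambda>a b. counit H b \<odot>\<^bsub>H\<^esub> a) \<in> bilinear_maps R H H H"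
    by (intro bilinear_mapsI linear_smult_vector[OF AH AH H.counit_linear]
        linear_smult_fun[OF AH AH linear_id] H.counit_closed)
  note bil' = A.mult_linear_bilinear[OF f convolution_unit_linear]
  have "convolution R H A f (convolution_unit H A) h =
      f (tensor_lift R H (\<lambda>a b. counit H b \<odot>\<^bsub>H\<^esub> a) (comult H h))"
    unfolding convolution_def
    by (rule tensor_linear_eqI[OF AH AH tensor_lift_linear[OF AH AH AA bil']
          linear_compose[OF tensor_lift_linear[OF AH AH AH bil] f] _ H.comult_closed[OF h]])
      (simp only: tensor_lift_pure[OF AH AH AA bil'] tensor_lift_pure[OF AH AH AH bil],
        simp add: convolution_unit_def linear_smult[OF f] H.counit_closed linear_closed[OF f] A.smult_mult_right)
  then show ?thesis by (simp add: H.counit_right h)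
qed

text \<open>Both sides are a threefold product applied to an iterated coproduct, once bracketed to
  the left and once to the right. Associativity of \<open>A\<close> identifies the two products
  along \<open>tensor_assoc\<close>, coassociativity the two coproducts.\<close>

lemma convolution_assoc:
  assumes f: "f \<in> linear_maps R H A" and g: "g \<in> linear_maps R H A" and k: "k \<in> linear_maps R H A"
    and h: "h \<in> carrier H"
  shows "convolution R H A (convolution R H A f g) k h = convolution R H A f (convolution R H A g k) h"
proof -
  let ?T = "tensor_module R H H"
  define fg where "fg = tensor_lift R A (\<lambda>a b. f a \<otimes>\<^bsub>A\<^esub> g b)"
  define gk where "gk = tensor_lift R A (\<lambda>a b. g a \<otimes>\<^bsub>A\<^esub> k b)"
  note fg_bil = A.mult_linear_bilinear[OF f g] and gk_bil = A.mult_linear_bilinear[OF g k]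
  have fg: "fg \<in> linear_maps R ?T A" and gk: "gk \<in> linear_maps R ?T A"
    unfolding fg_def gk_def by (rule tensor_lift_linear[OF AH AH AA] fg_bil gk_bil)+
  have fg_pure: "fg (pure_tensor R H H a b) = f a \<otimes>\<^bsub>A\<^esub> g b"
    and gk_pure: "gk (pure_tensor R H H a b) = g a \<otimes>\<^bsub>A\<^esub> k b"
    if "a \<in> carrier H" "b \<in> carrier H" for a b
    unfolding fg_def gk_def
    using that by (simp_all only: tensor_lift_pure[OF AH AH AA fg_bil] tensor_lift_pure[OF AH AH AA gk_bil])
  note left_bil = A.mult_linear_bilinear[OF fg k] and right_bil = A.mult_linear_bilinear[OF f gk]
  let ?L = "tensor_lift R A (\<lambda>t c. fg t \<otimes>\<^bsub>A\<^esub> k c)" and ?L' = "tensor_lift R A (\<lambda>a t. f a \<otimes>\<^bsub>A\<^esub> gk t)"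
  have L: "?L \<in> linear_maps R (tensor_module R ?T H) A" and L': "?L' \<in> linear_maps R (tensor_module R H ?T) A"
    by (rule tensor_lift_linear[OF AHH AH AA left_bil] tensor_lift_linear[OF AH AHH AA right_bil])+
  note convs = convolution_linear[OF f g] convolution_linear[OF g k]
  note closed = H.comult_closed linear_closed[OF f] linear_closed[OF g] linear_closed[OF k]
    linear_closed[OF fg] linear_closed[OF gk]
  have conv_eqs: "convolution R H A f g x = fg (comult H x)" "convolution R H A g k x = gk (comult H x)" for x
    by (simp_all add: convolution_def fg_def gk_def)
  have "convolution R H A (convolution R H A f g) k h =
      ?L (tensor_map R ?T H (comult H) (\<lambda>x. x) (comult H h))"
    unfolding convolution_def[of R H A "convolution R H A f g"]
    by (rule tensor_linear_eqI[OF AH AH tensor_lift_linear[OF AH AH AA A.mult_linear_bilinear[OF convs(1) k]]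
          linear_compose[OF tensor_map_linear[OF AH AH AHH AH H.comult_linear linear_id] L] _ H.comult_closed[OF h]])
      (simp only: tensor_lift_pure[OF AH AH AA A.mult_linear_bilinear[OF convs(1) k]],
        simp add: closed conv_eqs tensor_map_pure[OF AH AH AHH AH H.comult_linear linear_id] tensor_lift_pure[OF AHH AH AA left_bil])
  \<comment> \<open>The left component is itself a tensor, so pure tensors have to be inserted twice
    before associativity in \<open>A\<close> applies.\<close>
  also have "\<dots> = ?L' (tensor_assoc R H H H (tensor_map R ?T H (comult H) (\<lambda>x. x) (comult H h)))"
  proof (rule tensor_linear_eqI[OF AHH AH L linear_compose[OF tensor_assoc_linear[OF AH AH AH] L']])
    fix t c assume t: "t \<in> carrier ?T" and c: "c \<in> carrier H"
    have "(\<lambda>t. pure_tensor R ?T H t c) \<in> linear_maps R ?T (tensor_module R ?T H)"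
      by (rule bilinear_left[OF pure_tensor_bilinear[OF AHH AH] c])
    note lin = linear_compose[OF this L]
      linear_compose[OF linear_compose[OF this tensor_assoc_linear[OF AH AH AH]] L']
    show "?L (pure_tensor R ?T H t c) = ?L' (tensor_assoc R H H H (pure_tensor R ?T H t c))"
      by (rule tensor_linear_eqI[OF AH AH lin _ t])
        (simp add: c tensor_assoc_pure[OF AH AH AH] tensor_lift_pure[OF AHH AH AA left_bil]
          tensor_lift_pure[OF AH AHH AA right_bil] pure_tensor_closed[OF AH AH] fg_pure gk_pure A.m_assoc closed)
  qed (rule linear_closed[OF tensor_map_linear[OF AH AH AHH AH H.comult_linear linear_id] H.comult_closed[OF h]])
  also have "\<dots> = ?L' (tensor_map R H ?T (\<lambda>x. x) (comult H) (comult H h))"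
    by (simp add: H.coassoc h)
  also have "\<dots> = convolution R H A f (convolution R H A g k) h"
    unfolding convolution_def[of R H A f "convolution R H A g k"]
    by (rule tensor_linear_eqI[OF AH AH
          linear_compose[OF tensor_map_linear[OF AH AH AH AHH linear_id H.comult_linear] L']
          tensor_lift_linear[OF AH AH AA A.mult_linear_bilinear[OF f convs(2)]] _ H.comult_closed[OF h]])
      (simp only: tensor_lift_pure[OF AH AH AA A.mult_linear_bilinear[OF f convs(2)]],
        simp add: closed conv_eqs tensor_map_pure[OF AH AH AH AHH linear_id H.comult_linear] tensor_lift_pure[OF AH AHH AA right_bil])
  finally show ?thesis .
qed

text \<open>In a monoid a left inverse f and a right inverse k of the same g coincide: f = f \<ast>
  (g \<ast> k) = (f \<ast> g) \<ast> k = k.\<close>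

lemma convolution_inverse_unique:
  assumes f: "f \<in> linear_maps R H A" and g: "g \<in> linear_maps R H A" and k: "k \<in> linear_maps R H A"
    and left: "\<And>h. h \<in> carrier H \<Longrightarrow> convolution R H A f g h = convolution_unit H A h"
    and right: "\<And>h. h \<in> carrier H \<Longrightarrow> convolution R H A g k h = convolution_unit H A h"
    and h: "h \<in> carrier H"
  shows "f h = k h"
proof -
  have "f h = convolution R H A f (convolution_unit H A) h"
    by (simp add: convolution_unit_right f h)
  also have "\<dots> = convolution R H A f (convolution R H A g k) h"
    by (rule convolution_cong[OF f convolution_unit_linear h]) (simp_all add: right)
  also have "\<dots> = convolution R H A (convolution R H A f g) k h"
    by (rule convolution_assoc[OF f g k h, symmetric])
  also have "\<dots> = convolution R H A (convolution_unit H A) k h"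
    by (rule convolution_cong[OF convolution_linear[OF f g] k h]) (simp_all add: left)
  also have "\<dots> = k h" by (simp add: convolution_unit_left k h)
  finally show ?thesis .
qed

lemma convolution_minus_left:
  assumes "f \<in> linear_maps R H A" "g \<in> linear_maps R H A" "k \<in> linear_maps R H A" "h \<in> carrier H"
  shows "convolution R H A (\<lambda>x. f x \<ominus>\<^bsub>A\<^esub> g x) k h = convolution R H A f k h \<ominus>\<^bsub>A\<^esub> convolution R H A g k h"
proof -
  note fg = linear_minus_fun[OF AH AA assms(1,2)]
  note bil = A.mult_linear_bilinear[OF fg assms(3)] A.mult_linear_bilinear[OF assms(1,3)]
    A.mult_linear_bilinear[OF assms(2,3)]
  note lifts = tensor_lift_linear[OF AH AH AA bil(1)] tensor_lift_linear[OF AH AH AA bil(2)]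
    tensor_lift_linear[OF AH AH AA bil(3)]
  show ?thesis
    unfolding convolution_def
    by (rule tensor_linear_eqI[OF AH AH lifts(1) linear_minus_fun[OF AHH AA lifts(2,3)] _
          H.comult_closed[OF assms(4)]])
      (simp only: tensor_lift_pure[OF AH AH AA bil(1)] tensor_lift_pure[OF AH AH AA bil(2)]
        tensor_lift_pure[OF AH AH AA bil(3)], simp add: A.minus_eq A.l_distr A.l_minus
        linear_closed[OF assms(1)] linear_closed[OF assms(2)] linear_closed[OF assms(3)])
qed

lemma convolution_minus_right:
  assumes "f \<in> linear_maps R H A" "g \<in> linear_maps R H A" "k \<in> linear_maps R H A" "h \<in> carrier H"
  shows "convolution R H A k (\<lambda>x. f x \<ominus>\<^bsub>A\<^esub> g x) h = convolution R H A k f h \<ominus>\<^bsub>A\<^esub> convolution R H A k g h"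
proof -
  note fg = linear_minus_fun[OF AH AA assms(1,2)]
  note bil = A.mult_linear_bilinear[OF assms(3) fg] A.mult_linear_bilinear[OF assms(3,1)]
    A.mult_linear_bilinear[OF assms(3,2)]
  note lifts = tensor_lift_linear[OF AH AH AA bil(1)] tensor_lift_linear[OF AH AH AA bil(2)]
    tensor_lift_linear[OF AH AH AA bil(3)]
  show ?thesis
    unfolding convolution_def
    by (rule tensor_linear_eqI[OF AH AH lifts(1) linear_minus_fun[OF AHH AA lifts(2,3)] _
          H.comult_closed[OF assms(4)]])
      (simp only: tensor_lift_pure[OF AH AH AA bil(1)] tensor_lift_pure[OF AH AH AA bil(2)]
        tensor_lift_pure[OF AH AH AA bil(3)], simp add: A.minus_eq A.r_distr A.r_minus
        linear_closed[OF assms(1)] linear_closed[OF assms(2)] linear_closed[OF assms(3)])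
qed

end

text \<open>Both \<open>\<phi> \<circ> S\<close> and \<open>S' \<circ> \<phi>\<close> are convolution inverses of \<open>\<phi>\<close>.\<close>

lemma bialgebra_hom_antipode:
  assumes H: "bialgebra R H" and H': "bialgebra R H'" and hom: "\<phi> \<in> bialgebra_hom R H H'"
    and S: "antipode R H S" and S': "antipode R H' S'" and h: "h \<in> carrier H"
  shows "\<phi> (S h) = S' (\<phi> h)"
proof -
  interpret H: bialgebra R H by (rule H)
  interpret H': bialgebra R H' by (rule H')
  interpret bialgebra_and_algebra R H H' ..
  note M = H.module_H and M' = H'.module_H
  have hom_alg: "\<phi> \<in> algebra_hom R H H'"
    and hom_comult: "\<And>h. h \<in> carrier H \<Longrightarrow> comult H' (\<phi> h) = tensor_map R H' H' \<phi> \<phi> (comult H h)"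
    and hom_counit: "\<And>h. h \<in> carrier H \<Longrightarrow> counit H' (\<phi> h) = counit H h"
    using hom by (auto simp: bialgebra_hom_def)
  note lin = algebra_hom_linear[OF hom_alg]
  have Sl: "S \<in> linear_maps R H H" and Sl': "S' \<in> linear_maps R H' H'"
    using S S' by (auto simp: antipode_def)
  have mult': "(\<lambda>a b. S a \<otimes>\<^bsub>H\<^esub> b) \<in> bilinear_maps R H H H"
    "(\<lambda>a b. a \<otimes>\<^bsub>H'\<^esub> S' b) \<in> bilinear_maps R H' H' H'"
    by (rule H.mult_linear_bilinear[OF Sl linear_id] H'.mult_linear_bilinear[OF linear_id Sl'])+
  have lin1: "(\<lambda>x. \<phi> (S x)) \<in> linear_maps R H H'" and lin2: "(\<lambda>x. S' (\<phi> x)) \<in> linear_maps R H H'"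
    by (rule linear_compose[OF Sl lin] linear_compose[OF lin Sl'])+
  note bil1 = H'.mult_linear_bilinear[OF lin1 lin] and bil2 = H'.mult_linear_bilinear[OF lin lin2]
  \<comment> \<open>Here multiplicativity of \<phi> matters: \<phi>(S a) \<phi>(b) = \<phi>(S(a) b),
    so \<phi> leaves the lift.\<close>
  have left: "convolution R H H' (\<lambda>x. \<phi> (S x)) \<phi> x = convolution_unit H H' x" if x: "x \<in> carrier H" for x
  proof -
    have "convolution R H H' (\<lambda>x. \<phi> (S x)) \<phi> x = \<phi> (tensor_lift R H (\<lambda>a b. S a \<otimes>\<^bsub>H\<^esub> b) (comult H x))"
      unfolding convolution_def
      by (rule tensor_linear_eqI[OF M M tensor_lift_linear[OF M M M' bil1]
            linear_compose[OF tensor_lift_linear[OF M M M mult'(1)] lin] _ H.comult_closed[OF x]])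
        (simp add: tensor_lift_pure[OF M M M' bil1] tensor_lift_pure[OF M M M mult'(1)]
          algebra_hom_mult[OF hom_alg] linear_closed[OF Sl])
    then show ?thesis
      using S x
      by (simp add: antipode_def convolution_unit_def linear_smult[OF lin] algebra_hom_one[OF hom_alg]
          H.counit_closed)
  qed
  \<comment> \<open>Here compatibility with coproducts matters: \<phi> \<otimes> \<phi> carries
    \<Delta> h to the coproduct of \<phi>(h), where the antipode of the target applies.\<close>
  have right: "convolution R H H' \<phi> (\<lambda>x. S' (\<phi> x)) x = convolution_unit H H' x" if x: "x \<in> carrier H" for x
  proof -
    have "convolution R H H' \<phi> (\<lambda>x. S' (\<phi> x)) x =
        tensor_lift R H' (\<lambda>a b. a \<otimes>\<^bsub>H'\<^esub> S' b) (tensor_map R H' H' \<phi> \<phi> (comult H x))"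
      unfolding convolution_def
      by (rule tensor_linear_eqI[OF M M tensor_lift_linear[OF M M M' bil2]
            linear_compose[OF tensor_map_linear[OF M M M' M' lin lin]
              tensor_lift_linear[OF M' M' M' mult'(2)]] _ H.comult_closed[OF x]])
        (simp add: tensor_lift_pure[OF M M M' bil2] tensor_lift_pure[OF M' M' M' mult'(2)]
          tensor_map_pure[OF M M M' M' lin lin] linear_closed[OF lin])
    then show ?thesis
      using S' x linear_closed[OF lin x]
      by (simp add: antipode_def convolution_unit_def hom_comult[symmetric] hom_counit)
  qed
  show ?thesis by (rule convolution_inverse_unique[OF lin1 lin lin2 left right h])
qed

section \<open>Grafting on tensor squares\<close>

text \<open>Stated with separate maps on the two factors because it serves two purposes: \<Delta>
  \<otimes> id, where \<Delta> is multiplicative on the first factor, and the square of the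
  evaluation of trees in a target.\<close>

lemma tensor_map_op:
  assumes M: "module R M" and N: "module R N" and M': "module R M'" and N': "module R N'"
    and f: "f \<in> bilinear_maps R M M M" and g: "g \<in> bilinear_maps R N N N"
    and f': "f' \<in> bilinear_maps R M' M' M'" and g': "g' \<in> bilinear_maps R N' N' N'"
    and p: "p \<in> linear_maps R M M'" and q: "q \<in> linear_maps R N N'"
    and pf: "\<And>a c. \<lbrakk>a \<in> carrier M; c \<in> carrier M\<rbrakk> \<Longrightarrow> p (f a c) = f' (p a) (p c)"
    and qg: "\<And>b d. \<lbrakk>b \<in> carrier N; d \<in> carrier N\<rbrakk> \<Longrightarrow> q (g b d) = g' (q b) (q d)"
    and s: "s \<in> carrier (tensor_module R M N)" and t: "t \<in> carrier (tensor_module R M N)"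
  shows "tensor_map R M' N' p q (tensor_op R M N f g s t) =
    tensor_op R M' N' f' g' (tensor_map R M' N' p q s) (tensor_map R M' N' p q t)"
proof -
  note op = tensor_op_bilinear[OF M N f g] and op' = tensor_op_bilinear[OF M' N' f' g']
  note map = tensor_map_linear[OF M N M' N' p q]
  note rules = linear_add[OF map] linear_closed[OF map] bilinear_closed[OF op] bilinear_closed[OF op']
    bilinear_add_left[OF op] bilinear_add_left[OF op'] bilinear_add_right[OF op] bilinear_add_right[OF op']
  show ?thesis using s
  proof (induction s rule: tensor_induct[OF M N, consumes 1, case_names pure add])
    case (add s1 s2)
    then show ?case using t by (simp add: rules)
  next
    case (pure a b)
    show ?case using t
    proof (induction t rule: tensor_induct[OF M N, consumes 1, case_names pure add])
      case (add t1 t2)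
      then show ?case using pure by (simp add: rules pure_tensor_closed[OF M N])
    next
      case (pure c d)
      then show ?case
        using \<open>a \<in> carrier M\<close> \<open>b \<in> carrier N\<close>
        by (simp add: tensor_op_pure[OF M N f g] tensor_op_pure[OF M' N' f' g']
            tensor_map_pure[OF M N M' N' p q] bilinear_closed[OF f] bilinear_closed[OF g]
            linear_closed[OF p] linear_closed[OF q] pf qg)
    qed
  qed
qed

section \<open>Grafting against multiplication on the tensor square\<close>

context vee_algebra
begin

abbreviation tensor_mult where
  "tensor_mult \<equiv> tensor_op R A A (mult A) (mult A)"

abbreviation tensor_graft where
  "tensor_graft \<alpha> \<equiv> tensor_op R A A (mult A) (V \<alpha>)"

lemma module_AA: "module R (tensor_module R A A)"
  by (rule tensor_module_module[OF module_A module_A])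

lemma tensor_mult_bilinear:
  "tensor_mult \<in> bilinear_maps R (tensor_module R A A) (tensor_module R A A) (tensor_module R A A)"
  by (rule tensor_op_bilinear[OF module_A module_A mult_bilinear mult_bilinear])

lemma tensor_graft_bilinear:
  "\<alpha> \<in> \<Omega> \<Longrightarrow> tensor_graft \<alpha> \<in>
     bilinear_maps R (tensor_module R A A) (tensor_module R A A) (tensor_module R A A)"
  by (rule tensor_op_bilinear[OF module_A module_A mult_bilinear vee_bilinear])

lemma vee_closed: "\<lbrakk>\<alpha> \<in> \<Omega>; a \<in> carrier A; b \<in> carrier A\<rbrakk> \<Longrightarrow> V \<alpha> a b \<in> carrier A"
  by (rule bilinear_closed[OF vee_bilinear])

lemmas tensor_mult_pure = tensor_op_pure[OF module_A module_A mult_bilinear mult_bilinear]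
lemmas tensor_graft_pure = tensor_op_pure[OF module_A module_A mult_bilinear vee_bilinear]

lemmas tensor_mult_rules = bilinear_closed[OF tensor_mult_bilinear]
  bilinear_add_left[OF tensor_mult_bilinear] bilinear_add_right[OF tensor_mult_bilinear]

lemmas tensor_graft_rules = bilinear_closed[OF tensor_graft_bilinear]
  bilinear_add_left[OF tensor_graft_bilinear] bilinear_add_right[OF tensor_graft_bilinear]

lemmas tensor_ind = tensor_induct[OF module_A module_A, consumes 1, case_names pure add]

text \<open>Only the first components see x, and there x(ac) = (xa)c. This treats the mixed terms of
  \<Delta> X \<Delta> Y; the mirror statement pushes a right factor y \<otimes> 1 into the second
  argument instead.\<close>

lemma tensor_mult_left_graft:
  assumes \<alpha>: "\<alpha> \<in> \<Omega>" and x: "x \<in> carrier A"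
    and s: "s \<in> carrier (tensor_module R A A)" and t: "t \<in> carrier (tensor_module R A A)"
  shows "tensor_mult (pure_tensor R A A x \<one>\<^bsub>A\<^esub>) (tensor_graft \<alpha> s t) =
    tensor_graft \<alpha> (tensor_mult (pure_tensor R A A x \<one>\<^bsub>A\<^esub>) s) t"
  using s
proof (induction s rule: tensor_ind)
  case (add s1 s2)
  then show ?case using t \<alpha> x
    by (simp add: tensor_mult_rules tensor_graft_rules pure_tensor_closed[OF module_A module_A])
next
  case (pure a b)
  show ?case using t
  proof (induction t rule: tensor_ind)
    case (add t1 t2)
    then show ?case using pure \<alpha> x
      by (simp add: tensor_mult_rules tensor_graft_rules pure_tensor_closed[OF module_A module_A])
  next
    case (pure c d)
    with \<open>a \<in> carrier A\<close> \<open>b \<in> carrier A\<close> show ?case using \<alpha> x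
      by (simp add: tensor_mult_pure tensor_graft_pure vee_closed m_assoc)
  qed
qed

lemma tensor_mult_right_graft:
  assumes \<alpha>: "\<alpha> \<in> \<Omega>" and y: "y \<in> carrier A"
    and s: "s \<in> carrier (tensor_module R A A)" and t: "t \<in> carrier (tensor_module R A A)"
  shows "tensor_mult (tensor_graft \<alpha> s t) (pure_tensor R A A y \<one>\<^bsub>A\<^esub>) =
    tensor_graft \<alpha> s (tensor_mult t (pure_tensor R A A y \<one>\<^bsub>A\<^esub>))"
  using s
proof (induction s rule: tensor_ind)
  case (add s1 s2)
  then show ?case using t \<alpha> y
    by (simp add: tensor_mult_rules tensor_graft_rules pure_tensor_closed[OF module_A module_A])
next
  case (pure a b)
  show ?case using t
  proof (induction t rule: tensor_ind)
    case (add t1 t2)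
    then show ?case using pure \<alpha> y
      by (simp add: tensor_mult_rules tensor_graft_rules pure_tensor_closed[OF module_A module_A])
  next
    case (pure c d)
    with \<open>a \<in> carrier A\<close> \<open>b \<in> carrier A\<close> show ?case using \<alpha> y
      by (simp add: tensor_mult_pure tensor_graft_pure vee_closed m_assoc)
  qed
qed

text \<open>For pure tensors all three terms have the same fourfold product as first component, and
  the second components are related by the \<or>-law of \<open>A\<close>.\<close>

lemma tensor_mult_graft_graft:
  assumes \<alpha>: "\<alpha> \<in> \<Omega>" and \<beta>: "\<beta> \<in> \<Omega>"
    and s: "s \<in> carrier (tensor_module R A A)" and t: "t \<in> carrier (tensor_module R A A)"
    and s': "s' \<in> carrier (tensor_module R A A)" and t': "t' \<in> carrier (tensor_module R A A)"
  shows "tensor_mult (tensor_graft \<alpha> s t) (tensor_graft \<beta> s' t') =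
    tensor_graft \<alpha> s (tensor_mult t (tensor_graft \<beta> s' t')) \<oplus>\<^bsub>tensor_module R A A\<^esub>
    tensor_graft \<beta> (tensor_mult (tensor_graft \<alpha> s t) s') t'"
proof -
  interpret T: module R "tensor_module R A A" by (rule module_AA)
  note [simp] = \<alpha> \<beta> tensor_mult_rules tensor_graft_rules pure_tensor_closed[OF module_A module_A]
    T.a_ac
  show ?thesis using s
  proof (induction s rule: tensor_ind)
    case (add s1 s2)
    then show ?case using t s' t' by simp
  next
    case ab: (pure a b)
    show ?case using t
    proof (induction t rule: tensor_ind)
      case (add t1 t2)
      then show ?case using s' t' ab by simp
    next
      case cd: (pure c d)
      show ?case using s'
      proof (induction s' rule: tensor_ind)
        case (add s1' s2')
        then show ?case using t' ab cd by simp
      next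
        case ab': (pure a' b')
        show ?case using t'
        proof (induction t' rule: tensor_ind)
          case (add t1' t2')
          then show ?case using ab ab' cd by simp
        next
          case cd': (pure c' d')
          show ?case
            using ab cd ab' cd'
            by (simp add: tensor_mult_pure tensor_graft_pure vee_closed vee_mult m_assoc
                bilinear_add_right[OF pure_tensor_bilinear[OF module_A module_A]])
        qed
      qed
    qed
  qed
qed

end

text \<open>The common ground of the trees, before their coalgebra axioms are known, and of
  arbitrary cocycle bialgebras.\<close>

locale cocycle_vee_algebra = algebra_with_coproduct R H + vee_algebra R H \<Omega> "vee H"
  for R (structure) and \<Omega> and H (structure) +
  assumes cocycle:
    "\<lbrakk>\<alpha> \<in> \<Omega>; h \<in> carrier H; h' \<in> carrier H\<rbrakk> \<Longrightarrow>
     comult H (vee H \<alpha> h h') =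
       pure_tensor R H H (vee H \<alpha> h h') \<one>\<^bsub>H\<^esub>
       \<oplus>\<^bsub>tensor_module R H H\<^esub> tensor_graft \<alpha> (comult H h) (comult H h')"
begin

abbreviation counit_id where
  "counit_id \<equiv> tensor_lift R H (\<lambda>a b. counit H a \<odot>\<^bsub>H\<^esub> b)"

abbreviation id_counit where
  "id_counit \<equiv> tensor_lift R H (\<lambda>a b. counit H b \<odot>\<^bsub>H\<^esub> a)"

lemma counit_id_bilinear: "(\<lambda>a b. counit H a \<odot>\<^bsub>H\<^esub> b) \<in> bilinear_maps R H H H"
  by (intro bilinear_mapsI linear_smult_vector[OF module_A module_A counit_linear]
      linear_smult_fun[OF module_A module_A linear_id] counit_closed)

lemma id_counit_bilinear: "(\<lambda>a b. counit H b \<odot>\<^bsub>H\<^esub> a) \<in> bilinear_maps R H H H"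
  by (intro bilinear_mapsI linear_smult_vector[OF module_A module_A counit_linear]
      linear_smult_fun[OF module_A module_A linear_id] counit_closed)

lemmas counit_id_linear = tensor_lift_linear[OF module_A module_A module_A counit_id_bilinear]
lemmas id_counit_linear = tensor_lift_linear[OF module_A module_A module_A id_counit_bilinear]
lemmas counit_id_pure = tensor_lift_pure[OF module_A module_A module_A counit_id_bilinear]
lemmas id_counit_pure = tensor_lift_pure[OF module_A module_A module_A id_counit_bilinear]

lemmas counit_id_rules = linear_closed[OF counit_id_linear] linear_add[OF counit_id_linear]
lemmas id_counit_rules = linear_closed[OF id_counit_linear] linear_add[OF id_counit_linear]

text \<open>Multiplicativity of \<epsilon> distributes the scalar \<epsilon>(ac) over the two
  arguments of the grafting.\<close>

lemma counit_id_graft: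
  assumes \<alpha>: "\<alpha> \<in> \<Omega>"
    and s: "s \<in> carrier (tensor_module R H H)" and t: "t \<in> carrier (tensor_module R H H)"
  shows "counit_id (tensor_graft \<alpha> s t) = vee H \<alpha> (counit_id s) (counit_id t)"
  using s
proof (induction s rule: tensor_ind)
  case (add s1 s2)
  then show ?case using t \<alpha>
    by (simp add: tensor_graft_rules counit_id_rules bilinear_add_left[OF vee_bilinear])
next
  case ab: (pure a b)
  show ?case using t
  proof (induction t rule: tensor_ind)
    case (add t1 t2)
    then show ?case using ab \<alpha>
      by (simp add: tensor_graft_rules counit_id_rules bilinear_add_right[OF vee_bilinear]
          pure_tensor_closed[OF module_A module_A])
  next
    case (pure c d)
    with ab show ?case using \<alpha>
      by (simp add: tensor_graft_pure counit_id_pure counit_mult counit_closed vee_closed R.m_comm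
          bilinear_smult_left[OF vee_bilinear] bilinear_smult_right[OF vee_bilinear] flip: smult_assoc1)
  qed
qed

text \<open>Both sides are \<epsilon> \<otimes> \<epsilon>, as scalars commute. This is how
  \<open>counit_vee\<close> trades the right counit for the left one, which commutes with
  grafting.\<close>

lemma counit_id_counit_graft:
  assumes \<alpha>: "\<alpha> \<in> \<Omega>"
    and s: "s \<in> carrier (tensor_module R H H)" and t: "t \<in> carrier (tensor_module R H H)"
  shows "counit H (id_counit (tensor_graft \<alpha> s t)) = counit H (counit_id (tensor_graft \<alpha> s t))"
proof -
  have "counit H (id_counit w) = counit H (counit_id w)" if "w \<in> carrier (tensor_module R H H)" for w
    using that
  proof (induction w rule: tensor_ind)
    case (pure a b)
    then show ?case
      by (simp only: counit_id_pure id_counit_pure)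
        (simp add: counit_smult counit_closed R.m_comm)
  next
    case (add s t)
    then show ?case by (simp add: counit_id_rules id_counit_rules counit_add)
  qed
  then show ?thesis using \<alpha> s t by (simp add: tensor_graft_rules)
qed

text \<open>The second component of a grafted pure tensor is itself a grafting. Vanishing of
  \<epsilon> there is a hypothesis because for trees it is established directly, ahead of the counit
  axioms.\<close>

lemma id_counit_graft:
  assumes \<alpha>: "\<alpha> \<in> \<Omega>"
    and zero: "\<And>a b. \<lbrakk>a \<in> carrier H; b \<in> carrier H\<rbrakk> \<Longrightarrow> counit H (vee H \<alpha> a b) = \<zero>\<^bsub>R\<^esub>"
    and s: "s \<in> carrier (tensor_module R H H)" and t: "t \<in> carrier (tensor_module R H H)"
  shows "id_counit (tensor_graft \<alpha> s t) = \<zero>\<^bsub>H\<^esub>"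
  using s
proof (induction s rule: tensor_ind)
  case (add s1 s2)
  then show ?case using t \<alpha> by (simp add: tensor_graft_rules id_counit_rules)
next
  case ab: (pure a b)
  show ?case using t
  proof (induction t rule: tensor_ind)
    case (add t1 t2)
    then show ?case using ab \<alpha>
      by (simp add: tensor_graft_rules id_counit_rules pure_tensor_closed[OF module_A module_A])
  next
    case (pure c d)
    with ab show ?case using \<alpha>
      by (simp add: tensor_graft_pure id_counit_pure vee_closed zero)
  qed
qed

section \<open>Coassociativity on graftings\<close>

abbreviation comult_left where
  "comult_left \<equiv> tensor_map R (tensor_module R H H) H (comult H) (\<lambda>x. x)"

abbreviation comult_right where
  "comult_right \<equiv> tensor_map R H (tensor_module R H H) (\<lambda>x. x) (comult H)"

text \<open>On a \<otimes> b \<otimes> c and a' \<otimes> b' \<otimes> c' this and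
  \<open>graft_right\<close> both give aa' \<otimes> bb' \<otimes> (c \<or> c'); they differ only in
  the bracketing, which is the content of \<open>assoc_graft\<close>.\<close>

abbreviation graft_left where
  "graft_left \<alpha> \<equiv> tensor_op R (tensor_module R H H) H tensor_mult (vee H \<alpha>)"

abbreviation graft_right where
  "graft_right \<alpha> \<equiv> tensor_op R H (tensor_module R H H) (mult H) (tensor_graft \<alpha>)"

lemmas comult_left_linear = tensor_map_linear[OF module_A module_A module_AA module_A comult_linear linear_id]
lemmas comult_right_linear = tensor_map_linear[OF module_A module_A module_A module_AA linear_id comult_linear]
lemmas comult_left_pure = tensor_map_pure[OF module_A module_A module_AA module_A comult_linear linear_id]
lemmas comult_right_pure = tensor_map_pure[OF module_A module_A module_A module_AA linear_id comult_linear]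
lemmas assoc_linear = tensor_assoc_linear[OF module_A module_A module_A]
lemmas assoc_pure = tensor_assoc_pure[OF module_A module_A module_A]
lemmas graft_left_bilinear = tensor_op_bilinear[OF module_AA module_A tensor_mult_bilinear vee_bilinear]
lemmas graft_right_bilinear = tensor_op_bilinear[OF module_A module_AA mult_bilinear tensor_graft_bilinear]
lemmas graft_left_pure = tensor_op_pure[OF module_AA module_A tensor_mult_bilinear vee_bilinear]
lemmas graft_right_pure = tensor_op_pure[OF module_A module_AA mult_bilinear tensor_graft_bilinear]

lemma comult_left_graft:
  assumes "\<alpha> \<in> \<Omega>" "s \<in> carrier (tensor_module R H H)" "t \<in> carrier (tensor_module R H H)"
  shows "comult_left (tensor_graft \<alpha> s t) = graft_left \<alpha> (comult_left s) (comult_left t)"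
  by (rule tensor_map_op[where p = "comult H" and q = "\<lambda>x. x",
        OF module_A module_A module_AA module_A mult_bilinear vee_bilinear[OF assms(1)]
          tensor_mult_bilinear vee_bilinear[OF assms(1)] comult_linear linear_id _ _ assms(2,3)])
    (simp_all add: comult_mult)

text \<open>The second component b \<or> d is split by the cocycle identity: its part (b \<or> d)
  \<otimes> 1 gives the rebracketed first summand, and the grafting of \<Delta> b and \<Delta> d
  gives the second.\<close>

lemma comult_right_graft:
  assumes \<alpha>: "\<alpha> \<in> \<Omega>"
    and s: "s \<in> carrier (tensor_module R H H)" and t: "t \<in> carrier (tensor_module R H H)"
  shows "comult_right (tensor_graft \<alpha> s t) =
    tensor_assoc R H H H (pure_tensor R (tensor_module R H H) H (tensor_graft \<alpha> s t) \<one>\<^bsub>H\<^esub>)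
    \<oplus>\<^bsub>tensor_module R H (tensor_module R H H)\<^esub> graft_right \<alpha> (comult_right s) (comult_right t)"
proof -
  interpret HT: module R "tensor_module R H (tensor_module R H H)"
    by (rule tensor_module_module[OF module_A module_AA])
  note pure = pure_tensor_bilinear[OF module_AA module_A]
  note rules = \<alpha> tensor_graft_rules linear_add[OF comult_right_linear] linear_closed[OF comult_right_linear]
    linear_add[OF assoc_linear] linear_closed[OF assoc_linear] bilinear_closed[OF pure]
    bilinear_add_left[OF pure] bilinear_closed[OF graft_right_bilinear]
    bilinear_add_left[OF graft_right_bilinear] bilinear_add_right[OF graft_right_bilinear] HT.a_ac
  show ?thesis using s
  proof (induction s rule: tensor_ind)
    case (add s1 s2)
    then show ?case using t by (simp add: rules)
  next
    case ab: (pure a b)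
    show ?case using t
    proof (induction t rule: tensor_ind)
      case (add t1 t2)
      then show ?case using ab by (simp add: rules pure_tensor_closed[OF module_A module_A])
    next
      case (pure c d)
      with ab show ?case using \<alpha>
        by (simp add: tensor_graft_pure comult_right_pure graft_right_pure vee_closed assoc_pure
            cocycle comult_closed tensor_graft_rules pure_tensor_closed[OF module_A module_A]
            bilinear_add_right[OF pure_tensor_bilinear[OF module_A module_AA]])
    qed
  qed
qed

lemma assoc_graft:
  assumes \<alpha>: "\<alpha> \<in> \<Omega>"
    and p: "p \<in> carrier (tensor_module R (tensor_module R H H) H)"
    and q: "q \<in> carrier (tensor_module R (tensor_module R H H) H)"
  shows "tensor_assoc R H H H (graft_left \<alpha> p q) =
    graft_right \<alpha> (tensor_assoc R H H H p) (tensor_assoc R H H H q)"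
proof -
  note pure2 = pure_tensor_bilinear[OF module_AA module_A]
  note rules = \<alpha> linear_add[OF assoc_linear] linear_closed[OF assoc_linear]
    bilinear_closed[OF graft_left_bilinear] bilinear_add_left[OF graft_left_bilinear]
    bilinear_add_right[OF graft_left_bilinear] bilinear_closed[OF graft_right_bilinear]
    bilinear_add_left[OF graft_right_bilinear] bilinear_add_right[OF graft_right_bilinear]
    bilinear_closed[OF pure2] bilinear_add_left[OF pure2]
  note ind = tensor_induct[OF module_AA module_A, consumes 1, case_names pure add]
  show ?thesis using p
  proof (induction p rule: ind)
    case (add p1 p2)
    then show ?case using q by (simp add: rules)
  next
    case (pure s c)
    note c = pure(2)
    from pure(1) show ?case
    proof (induction s rule: tensor_ind)
      case (add s1 s2)
      then show ?case using q c by (simp add: rules)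
    next
      case ab: (pure a b)
      show ?case using q
      proof (induction q rule: ind)
        case (add q1 q2)
        then show ?case using ab c by (simp add: rules pure_tensor_closed[OF module_A module_A])
      next
        case (pure t c')
        note c' = pure(2)
        from pure(1) show ?case
        proof (induction t rule: tensor_ind)
          case (add t1 t2)
          then show ?case using ab c c' by (simp add: rules pure_tensor_closed[OF module_A module_A])
        next
          case (pure a' b')
          then show ?case using ab c c' \<alpha>
            by (simp add: assoc_pure graft_left_pure graft_right_pure tensor_mult_pure
                tensor_graft_pure vee_closed pure_tensor_closed[OF module_A module_A])
        qed
      qed
    qed
  qed
qed

lemma coassoc_one:
  "tensor_assoc R H H H (comult_left (comult H \<one>\<^bsub>H\<^esub>)) = comult_right (comult H \<one>\<^bsub>H\<^esub>)"
  by (simp add: comult_one comult_left_pure comult_right_pure assoc_pure)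

text \<open>Let z = x \<or> y and \<Delta> z = z \<otimes> 1 + w. Up to bracketing, applying
  \<Delta> on the left gives z \<otimes> 1 \<otimes> 1 + w \<otimes> 1 from the first summand, and
  on the right only z \<otimes> 1 \<otimes> 1. The missing w \<otimes> 1 is the extra summand that
  \<open>comult_right_graft\<close> produces from w; the rest agrees by the assumptions on x and
  y.\<close>

lemma coassoc_vee:
  assumes \<alpha>: "\<alpha> \<in> \<Omega>" and x: "x \<in> carrier H" and y: "y \<in> carrier H"
    and cx: "tensor_assoc R H H H (comult_left (comult H x)) = comult_right (comult H x)"
    and cy: "tensor_assoc R H H H (comult_left (comult H y)) = comult_right (comult H y)"
  shows "tensor_assoc R H H H (comult_left (comult H (vee H \<alpha> x y))) =
    comult_right (comult H (vee H \<alpha> x y))"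
proof -
  interpret HT: module R "tensor_module R H (tensor_module R H H)"
    by (rule tensor_module_module[OF module_A module_AA])
  note pure2 = pure_tensor_bilinear[OF module_AA module_A]
  let ?z = "vee H \<alpha> x y" let ?w = "tensor_graft \<alpha> (comult H x) (comult H y)"
  note [simp] = \<alpha> x y vee_closed comult_closed tensor_graft_rules(1) linear_add[OF comult_left_linear]
    linear_add[OF comult_right_linear] linear_add[OF assoc_linear] linear_closed[OF assoc_linear]
    linear_closed[OF comult_left_linear] linear_closed[OF comult_right_linear] bilinear_closed[OF pure2]
    bilinear_add_left[OF pure2] pure_tensor_closed[OF module_A module_A]
    bilinear_closed[OF graft_left_bilinear] bilinear_closed[OF graft_right_bilinear]
  have "tensor_assoc R H H H (comult_left (pure_tensor R H H ?z \<one>\<^bsub>H\<^esub>)) =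
      pure_tensor R H (tensor_module R H H) ?z (pure_tensor R H H \<one>\<^bsub>H\<^esub> \<one>\<^bsub>H\<^esub>)
      \<oplus>\<^bsub>tensor_module R H (tensor_module R H H)\<^esub>
      tensor_assoc R H H H (pure_tensor R (tensor_module R H H) H ?w \<one>\<^bsub>H\<^esub>)"
    by (simp add: comult_left_pure cocycle assoc_pure)
  then show ?thesis
    by (simp add: cocycle[OF \<alpha> x y] comult_left_graft comult_right_graft assoc_graft cx cy
        comult_right_pure comult_one HT.a_assoc pure_tensor_closed[OF module_A module_AA])
qed

end

sublocale cocycle_vee_bialgebra \<subseteq> cocycle_vee_algebra
  by unfold_locales (rule cocycle)

text \<open>Applying \<open>id \<otimes> \<epsilon>\<close> to the cocycle identity gives \<open>(id \<otimes> \<epsilon>)(\<ast>, \<or>\<^sub>\<alpha>)(\<Delta> x \<otimes> \<Delta> y) = 0\<close>, and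
  \<open>\<epsilon>\<close> of the left-hand side is \<open>\<epsilon>(x \<or>\<^sub>\<alpha> y)\<close>.\<close>

lemma (in cocycle_vee_bialgebra) counit_vee:
  assumes \<alpha>: "\<alpha> \<in> \<Omega>" and x: "x \<in> carrier H" and y: "y \<in> carrier H"
  shows "counit H (vee H \<alpha> x y) = \<zero>\<^bsub>R\<^esub>"
proof -
  let ?z = "vee H \<alpha> x y" let ?w = "tensor_graft \<alpha> (comult H x) (comult H y)"
  have z: "?z \<in> carrier H" and w: "?w \<in> carrier (tensor_module R H H)"
    by (simp_all add: \<alpha> x y vee_closed tensor_graft_rules comult_closed)
  have "?z = id_counit (comult H ?z)" using counit_right[OF z] by simp
  also have "\<dots> = ?z \<oplus>\<^bsub>H\<^esub> id_counit ?w"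
    using z w
    by (simp add: cocycle[OF \<alpha> x y] id_counit_rules id_counit_pure counit_one pure_tensor_closed[OF module_H module_H])
  finally have "id_counit ?w = \<zero>\<^bsub>H\<^esub>"
    using M.add.l_cancel_one'[OF z id_counit_rules(1)[OF w]] by simp
  \<comment> \<open>After the exchange of the two counit maps, the left counit law for x and y turns
    w back into x \<or> y.\<close>
  moreover have "counit H (id_counit ?w) = counit H ?z"
    by (simp add: counit_id_counit_graft counit_id_graft \<alpha> x y comult_closed counit_left)
  moreover have "counit H \<zero>\<^bsub>H\<^esub> = \<zero>\<^bsub>R\<^esub>"
    using linear_zero[OF counit_linear module_H base_algebra_module[OF R.cring_axioms]]
    by (simp add: base_algebra_simps)
  ultimately show ?thesis by simp
qed

section \<open>The algebra of decorated trees\<close>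

text \<open>The tree bialgebra and the free module on trees are records of different types that
  agree in the module fields.\<close>

lemma module_cong:
  assumes "module R M" "carrier N = carrier M" "add N = add M" "zero N = zero M" "smult N = smult M"
  shows "module R N"
proof -
  interpret M: module R M by fact
  have "abelian_group N"
    by (rule abelian_groupI) (auto simp: assms(2-) M.a_ac intro: bexI[of _ "\<ominus>\<^bsub>M\<^esub> _"] M.l_neg)
  then show ?thesis
    by (intro moduleI)
      (simp_all add: assms(2-) M.R.cring_axioms M.smult_l_distr M.smult_r_distr M.smult_assoc1)
qed

lemma Leaf_decorated: "Leaf \<in> decorated_trees \<Omega>"
  by (simp add: decorated_trees_def)

lemma Node_decorated:
  "Node l \<alpha> r \<in> decorated_trees \<Omega> \<longleftrightarrow> \<alpha> \<in> \<Omega> \<and> l \<in> decorated_trees \<Omega> \<and> r \<in> decorated_trees \<Omega>"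
  by (auto simp: decorated_trees_def)

lemma LR_simps:
  "carrier (LR R \<Omega>) = carrier (free_module R (decorated_trees \<Omega>))"
  "add (LR R \<Omega>) = add (free_module R (decorated_trees \<Omega>))"
  "zero (LR R \<Omega>) = zero (free_module R (decorated_trees \<Omega>))"
  "smult (LR R \<Omega>) = smult (free_module R (decorated_trees \<Omega>))"
  "mult (LR R \<Omega>) = LR_mult R \<Omega>"
  "one (LR R \<Omega>) = free_basis R Leaf"
  "vee (LR R \<Omega>) = LR_vee R \<Omega>"
  by (simp_all add: LR_def LR_module_def)

text \<open>The tree operations are defined over the bare module, since the full record is assembled
  from them, while the abstract lemmas speak about the full record. The constructions read only the
  module fields, so this and the following equations hold by unfolding.\<close>

lemma lin_ext_LR: "lin_ext R (LR_module R \<Omega>) = lin_ext R (LR R \<Omega>)"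
  by (intro ext) (simp add: lin_ext_def finsum_def finprod_def LR_simps LR_module_def)

lemma add_LR: "add (LR_module R \<Omega>) = add (LR R \<Omega>)"
  by (simp add: LR_simps LR_module_def)

lemma tensor_free_LR:
  "tensor_free R (LR_module R \<Omega>) (LR_module R \<Omega>) = tensor_free R (LR R \<Omega>) (LR R \<Omega>)"
  by (simp add: tensor_free_def LR_module_def LR_simps)

lemma tensor_kernel_LR:
  "tensor_kernel R (LR_module R \<Omega>) (LR_module R \<Omega>) = tensor_kernel R (LR R \<Omega>) (LR R \<Omega>)"
  by (simp add: tensor_kernel_def tensor_relations_def tensor_free_LR)
    (simp add: LR_module_def LR_simps)

lemma tensor_module_LR:
  "tensor_module R (LR_module R \<Omega>) (LR_module R \<Omega>) = tensor_module R (LR R \<Omega>) (LR R \<Omega>)"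
  by (simp add: tensor_module_def tensor_free_LR tensor_kernel_LR)

lemma pure_tensor_LR:
  "pure_tensor R (LR_module R \<Omega>) (LR_module R \<Omega>) = pure_tensor R (LR R \<Omega>) (LR R \<Omega>)"
  by (intro ext) (simp add: pure_tensor_def tensor_free_LR tensor_kernel_LR)

lemma tensor_op_LR:
  "tensor_op R (LR_module R \<Omega>) (LR_module R \<Omega>) = tensor_op R (LR R \<Omega>) (LR R \<Omega>)"
  by (intro ext) (simp add: tensor_op_def tensor_module_LR pure_tensor_LR)

lemma LR_linear_maps:
  "linear_maps R (LR R \<Omega>) M = linear_maps R (free_module R (decorated_trees \<Omega>)) M"
  by (simp add: linear_maps_def LR_simps)

lemma LR_bilinear_maps:
  "bilinear_maps R (LR R \<Omega>) (LR R \<Omega>) M =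
   bilinear_maps R (free_module R (decorated_trees \<Omega>)) (free_module R (decorated_trees \<Omega>)) M"
  by (simp add: bilinear_maps_def LR_linear_maps LR_simps)

section \<open>The module of trees, its graftings and its product\<close>

locale tree_algebra =
  fixes R :: "('k, 'r) ring_scheme" and \<Omega> :: "'w set"
  assumes R: "cring R"
begin

interpretation R: cring R by (rule R)

abbreviation H where "H \<equiv> LR R \<Omega>"
abbreviation D where "D \<equiv> decorated_trees \<Omega>"
abbreviation tree where "tree \<equiv> free_basis R"

lemma LR_module_module: "module R H"
  by (rule module_cong[OF free_module_module[OF R]]) (simp_all add: LR_simps)

interpretation M: module R H by (rule LR_module_module)

lemma tree_closed: "T \<in> D \<Longrightarrow> tree T \<in> carrier H"
  by (simp add: LR_simps free_basis_in_carrier R)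

text \<open>Sums and multiples are separate cases, matching the rules for linear maps; zero is
  covered as a zero multiple of the leaf.\<close>

lemma LR_induct [consumes 1, case_names tree add smult]:
  assumes x: "x \<in> carrier H"
    and tree: "\<And>T. T \<in> D \<Longrightarrow> P (tree T)"
    and add: "\<And>x y. \<lbrakk>x \<in> carrier H; y \<in> carrier H; P x; P y\<rbrakk> \<Longrightarrow> P (x \<oplus>\<^bsub>H\<^esub> y)"
    and smult: "\<And>r x. \<lbrakk>r \<in> carrier R; x \<in> carrier H; P x\<rbrakk> \<Longrightarrow> P (r \<odot>\<^bsub>H\<^esub> x)"
  shows "P x"
proof (rule free_module_induct[OF R x[unfolded LR_simps], folded LR_simps])
  have "P (\<zero>\<^bsub>R\<^esub> \<odot>\<^bsub>H\<^esub> tree Leaf)"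
    by (intro smult tree) (auto simp: Leaf_decorated tree_closed)
  then show "P \<zero>\<^bsub>H\<^esub>" by (simp add: Leaf_decorated tree_closed)
qed (auto intro!: add smult tree tree_closed)

lemma LR_linear_eqI:
  assumes "module R M" "f \<in> linear_maps R H M" "g \<in> linear_maps R H M"
    "\<And>T. T \<in> D \<Longrightarrow> f (tree T) = g (tree T)" "x \<in> carrier H"
  shows "f x = g x"
  using assms(5)
  by (induction rule: LR_induct)
    (simp_all add: assms(4) linear_add[OF assms(2)] linear_add[OF assms(3)] linear_smult[OF assms(2)]
      linear_smult[OF assms(3)])

lemma LR_vee_bilinear: "\<alpha> \<in> \<Omega> \<Longrightarrow> LR_vee R \<Omega> \<alpha> \<in> bilinear_maps R H H H"
  unfolding LR_vee_def bilin_ext_def LR_bilinear_maps lin_ext_LR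
  \<comment> \<open>The bilinear extension was opened only to move both inner linear extensions from
    the bare module to \<open>H\<close>; it is folded again.\<close>
  unfolding bilin_ext_def[symmetric]
  by (rule bilin_ext_bilinear[OF LR_module_module]) (simp add: tree_closed Node_decorated)

lemma LR_vee_tree:
  "\<lbrakk>\<alpha> \<in> \<Omega>; l \<in> D; r \<in> D\<rbrakk> \<Longrightarrow> LR_vee R \<Omega> \<alpha> (tree l) (tree r) = tree (Node l \<alpha> r)"
  unfolding LR_vee_def bilin_ext_def lin_ext_LR
  unfolding bilin_ext_def[symmetric]
  by (rule bilin_ext_basis[OF LR_module_module]) (simp_all add: tree_closed Node_decorated)

text \<open>One recursive call shrinks only the left factor, to its right subtree, the other only
  the right factor, to its left subtree. Hence the sum of the sizes is the measure, here and in
  later proofs about products of two trees.\<close>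

lemma LR_mult_tree_closed: "\<lbrakk>S \<in> D; T \<in> D\<rbrakk> \<Longrightarrow> LR_mult_tree R \<Omega> S T \<in> carrier H"
proof (induction "size S + size T" arbitrary: S T rule: less_induct)
  case less
  show ?case
  proof (cases "S = Leaf \<or> T = Leaf")
    case True
    then show ?thesis using less.prems by (cases S) (auto simp: tree_closed)
  next
    case False
    then obtain l \<alpha> r l' \<beta> r' where ST: "S = Node l \<alpha> r" "T = Node l' \<beta> r'"
      by (cases S; cases T) auto
    then have "\<alpha> \<in> \<Omega>" "\<beta> \<in> \<Omega>" "l \<in> D" "r \<in> D" "l' \<in> D" "r' \<in> D"
      using less.prems by (auto simp: Node_decorated)
    then show ?thesis
      using less.hyps[of r T] less.hyps[of S l'] less.prems
      by (auto simp: ST add_LR tree_closed intro!: bilinear_closed[OF LR_vee_bilinear])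
  qed
qed

lemma LR_mult_bilinear: "mult H \<in> bilinear_maps R H H H"
  unfolding LR_simps LR_mult_def bilin_ext_def LR_bilinear_maps lin_ext_LR
  unfolding bilin_ext_def[symmetric]
  by (rule bilin_ext_bilinear[OF LR_module_module]) (rule LR_mult_tree_closed)

lemma LR_mult_trees: "\<lbrakk>S \<in> D; T \<in> D\<rbrakk> \<Longrightarrow> tree S \<otimes>\<^bsub>H\<^esub> tree T = LR_mult_tree R \<Omega> S T"
  unfolding LR_simps LR_mult_def bilin_ext_def lin_ext_LR
  unfolding bilin_ext_def[symmetric]
  by (rule bilin_ext_basis[OF LR_module_module]) (simp_all add: LR_mult_tree_closed)

lemma vee_LR: "vee H = LR_vee R \<Omega>"
  by (simp add: LR_simps)

lemmas H_vee_bilinear = LR_vee_bilinear[folded vee_LR]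
lemmas H_vee_tree = LR_vee_tree[folded vee_LR]

lemmas vee_rules = bilinear_closed[OF H_vee_bilinear] bilinear_add_left[OF H_vee_bilinear]
  bilinear_add_right[OF H_vee_bilinear] bilinear_smult_left[OF H_vee_bilinear]
  bilinear_smult_right[OF H_vee_bilinear]

lemmas mult_rules = bilinear_closed[OF LR_mult_bilinear] bilinear_add_left[OF LR_mult_bilinear]
  bilinear_add_right[OF LR_mult_bilinear] bilinear_smult_left[OF LR_mult_bilinear]
  bilinear_smult_right[OF LR_mult_bilinear]

lemma one_LR: "\<one>\<^bsub>H\<^esub> = tree Leaf"
  by (simp add: LR_simps)

lemma LR_one_closed: "\<one>\<^bsub>H\<^esub> \<in> carrier H"
  by (simp add: one_LR tree_closed Leaf_decorated)

lemma LR_l_one: "x \<in> carrier H \<Longrightarrow> \<one>\<^bsub>H\<^esub> \<otimes>\<^bsub>H\<^esub> x = x"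
  by (induction rule: LR_induct) (simp_all add: mult_rules LR_one_closed, simp add: one_LR LR_mult_trees Leaf_decorated)

lemma LR_r_one: "x \<in> carrier H \<Longrightarrow> x \<otimes>\<^bsub>H\<^esub> \<one>\<^bsub>H\<^esub> = x"
proof (induction rule: LR_induct)
  case (tree T)
  then show ?case by (cases T) (simp_all add: one_LR LR_mult_trees Leaf_decorated)
qed (simp_all add: mult_rules LR_one_closed)

lemma LR_vee_mult_trees:
  assumes "\<alpha> \<in> \<Omega>" "\<beta> \<in> \<Omega>" "l \<in> D" "r \<in> D" "l' \<in> D" "r' \<in> D"
  shows "vee H \<alpha> (tree l) (tree r) \<otimes>\<^bsub>H\<^esub> vee H \<beta> (tree l') (tree r') =
    vee H \<alpha> (tree l) (tree r \<otimes>\<^bsub>H\<^esub> vee H \<beta> (tree l') (tree r')) \<oplus>\<^bsub>H\<^esub>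
    vee H \<beta> (vee H \<alpha> (tree l) (tree r) \<otimes>\<^bsub>H\<^esub> tree l') (tree r')"
  using assms by (simp add: H_vee_tree LR_mult_trees Node_decorated) (simp add: vee_LR add_LR)

lemma LR_vee_mult:
  assumes \<alpha>: "\<alpha> \<in> \<Omega>" and \<beta>: "\<beta> \<in> \<Omega>" and a: "a \<in> carrier H" and b: "b \<in> carrier H"
    and a': "a' \<in> carrier H" and b': "b' \<in> carrier H"
  shows "vee H \<alpha> a b \<otimes>\<^bsub>H\<^esub> vee H \<beta> a' b' =
    vee H \<alpha> a (b \<otimes>\<^bsub>H\<^esub> vee H \<beta> a' b') \<oplus>\<^bsub>H\<^esub> vee H \<beta> (vee H \<alpha> a b \<otimes>\<^bsub>H\<^esub> a') b'"
proof -
  note rules = \<alpha> \<beta> vee_rules mult_rules tree_closed M.M.a_ac M.smult_r_distr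
  show ?thesis using a
  proof (induction a rule: LR_induct)
    case l: (tree l)
    show ?case using b
    proof (induction b rule: LR_induct)
      case r: (tree r)
      show ?case using a'
      proof (induction a' rule: LR_induct)
        case l': (tree l')
        show ?case using b'
        proof (induction b' rule: LR_induct)
          case r': (tree r')
          show ?case by (rule LR_vee_mult_trees[OF \<alpha> \<beta> l r l' r'])
        qed (use l r l' in \<open>simp_all add: rules\<close>)
      qed (use l r b' in \<open>simp_all add: rules\<close>)
    qed (use l a' b' in \<open>simp_all add: rules\<close>)
  qed (use b a' b' in \<open>simp_all add: rules\<close>)
qed

text \<open>Expanding either side gives three terms, grafted at the root of x, of y and of z. The
  middle ones agree outright; the outer ones need the claim for (r, y, z) and (x, y, l''), so y
  stays fixed and the measure is the size of x plus that of z.\<close>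

lemma LR_mult_assoc_trees:
  "\<lbrakk>x \<in> D; y \<in> D; z \<in> D\<rbrakk> \<Longrightarrow>
   (tree x \<otimes>\<^bsub>H\<^esub> tree y) \<otimes>\<^bsub>H\<^esub> tree z = tree x \<otimes>\<^bsub>H\<^esub> (tree y \<otimes>\<^bsub>H\<^esub> tree z)"
proof (induction "size x + size z" arbitrary: x z rule: less_induct)
  case less
  show ?case
  proof (cases "x = Leaf \<or> y = Leaf \<or> z = Leaf")
    case True
    then show ?thesis using less.prems
      by (auto simp: one_LR[symmetric] LR_l_one LR_r_one tree_closed mult_rules)
  next
    case False
    then obtain l \<alpha> r l' \<beta> r' l'' \<gamma> r'' where
      xyz: "x = Node l \<alpha> r" "y = Node l' \<beta> r'" "z = Node l'' \<gamma> r''"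
      by (cases x; cases y; cases z) auto
    have d: "\<alpha> \<in> \<Omega>" "\<beta> \<in> \<Omega>" "\<gamma> \<in> \<Omega>" "l \<in> D" "r \<in> D" "l' \<in> D" "r' \<in> D" "l'' \<in> D" "r'' \<in> D"
      using less.prems xyz by (auto simp: Node_decorated)
    note c = d(1-3) tree_closed[OF d(4)] tree_closed[OF d(5)] tree_closed[OF d(6)] tree_closed[OF d(7)]
      tree_closed[OF d(8)] tree_closed[OF d(9)]
    have IH1: "(tree r \<otimes>\<^bsub>H\<^esub> tree y) \<otimes>\<^bsub>H\<^esub> tree z = tree r \<otimes>\<^bsub>H\<^esub> (tree y \<otimes>\<^bsub>H\<^esub> tree z)"
      and IH2: "(tree x \<otimes>\<^bsub>H\<^esub> tree y) \<otimes>\<^bsub>H\<^esub> tree l'' = tree x \<otimes>\<^bsub>H\<^esub> (tree y \<otimes>\<^bsub>H\<^esub> tree l'')"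
      using less d xyz by auto
    define X Y Z where XYZ: "X = tree x" "Y = tree y" "Z = tree z"
    have Xc: "X \<in> carrier H" "Y \<in> carrier H" "Z \<in> carrier H"
      using XYZ less.prems tree_closed by auto
    have XV: "X = vee H \<alpha> (tree l) (tree r)" "Y = vee H \<beta> (tree l') (tree r')"
      "Z = vee H \<gamma> (tree l'') (tree r'')"
      using d by (simp_all add: XYZ xyz H_vee_tree)
    note vm = LR_vee_mult
    have XY: "X \<otimes>\<^bsub>H\<^esub> Y = vee H \<alpha> (tree l) (tree r \<otimes>\<^bsub>H\<^esub> Y) \<oplus>\<^bsub>H\<^esub> vee H \<beta> (X \<otimes>\<^bsub>H\<^esub> tree l') (tree r')"
      unfolding XV using c by (intro vm)
    have YZ: "Y \<otimes>\<^bsub>H\<^esub> Z = vee H \<beta> (tree l') (tree r' \<otimes>\<^bsub>H\<^esub> Z) \<oplus>\<^bsub>H\<^esub> vee H \<gamma> (Y \<otimes>\<^bsub>H\<^esub> tree l'') (tree r'')"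
      unfolding XV using c by (intro vm)
    have Z: "vee H \<delta> a b \<otimes>\<^bsub>H\<^esub> Z = vee H \<delta> a (b \<otimes>\<^bsub>H\<^esub> Z) \<oplus>\<^bsub>H\<^esub> vee H \<gamma> (vee H \<delta> a b \<otimes>\<^bsub>H\<^esub> tree l'') (tree r'')"
      if "\<delta> \<in> \<Omega>" "a \<in> carrier H" "b \<in> carrier H" for \<delta> a b
      unfolding XV(3) using c that by (intro vm)
    have X: "X \<otimes>\<^bsub>H\<^esub> vee H \<delta> a b = vee H \<alpha> (tree l) (tree r \<otimes>\<^bsub>H\<^esub> vee H \<delta> a b) \<oplus>\<^bsub>H\<^esub> vee H \<delta> (X \<otimes>\<^bsub>H\<^esub> a) b"
      if "\<delta> \<in> \<Omega>" "a \<in> carrier H" "b \<in> carrier H" for \<delta> a b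
      unfolding XV(1) using c that by (intro vm)
    note rules = c Xc vee_rules mult_rules
    \<comment> \<open>Multiplying each of the two summands of XY by Z leaves a term under the root
      of Z; by linearity these two recombine to the grafting of (XY) l''.\<close>
    have "(X \<otimes>\<^bsub>H\<^esub> Y) \<otimes>\<^bsub>H\<^esub> Z =
        vee H \<alpha> (tree l) ((tree r \<otimes>\<^bsub>H\<^esub> Y) \<otimes>\<^bsub>H\<^esub> Z) \<oplus>\<^bsub>H\<^esub> vee H \<beta> (X \<otimes>\<^bsub>H\<^esub> tree l') (tree r' \<otimes>\<^bsub>H\<^esub> Z)
        \<oplus>\<^bsub>H\<^esub> vee H \<gamma> ((X \<otimes>\<^bsub>H\<^esub> Y) \<otimes>\<^bsub>H\<^esub> tree l'') (tree r'')"
      by (simp add: XY Z rules M.M.a_ac)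
    also have "\<dots> = vee H \<alpha> (tree l) (tree r \<otimes>\<^bsub>H\<^esub> (Y \<otimes>\<^bsub>H\<^esub> Z)) \<oplus>\<^bsub>H\<^esub> vee H \<beta> (X \<otimes>\<^bsub>H\<^esub> tree l') (tree r' \<otimes>\<^bsub>H\<^esub> Z)
        \<oplus>\<^bsub>H\<^esub> vee H \<gamma> (X \<otimes>\<^bsub>H\<^esub> (Y \<otimes>\<^bsub>H\<^esub> tree l'')) (tree r'')"
      using IH1 IH2 by (simp add: XYZ)
    also have "\<dots> = X \<otimes>\<^bsub>H\<^esub> (Y \<otimes>\<^bsub>H\<^esub> Z)"
      by (simp add: YZ X rules M.M.a_ac)
    finally show ?thesis by (simp add: XYZ)
  qed
qed

lemma LR_mult_assoc:
  assumes "x \<in> carrier H" and y: "y \<in> carrier H" and z: "z \<in> carrier H"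
  shows "(x \<otimes>\<^bsub>H\<^esub> y) \<otimes>\<^bsub>H\<^esub> z = x \<otimes>\<^bsub>H\<^esub> (y \<otimes>\<^bsub>H\<^esub> z)"
  using assms(1)
proof (induction x rule: LR_induct)
  case S: (tree S)
  show ?case using y
  proof (induction y rule: LR_induct)
    case T: (tree T)
    show ?case using z
      by (induction z rule: LR_induct) (use S T in \<open>simp_all add: LR_mult_assoc_trees mult_rules tree_closed\<close>)
  qed (use S z in \<open>simp_all add: mult_rules tree_closed\<close>)
qed (use y z in \<open>simp_all add: mult_rules\<close>)

lemma LR_unital_algebra: "unital_algebra R H"
proof (intro unital_algebra.intro unital_algebra_axioms.intro LR_module_module)
  show "ring H"
    by (intro ringI monoidI M.M.abelian_group_axioms)
      (simp_all add: mult_rules LR_one_closed LR_l_one LR_r_one LR_mult_assoc)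
qed (simp_all add: mult_rules)

lemma LR_vee_algebra: "vee_algebra R H \<Omega> (vee H)"
  by (intro vee_algebra.intro LR_unital_algebra vee_algebra_axioms.intro H_vee_bilinear LR_vee_mult)

interpretation V: vee_algebra R H \<Omega> "vee H" by (rule LR_vee_algebra)

interpretation T: module R "tensor_module R H H" by (rule V.module_AA)

section \<open>The coproduct of trees and its multiplicativity\<close>

lemma comult_LR: "comult H = lin_ext R (tensor_module R H H) (LR_comult_tree R \<Omega>)"
  unfolding tensor_module_LR[symmetric] by (simp add: LR_def)

lemma LR_comult_tree_Node:
  "LR_comult_tree R \<Omega> (Node l \<alpha> r) =
     pure_tensor R H H (tree (Node l \<alpha> r)) \<one>\<^bsub>H\<^esub> \<oplus>\<^bsub>tensor_module R H H\<^esub>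
     V.tensor_graft \<alpha> (LR_comult_tree R \<Omega> l) (LR_comult_tree R \<Omega> r)"
  by (simp add: pure_tensor_LR tensor_op_LR tensor_module_LR LR_simps)

lemma LR_comult_tree_closed: "T \<in> D \<Longrightarrow> LR_comult_tree R \<Omega> T \<in> carrier (tensor_module R H H)"
proof (induction T)
  case Leaf
  then show ?case
    by (simp add: pure_tensor_LR pure_tensor_closed[OF LR_module_module LR_module_module] tree_closed)
next
  case (Node l \<alpha> r)
  then show ?case
    by (simp add: LR_comult_tree_Node Node_decorated V.tensor_graft_rules tree_closed LR_one_closed
        pure_tensor_closed[OF LR_module_module LR_module_module] del: LR_comult_tree.simps)
qed

lemma LR_comult_linear: "comult H \<in> linear_maps R H (tensor_module R H H)"
  unfolding comult_LR LR_linear_maps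
  by (rule lin_ext_linear[OF V.module_AA]) (use LR_comult_tree_closed in auto)

lemma LR_comult_basis: "T \<in> D \<Longrightarrow> comult H (tree T) = LR_comult_tree R \<Omega> T"
  unfolding comult_LR
  by (rule lin_ext_basis[OF V.module_AA]) (simp_all add: LR_comult_tree_closed)

lemma LR_comult_one: "comult H \<one>\<^bsub>H\<^esub> = pure_tensor R H H \<one>\<^bsub>H\<^esub> \<one>\<^bsub>H\<^esub>"
  unfolding one_LR by (simp add: LR_comult_basis Leaf_decorated pure_tensor_LR)

lemmas comult_rules = linear_closed[OF LR_comult_linear] linear_add[OF LR_comult_linear]
  linear_smult[OF LR_comult_linear]

lemmas pure_bilinear = pure_tensor_bilinear[OF LR_module_module LR_module_module]

lemmas pure_rules = bilinear_closed[OF pure_bilinear] bilinear_add_left[OF pure_bilinear]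
  bilinear_smult_left[OF pure_bilinear]

lemmas graft_rules = V.tensor_graft_rules bilinear_smult_left[OF V.tensor_graft_bilinear]
  bilinear_smult_right[OF V.tensor_graft_bilinear]

text \<open>On trees this is the recursion defining the coproduct, and both sides are
  bilinear.\<close>

lemma LR_cocycle:
  assumes \<alpha>: "\<alpha> \<in> \<Omega>" and h: "h \<in> carrier H" and h': "h' \<in> carrier H"
  shows "comult H (vee H \<alpha> h h') = pure_tensor R H H (vee H \<alpha> h h') \<one>\<^bsub>H\<^esub>
    \<oplus>\<^bsub>tensor_module R H H\<^esub> V.tensor_graft \<alpha> (comult H h) (comult H h')"
proof -
  note rules = \<alpha> comult_rules vee_rules pure_rules graft_rules LR_one_closed tree_closed
    T.M.a_ac T.smult_r_distr
  show ?thesis using h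
  proof (induction h rule: LR_induct)
    case l: (tree l)
    show ?case using h'
    proof (induction h' rule: LR_induct)
      case r: (tree r)
      show ?case using l r \<alpha>
        by (simp add: H_vee_tree LR_comult_basis Node_decorated LR_comult_tree_Node del: LR_comult_tree.simps)
    qed (use l in \<open>simp_all add: rules\<close>)
  qed (use h' in \<open>simp_all add: rules\<close>)
qed

text \<open>Write \<Delta> X = X \<otimes> 1 + G(\<Delta> l, \<Delta> r) and \<Delta> Y = Y
  \<otimes> 1 + G'(\<Delta> l', \<Delta> r'). The product of the grafted parts is G(\<Delta> l,
  \<Delta> r G'(\<Delta> l', \<Delta> r')) + G'(G(\<Delta> l, \<Delta> r) \<Delta> l', \<Delta> r').
  The mixed terms complete these to G(\<Delta> l, \<Delta> r \<Delta> Y) and G'(\<Delta> X \<Delta>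
  l', \<Delta> r'), to which the induction hypotheses apply.\<close>

lemma LR_comult_mult_trees:
  "\<lbrakk>x \<in> D; y \<in> D\<rbrakk> \<Longrightarrow>
   comult H (tree x \<otimes>\<^bsub>H\<^esub> tree y) = V.tensor_mult (comult H (tree x)) (comult H (tree y))"
proof (induction "size x + size y" arbitrary: x y rule: less_induct)
  case less
  have unit: "V.tensor_mult (pure_tensor R H H \<one>\<^bsub>H\<^esub> \<one>\<^bsub>H\<^esub>) t = t"
    "V.tensor_mult t (pure_tensor R H H \<one>\<^bsub>H\<^esub> \<one>\<^bsub>H\<^esub>) = t"
    if "t \<in> carrier (tensor_module R H H)" for t
    using that
    by (induction t rule: V.tensor_ind)
      (simp_all add: V.tensor_mult_pure V.tensor_mult_rules pure_rules LR_one_closed)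
  show ?case
  proof (cases "x = Leaf \<or> y = Leaf")
    case True
    then show ?thesis using less.prems
      by (auto simp: one_LR[symmetric] LR_l_one LR_r_one tree_closed LR_comult_one unit comult_rules)
  next
    case False
    then obtain l \<alpha> r l' \<beta> r' where xy: "x = Node l \<alpha> r" "y = Node l' \<beta> r'"
      by (cases x; cases y) auto
    have d: "\<alpha> \<in> \<Omega>" "\<beta> \<in> \<Omega>" "l \<in> D" "r \<in> D" "l' \<in> D" "r' \<in> D"
      using less.prems xy by (auto simp: Node_decorated)
    define X Y where XY: "X = tree x" "Y = tree y"
    have c: "X \<in> carrier H" "Y \<in> carrier H" "tree l \<in> carrier H" "tree r \<in> carrier H"
      "tree l' \<in> carrier H" "tree r' \<in> carrier H"
      using XY less.prems d tree_closed by auto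
    have XV: "X = vee H \<alpha> (tree l) (tree r)" "Y = vee H \<beta> (tree l') (tree r')"
      using d by (simp_all add: XY xy H_vee_tree)
    have IH: "comult H (tree r \<otimes>\<^bsub>H\<^esub> Y) = V.tensor_mult (comult H (tree r)) (comult H Y)"
      "comult H (X \<otimes>\<^bsub>H\<^esub> tree l') = V.tensor_mult (comult H X) (comult H (tree l'))"
      using less d xy by (auto simp: XY)
    have prod: "X \<otimes>\<^bsub>H\<^esub> Y = vee H \<alpha> (tree l) (tree r \<otimes>\<^bsub>H\<^esub> Y) \<oplus>\<^bsub>H\<^esub> vee H \<beta> (X \<otimes>\<^bsub>H\<^esub> tree l') (tree r')"
      unfolding XV using c d by (intro LR_vee_mult)
    have CX: "comult H X = pure_tensor R H H X \<one>\<^bsub>H\<^esub> \<oplus>\<^bsub>tensor_module R H H\<^esub>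
        V.tensor_graft \<alpha> (comult H (tree l)) (comult H (tree r))"
      and CY: "comult H Y = pure_tensor R H H Y \<one>\<^bsub>H\<^esub> \<oplus>\<^bsub>tensor_module R H H\<^esub>
        V.tensor_graft \<beta> (comult H (tree l')) (comult H (tree r'))"
      using LR_cocycle c d by (simp_all add: XV)
    note rules = d(1,2) c comult_rules mult_rules vee_rules pure_rules graft_rules LR_one_closed
      V.tensor_mult_rules T.M.a_ac
    have "comult H (X \<otimes>\<^bsub>H\<^esub> Y) = pure_tensor R H H (X \<otimes>\<^bsub>H\<^esub> Y) \<one>\<^bsub>H\<^esub> \<oplus>\<^bsub>tensor_module R H H\<^esub>
        (V.tensor_graft \<alpha> (comult H (tree l)) (V.tensor_mult (comult H (tree r)) (comult H Y))
        \<oplus>\<^bsub>tensor_module R H H\<^esub>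
        V.tensor_graft \<beta> (V.tensor_mult (comult H X) (comult H (tree l'))) (comult H (tree r')))"
      by (simp add: prod LR_cocycle IH rules)
    also have "\<dots> = V.tensor_mult (comult H X) (comult H Y)"
      by (simp add: CX CY rules V.tensor_mult_left_graft V.tensor_mult_right_graft
          V.tensor_mult_graft_graft V.tensor_mult_pure LR_l_one)
    finally show ?thesis by (simp add: XY)
  qed
qed

lemma LR_comult_mult:
  assumes "x \<in> carrier H" and y: "y \<in> carrier H"
  shows "comult H (x \<otimes>\<^bsub>H\<^esub> y) = V.tensor_mult (comult H x) (comult H y)"
proof -
  note rules = comult_rules mult_rules V.tensor_mult_rules tree_closed
    bilinear_smult_left[OF V.tensor_mult_bilinear] bilinear_smult_right[OF V.tensor_mult_bilinear]
  show ?thesis using assms(1)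
  proof (induction x rule: LR_induct)
    case S: (tree S)
    show ?case using y
      by (induction y rule: LR_induct) (use S in \<open>simp_all add: rules LR_comult_mult_trees\<close>)
  qed (use y in \<open>simp_all add: rules\<close>)
qed

lemma LR_comult_hom: "comult H \<in> algebra_hom R H (tensor_algebra R H H)"
proof (rule algebra_homI)
  show "comult H \<in> linear_maps R H (tensor_algebra R H H)"
    using LR_comult_linear by (simp add: linear_maps_def tensor_algebra_simps)
qed (simp_all add: tensor_algebra_simps LR_comult_one LR_comult_mult)

section \<open>The counit of trees\<close>

lemma counit_LR:
  "counit H = lin_ext R (base_algebra R) (\<lambda>T. if T = Leaf then \<one>\<^bsub>R\<^esub> else \<zero>\<^bsub>R\<^esub>)"
  by (simp add: LR_def)

lemma LR_counit_linear: "counit H \<in> linear_maps R H (base_algebra R)"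
  unfolding counit_LR LR_linear_maps
  by (rule lin_ext_linear[OF base_algebra_module[OF R]]) (auto simp: base_algebra_simps)

lemma LR_counit_basis: "T \<in> D \<Longrightarrow> counit H (tree T) = (if T = Leaf then \<one>\<^bsub>R\<^esub> else \<zero>\<^bsub>R\<^esub>)"
  unfolding counit_LR
  by (rule lin_ext_basis[OF base_algebra_module[OF R], where X = D]) (simp_all add: base_algebra_simps)

lemmas counit_rules = linear_closed[OF LR_counit_linear, unfolded base_algebra_simps]
  linear_add[OF LR_counit_linear, unfolded base_algebra_simps]
  linear_smult[OF LR_counit_linear, unfolded base_algebra_simps]

lemma LR_counit_vee:
  assumes \<alpha>: "\<alpha> \<in> \<Omega>" and a: "a \<in> carrier H" and b: "b \<in> carrier H"
  shows "counit H (vee H \<alpha> a b) = \<zero>\<^bsub>R\<^esub>"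
  using a
proof (induction a rule: LR_induct)
  case l: (tree l)
  show ?case using b
    by (induction b rule: LR_induct)
      (use l \<alpha> in \<open>simp_all add: counit_rules vee_rules tree_closed H_vee_tree LR_counit_basis Node_decorated\<close>)
qed (use b \<alpha> in \<open>simp_all add: counit_rules vee_rules\<close>)

text \<open>The product of two trees other than the leaf is a sum of two graftings, so both sides
  vanish.\<close>

lemma LR_counit_mult_trees:
  assumes "x \<in> D" "y \<in> D"
  shows "counit H (tree x \<otimes>\<^bsub>H\<^esub> tree y) = counit H (tree x) \<otimes>\<^bsub>R\<^esub> counit H (tree y)"
proof (cases "x = Leaf \<or> y = Leaf")
  case True
  then show ?thesis using assms
    by (auto simp: one_LR[symmetric] LR_l_one LR_r_one tree_closed counit_rules)
      (auto simp: one_LR LR_counit_basis Leaf_decorated)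
next
  case False
  then obtain l \<alpha> r l' \<beta> r' where xy: "x = Node l \<alpha> r" "y = Node l' \<beta> r'"
    by (cases x; cases y) auto
  then have d: "\<alpha> \<in> \<Omega>" "\<beta> \<in> \<Omega>" "l \<in> D" "r \<in> D" "l' \<in> D" "r' \<in> D"
    using assms by (auto simp: Node_decorated)
  then show ?thesis
    by (simp add: xy H_vee_tree[symmetric] LR_vee_mult tree_closed counit_rules vee_rules mult_rules
        LR_counit_vee)
qed

lemma LR_counit_hom: "counit H \<in> algebra_hom R H (base_algebra R)"
proof (rule algebra_homI[OF LR_counit_linear])
  show "counit H \<one>\<^bsub>H\<^esub> = \<one>\<^bsub>base_algebra R\<^esub>"
    by (simp add: one_LR LR_counit_basis Leaf_decorated base_algebra_simps)
  fix x y assume x: "x \<in> carrier H" and y: "y \<in> carrier H"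
  note rules = counit_rules mult_rules tree_closed R.l_distr R.r_distr R.m_ac
  have "counit H (x \<otimes>\<^bsub>H\<^esub> y) = counit H x \<otimes>\<^bsub>R\<^esub> counit H y"
    using x
  proof (induction x rule: LR_induct)
    case S: (tree S)
    show ?case using y
      by (induction y rule: LR_induct) (use S in \<open>simp_all add: rules LR_counit_mult_trees\<close>)
  qed (use y in \<open>simp_all add: rules\<close>)
  then show "counit H (x \<otimes>\<^bsub>H\<^esub> y) = counit H x \<otimes>\<^bsub>base_algebra R\<^esub> counit H y"
    by (simp add: base_algebra_simps)
qed

lemma LR_cocycle_vee_algebra: "cocycle_vee_algebra R \<Omega> H"
  by (intro cocycle_vee_algebra.intro LR_vee_algebra cocycle_vee_algebra_axioms.intro
      algebra_with_coproduct.intro algebra_with_coproduct_axioms.intro LR_unital_algebra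
      LR_comult_hom LR_counit_hom LR_cocycle)

interpretation C: cocycle_vee_algebra R \<Omega> H by (rule LR_cocycle_vee_algebra)

section \<open>Coassociativity and the counit laws for trees\<close>

lemma LR_coassoc:
  assumes "h \<in> carrier H"
  shows "tensor_assoc R H H H (C.comult_left (comult H h)) = C.comult_right (comult H h)"
proof (rule LR_linear_eqI[OF tensor_module_module[OF LR_module_module V.module_AA]
        linear_compose[OF linear_compose[OF LR_comult_linear C.comult_left_linear] C.assoc_linear]
        linear_compose[OF LR_comult_linear C.comult_right_linear] _ assms])
  fix T assume "T \<in> D"
  then show "tensor_assoc R H H H (C.comult_left (comult H (tree T))) = C.comult_right (comult H (tree T))"
  proof (induction T)
    case Leaf
    then show ?case by (simp only: C.coassoc_one flip: one_LR)
  next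
    case (Node l \<alpha> r)
    then have "\<alpha> \<in> \<Omega>" "l \<in> D" "r \<in> D" by (auto simp: Node_decorated)
    then show ?case
      using C.coassoc_vee[of \<alpha> "tree l" "tree r"] Node.IH by (simp add: H_vee_tree tree_closed)
  qed
qed

text \<open>The map \<epsilon> \<otimes> id kills T \<otimes> 1 for a tree T with a root and
  commutes with grafting on the remaining part, so induction on the subtrees rebuilds T.\<close>

lemma LR_counit_left:
  assumes "h \<in> carrier H"
  shows "C.counit_id (comult H h) = h"
proof (rule LR_linear_eqI[OF LR_module_module linear_compose[OF LR_comult_linear C.counit_id_linear]
        linear_id _ assms])
  fix T assume "T \<in> D"
  then show "C.counit_id (comult H (tree T)) = tree T"
  proof (induction T)
    case Leaf
    show ?case
      by (simp add: C.comult_one C.counit_id_pure LR_one_closed C.counit_one flip: one_LR)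
  next
    case (Node l \<alpha> r)
    then have d: "\<alpha> \<in> \<Omega>" "l \<in> D" "r \<in> D" by (auto simp: Node_decorated)
    have "C.counit_id (comult H (vee H \<alpha> (tree l) (tree r))) = vee H \<alpha> (tree l) (tree r)"
      using d Node.IH
      by (simp add: LR_cocycle tree_closed C.counit_id_rules C.counit_id_graft pure_rules graft_rules
          vee_rules LR_one_closed comult_rules C.counit_id_pure LR_counit_vee)
    then show ?case using d by (simp add: H_vee_tree)
  qed
qed

text \<open>A case distinction suffices: id \<otimes> \<epsilon> keeps T from the term T \<otimes> 1
  and annihilates the grafted part.\<close>

lemma LR_counit_right:
  assumes "h \<in> carrier H"
  shows "C.id_counit (comult H h) = h"
proof (rule LR_linear_eqI[OF LR_module_module linear_compose[OF LR_comult_linear C.id_counit_linear]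
        linear_id _ assms])
  fix T assume T: "T \<in> D"
  show "C.id_counit (comult H (tree T)) = tree T"
  proof (cases T)
    case Leaf
    then show ?thesis
      by (simp add: C.comult_one C.id_counit_pure LR_one_closed C.counit_one flip: one_LR)
  next
    case (Node l \<alpha> r)
    then have d: "\<alpha> \<in> \<Omega>" "l \<in> D" "r \<in> D" using T by (auto simp: Node_decorated)
    have "C.id_counit (comult H (vee H \<alpha> (tree l) (tree r))) = vee H \<alpha> (tree l) (tree r)"
      using d
      by (simp add: LR_cocycle tree_closed C.id_counit_rules C.id_counit_graft pure_rules graft_rules
          vee_rules LR_one_closed comult_rules C.id_counit_pure LR_counit_vee C.counit_one)
    then show ?thesis using d Node by (simp add: H_vee_tree)
  qed
qed

lemma LR_cocycle_vee_bialgebra: "cocycle_vee_bialgebra R \<Omega> H"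
  by (intro cocycle_vee_bialgebra.intro cocycle_vee_bialgebra_axioms.intro vee_bialgebra.intro
      bialgebra.intro bialgebra_axioms.intro LR_unital_algebra LR_vee_algebra LR_comult_hom LR_counit_hom
      LR_coassoc LR_counit_left LR_counit_right LR_cocycle)

end

section \<open>The antipode\<close>

text \<open>Solves the equation for the antipode: with s = S(T), c = (S \<ast> id)(T) or (id \<ast>
  S)(T), and u the convolution unit at T, the geometric series yields the last assumption.\<close>

lemma (in abelian_group) minus_minus_cancel:
  assumes "s \<in> carrier G" "u \<in> carrier G" "c \<in> carrier G" "s = u \<ominus> (c \<ominus> s)"
  shows "c = u"
proof -
  have "s = (u \<ominus> c) \<oplus> s"
    using assms by (simp add: minus_eq minus_add a_assoc)
  then have zero: "u \<ominus> c = \<zero>"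
    using assms(1-3) add.r_cancel_one'[of s "u \<ominus> c"] by (simp add: minus_eq)
  have "u = (u \<ominus> c) \<oplus> c" using assms(1-3) by (simp add: minus_eq a_assoc l_neg)
  then show ?thesis using zero assms(3) by simp
qed

section \<open>The filtration by the number of interior vertices and the geometric series\<close>

context tree_algebra
begin

interpretation C: cocycle_vee_bialgebra R \<Omega> H by (rule LR_cocycle_vee_bialgebra)
interpretation H: bialgebra_and_algebra R H H ..
interpretation M: module R H by (rule LR_module_module)

text \<open>The span of the trees with at most n interior vertices, generated inductively so that
  facts about it follow by rule induction; zero arises as a zero multiple of the leaf.\<close>

inductive_set low :: "nat \<Rightarrow> ('w tree \<Rightarrow> 'k) set" for n where
  low_tree: "\<lbrakk>T \<in> D; size T \<le> n\<rbrakk> \<Longrightarrow> tree T \<in> low n"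
| low_add: "\<lbrakk>x \<in> low n; y \<in> low n\<rbrakk> \<Longrightarrow> x \<oplus>\<^bsub>H\<^esub> y \<in> low n"
| low_smult: "\<lbrakk>r \<in> carrier R; x \<in> low n\<rbrakk> \<Longrightarrow> r \<odot>\<^bsub>H\<^esub> x \<in> low n"

lemma low_closed: "x \<in> low n \<Longrightarrow> x \<in> carrier H"
  by (induction rule: low.induct) (auto simp: tree_closed)

lemma low_mono: "\<lbrakk>x \<in> low m; m \<le> n\<rbrakk> \<Longrightarrow> x \<in> low n"
  by (induction rule: low.induct) (auto intro: low.intros)

lemma low_vee:
  assumes \<alpha>: "\<alpha> \<in> \<Omega>" and a: "a \<in> low m" and b: "b \<in> low n"
  shows "vee H \<alpha> a b \<in> low (Suc (m + n))"
  using a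
proof (induction a rule: low.induct)
  case (low_tree l)
  show ?case using b
    by (induction b rule: low.induct)
      (use low_tree \<alpha> in \<open>auto simp: H_vee_tree tree_closed low_closed vee_rules Node_decorated intro!: low.intros\<close>)
qed (use b \<alpha> in \<open>auto simp: vee_rules low_closed intro: low.intros\<close>)

lemma low_mult_trees: "\<lbrakk>x \<in> D; y \<in> D\<rbrakk> \<Longrightarrow> tree x \<otimes>\<^bsub>H\<^esub> tree y \<in> low (size x + size y)"
proof (induction "size x + size y" arbitrary: x y rule: less_induct)
  case less
  show ?case
  proof (cases "x = Leaf \<or> y = Leaf")
    case True
    then show ?thesis using less.prems
      by (auto simp: LR_l_one LR_r_one tree_closed simp flip: one_LR intro: low_tree)
  next
    case False
    then obtain l \<alpha> r l' \<beta> r' where xy: "x = Node l \<alpha> r" "y = Node l' \<beta> r'"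
      by (cases x; cases y) auto
    have d: "\<alpha> \<in> \<Omega>" "\<beta> \<in> \<Omega>" "l \<in> D" "r \<in> D" "l' \<in> D" "r' \<in> D"
      using less.prems xy by (auto simp: Node_decorated)
    have "tree x \<otimes>\<^bsub>H\<^esub> tree y =
        vee H \<alpha> (tree l) (tree r \<otimes>\<^bsub>H\<^esub> tree y) \<oplus>\<^bsub>H\<^esub> vee H \<beta> (tree x \<otimes>\<^bsub>H\<^esub> tree l') (tree r')"
      using LR_vee_mult_trees[OF d(1-6)] d by (simp add: xy H_vee_tree)
    moreover have "vee H \<alpha> (tree l) (tree r \<otimes>\<^bsub>H\<^esub> tree y) \<in> low (Suc (size l + (size r + size y)))"
      by (intro low_vee low_tree less.hyps) (use less.prems d in \<open>auto simp: xy\<close>)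
    moreover have "vee H \<beta> (tree x \<otimes>\<^bsub>H\<^esub> tree l') (tree r') \<in> low (Suc ((size x + size l') + size r'))"
      by (intro low_vee low_tree less.hyps) (use less.prems d in \<open>auto simp: xy\<close>)
    ultimately show ?thesis by (simp add: xy ac_simps low_add)
  qed
qed

lemma low_mult:
  assumes a: "a \<in> low m" and b: "b \<in> low n"
  shows "a \<otimes>\<^bsub>H\<^esub> b \<in> low (m + n)"
  using a
proof (induction a rule: low.induct)
  case S: (low_tree S)
  show ?case using b
    by (induction b rule: low.induct)
      (use S in \<open>auto simp: tree_closed low_closed mult_rules intro: low.intros low_mono[OF low_mult_trees]\<close>)
qed (use b in \<open>auto simp: mult_rules low_closed intro: low.intros\<close>)

text \<open>These tensors are collected inside \<open>H\<close> \<otimes> \<open>H\<close>, which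
  avoids asking whether a tensor product of submodules embeds there.\<close>

inductive_set low_tensor :: "nat \<Rightarrow> nat \<Rightarrow> (('w tree \<Rightarrow> 'k) \<times> ('w tree \<Rightarrow> 'k) \<Rightarrow> 'k) set set" for m n where
  low_pure: "\<lbrakk>a \<in> low m; b \<in> low n\<rbrakk> \<Longrightarrow> pure_tensor R H H a b \<in> low_tensor m n"
| low_tensor_add: "\<lbrakk>s \<in> low_tensor m n; t \<in> low_tensor m n\<rbrakk> \<Longrightarrow> s \<oplus>\<^bsub>tensor_module R H H\<^esub> t \<in> low_tensor m n"

interpretation T: module R "tensor_module R H H" by (rule C.module_HH)

lemma low_tensor_closed: "t \<in> low_tensor m n \<Longrightarrow> t \<in> carrier (tensor_module R H H)"
  by (induction rule: low_tensor.induct) (auto simp: pure_rules low_closed)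

lemma low_tensor_mono: "\<lbrakk>t \<in> low_tensor m n; m \<le> m'; n \<le> n'\<rbrakk> \<Longrightarrow> t \<in> low_tensor m' n'"
  by (induction rule: low_tensor.induct) (auto intro: low_tensor.intros low_mono)

lemma low_graft:
  assumes \<alpha>: "\<alpha> \<in> \<Omega>" and s: "s \<in> low_tensor m n" and t: "t \<in> low_tensor m' n'"
  shows "C.tensor_graft \<alpha> s t \<in> low_tensor (m + m') (Suc (n + n'))"
  using s
proof (induction s rule: low_tensor.induct)
  case ab: (low_pure a b)
  show ?case using t
    by (induction t rule: low_tensor.induct)
      (use ab \<alpha> in \<open>auto simp: C.tensor_graft_pure graft_rules pure_rules low_closed low_tensor_closed
        intro: low_tensor.intros low_mult low_vee\<close>)
qed (use t \<alpha> in \<open>auto simp: graft_rules low_tensor_closed intro: low_tensor.intros\<close>)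

text \<open>This bound is coarse because of the term T \<otimes> 1. The drop in the first component
  concerns the grafted part alone and is obtained separately from \<open>low_graft\<close>.\<close>

lemma low_comult: "T \<in> D \<Longrightarrow> comult H (tree T) \<in> low_tensor (size T) (size T)"
proof (induction T)
  case Leaf
  have "tree Leaf \<in> low 0" by (auto intro: low_tree Leaf_decorated)
  then show ?case by (auto simp: LR_comult_one one_LR intro: low_pure simp flip: one_LR)
next
  case (Node l \<alpha> r)
  then have d: "\<alpha> \<in> \<Omega>" "l \<in> D" "r \<in> D" by (auto simp: Node_decorated)
  have "pure_tensor R H H (tree (Node l \<alpha> r)) (tree Leaf) \<in>
      low_tensor (size (Node l \<alpha> r)) (size (Node l \<alpha> r))"
    using Node.prems by (intro low_pure low_tree) (auto simp: Leaf_decorated)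
  moreover have "C.tensor_graft \<alpha> (comult H (tree l)) (comult H (tree r)) \<in>
      low_tensor (size (Node l \<alpha> r)) (size (Node l \<alpha> r))"
    by (rule low_tensor_mono[OF low_graft]) (use d Node.IH in auto)
  ultimately show ?case
    using LR_cocycle[of \<alpha> "tree l" "tree r"] d
    by (simp add: H_vee_tree tree_closed one_LR low_tensor_add)
qed

text \<open>Convolution at a tree evaluates the two maps only on the levels that its coproduct
  reaches, so partial sums may replace the antipode and conversely.\<close>

lemma lift_eq_on_low:
  assumes f: "f \<in> linear_maps R H H" and f': "f' \<in> linear_maps R H H"
    and k: "k \<in> linear_maps R H H" and k': "k' \<in> linear_maps R H H"
    and eq: "\<And>x. x \<in> low m \<Longrightarrow> f x = f' x" "\<And>x. x \<in> low n \<Longrightarrow> k x = k' x"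
    and t: "t \<in> low_tensor m n"
  shows "tensor_lift R H (\<lambda>a b. f a \<otimes>\<^bsub>H\<^esub> k b) t = tensor_lift R H (\<lambda>a b. f' a \<otimes>\<^bsub>H\<^esub> k' b) t"
proof -
  note M = LR_module_module
  note bil = C.mult_linear_bilinear[OF f k] C.mult_linear_bilinear[OF f' k']
  note lin = tensor_lift_linear[OF M M M bil(1)] tensor_lift_linear[OF M M M bil(2)]
  show ?thesis using t
  proof (induction t rule: low_tensor.induct)
    case (low_pure a b)
    then show ?case
      by (simp only: tensor_lift_pure[OF M M M bil(1)] tensor_lift_pure[OF M M M bil(2)] low_closed eq)
  next
    case (low_tensor_add s t)
    then show ?case by (simp only: linear_add[OF lin(1)] linear_add[OF lin(2)] low_tensor_closed)
  qed
qed

text \<open>The projection id - \<eta>\<epsilon> onto the kernel of \<epsilon>; its negative is the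
  ratio of the geometric series.\<close>

definition augmentation_part :: "('w tree \<Rightarrow> 'k) \<Rightarrow> 'w tree \<Rightarrow> 'k" where
  "augmentation_part x = x \<ominus>\<^bsub>H\<^esub> convolution_unit H H x"

lemma augmentation_part_linear: "augmentation_part \<in> linear_maps R H H"
  unfolding augmentation_part_def[abs_def]
  by (rule linear_minus_fun[OF LR_module_module LR_module_module linear_id H.convolution_unit_linear])

lemma convolution_unit_one: "convolution_unit H H \<one>\<^bsub>H\<^esub> = \<one>\<^bsub>H\<^esub>"
  by (simp add: convolution_unit_def C.counit_one LR_one_closed)

lemma augmentation_part_one: "augmentation_part \<one>\<^bsub>H\<^esub> = \<zero>\<^bsub>H\<^esub>"
  by (simp add: augmentation_part_def convolution_unit_one LR_one_closed C.minus_eq C.r_neg)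

text \<open>The partial sums \<open>\<Sum>\<^sub>i\<^sub>\<le>\<^sub>n (\<eta>\<epsilon> - id)\<^sup>i\<close> of the geometric series that inverts \<open>id\<close> under convolution.\<close>

primrec antipode_approx :: "nat \<Rightarrow> ('w tree \<Rightarrow> 'k) \<Rightarrow> 'w tree \<Rightarrow> 'k" where
  "antipode_approx 0 = convolution_unit H H"
| "antipode_approx (Suc n) =
     (\<lambda>x. convolution_unit H H x \<ominus>\<^bsub>H\<^esub> convolution R H H (antipode_approx n) augmentation_part x)"

lemma antipode_approx_linear: "antipode_approx n \<in> linear_maps R H H"
proof (induction n)
  case 0
  show ?case using H.convolution_unit_linear by simp
next
  case (Suc n)
  show ?case unfolding antipode_approx.simps
    by (rule linear_minus_fun[OF LR_module_module LR_module_module H.convolution_unit_linear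
          H.convolution_linear[OF Suc augmentation_part_linear]])
qed

lemma convolution_augmentation_part_one:
  assumes "f \<in> linear_maps R H H"
  shows "convolution R H H f augmentation_part \<one>\<^bsub>H\<^esub> = \<zero>\<^bsub>H\<^esub>"
  unfolding convolution_def LR_comult_one
  by (subst tensor_lift_pure[OF LR_module_module LR_module_module LR_module_module
        C.mult_linear_bilinear[OF assms augmentation_part_linear]])
    (simp_all add: LR_one_closed augmentation_part_one linear_closed[OF assms])

text \<open>The augmentation part vanishes at 1, so the term T \<otimes> 1, the only one where the
  first map would see T itself, contributes nothing.\<close>

lemma convolution_augmentation_part_tree:
  assumes f: "f \<in> linear_maps R H H" and g: "g \<in> linear_maps R H H"
    and eq: "\<And>x. x \<in> low n \<Longrightarrow> f x = g x" and T: "T \<in> D" "size T \<le> Suc n"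
  shows "convolution R H H f augmentation_part (tree T) = convolution R H H g augmentation_part (tree T)"
proof (cases T)
  case Leaf
  then show ?thesis
    using convolution_augmentation_part_one[OF f] convolution_augmentation_part_one[OF g] by (simp add: one_LR)
next
  case (Node l \<alpha> r)
  note M = LR_module_module
  have d: "\<alpha> \<in> \<Omega>" "l \<in> D" "r \<in> D" using T Node by (auto simp: Node_decorated)
  let ?w = "C.tensor_graft \<alpha> (comult H (tree l)) (comult H (tree r))"
  \<comment> \<open>The first index is the sum of the sizes of the two subtrees, one less than the
    size of T and hence at most n.\<close>
  have w: "?w \<in> low_tensor n (size T)"
    by (rule low_tensor_mono[OF low_graft[OF d(1) low_comult[OF d(2)] low_comult[OF d(3)]]])
      (use T Node in auto)
  have comult: "comult H (tree T) = pure_tensor R H H (tree T) \<one>\<^bsub>H\<^esub> \<oplus>\<^bsub>tensor_module R H H\<^esub> ?w"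
    using LR_cocycle[of \<alpha> "tree l" "tree r"] d Node by (simp add: H_vee_tree tree_closed)
  have "convolution R H H k augmentation_part (tree T) = tensor_lift R H (\<lambda>a b. k a \<otimes>\<^bsub>H\<^esub> augmentation_part b) ?w"
    if k: "k \<in> linear_maps R H H" for k
  proof -
    note bil = C.mult_linear_bilinear[OF k augmentation_part_linear]
    note lin = tensor_lift_linear[OF M M M bil]
    have "tensor_lift R H (\<lambda>a b. k a \<otimes>\<^bsub>H\<^esub> augmentation_part b) (pure_tensor R H H (tree T) \<one>\<^bsub>H\<^esub>) = \<zero>\<^bsub>H\<^esub>"
      by (subst tensor_lift_pure[OF M M M bil])
        (simp_all add: T tree_closed LR_one_closed augmentation_part_one linear_closed[OF k])
    then show ?thesis
      using low_tensor_closed[OF w] T(1)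
      by (simp add: convolution_def comult linear_add[OF lin] linear_closed[OF lin] pure_rules
          tree_closed LR_one_closed)
  qed
  then show ?thesis using f g lift_eq_on_low[OF f g augmentation_part_linear augmentation_part_linear eq refl w] by simp
qed

lemma linear_eq_on_low:
  assumes f: "f \<in> linear_maps R H H" and g: "g \<in> linear_maps R H H"
    and eq: "\<And>T. \<lbrakk>T \<in> D; size T \<le> n\<rbrakk> \<Longrightarrow> f (tree T) = g (tree T)" and x: "x \<in> low n"
  shows "f x = g x"
  using x
  by (induction x rule: low.induct)
    (simp_all add: eq linear_add[OF f] linear_add[OF g] linear_smult[OF f] linear_smult[OF g] low_closed)

text \<open>Convolving with the augmentation part gains one level: if two maps agree up to size n,
  their convolutions agree up to size n + 1. At level 0 only the leaf remains, where the correction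
  term is zero.\<close>

lemma antipode_approx_stable: "x \<in> low n \<Longrightarrow> antipode_approx (Suc n) x = antipode_approx n x"
proof (induction n arbitrary: x)
  case 0
  show ?case
  proof (rule linear_eq_on_low[OF antipode_approx_linear antipode_approx_linear _ 0])
    fix T assume "T \<in> D" "size T \<le> 0"
    then have "T = Leaf" by simp
    then show "antipode_approx (Suc 0) (tree T) = antipode_approx 0 (tree T)"
      using convolution_augmentation_part_one[OF H.convolution_unit_linear]
      by (simp add: convolution_unit_one LR_one_closed C.minus_eq flip: one_LR)
  qed
next
  case (Suc n)
  show ?case
  proof (rule linear_eq_on_low[OF antipode_approx_linear antipode_approx_linear _ Suc.prems])
    fix T assume "T \<in> D" "size T \<le> Suc n"
    then show "antipode_approx (Suc (Suc n)) (tree T) = antipode_approx (Suc n) (tree T)"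
      using convolution_augmentation_part_tree[OF antipode_approx_linear antipode_approx_linear Suc.IH]
      by simp
  qed
qed

lemma antipode_approx_stable_le:
  assumes "n \<le> m" "x \<in> low n"
  shows "antipode_approx m x = antipode_approx n x"
  using assms(1)
proof (induction m rule: dec_induct)
  case base
  show ?case ..
next
  case (step m)
  then show ?case using antipode_approx_stable[OF low_mono[OF assms(2)]] by simp
qed

text \<open>The partial sums A are polynomials in the augmentation part P and so commute with it: (u
  - P \<ast> A) \<ast> P = P \<ast> (u - A \<ast> P). The defining recursion gives a left inverse of
  id, this form a right inverse.\<close>

lemma antipode_approx_Suc_left:
  assumes "x \<in> carrier H"
  shows "antipode_approx (Suc n) x =
    convolution_unit H H x \<ominus>\<^bsub>H\<^esub> convolution R H H augmentation_part (antipode_approx n) x"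
  using assms
proof (induction n arbitrary: x)
  case 0
  then show ?case
    by (simp add: H.convolution_unit_left H.convolution_unit_right augmentation_part_linear)
next
  case (Suc n)
  let ?u = "convolution_unit H H" and ?A = "antipode_approx n" and ?k = augmentation_part
  note lin = H.convolution_unit_linear antipode_approx_linear[of n] augmentation_part_linear
  note lin2 = H.convolution_linear[OF lin(2,3)] H.convolution_linear[OF lin(3,2)]
  have "convolution R H H (antipode_approx (Suc n)) ?k x =
      convolution R H H (\<lambda>x. ?u x \<ominus>\<^bsub>H\<^esub> convolution R H H ?k ?A x) ?k x"
    by (rule H.convolution_cong[OF antipode_approx_linear augmentation_part_linear Suc.prems Suc.IH refl])
  also have "\<dots> = ?k x \<ominus>\<^bsub>H\<^esub> convolution R H H ?k (convolution R H H ?A ?k) x"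
    using Suc.prems
    by (simp add: H.convolution_minus_left lin lin2 H.convolution_unit_left H.convolution_assoc)
  also have "\<dots> = convolution R H H ?k (antipode_approx (Suc n)) x"
    using Suc.prems
    by (simp add: H.convolution_minus_right lin lin2 H.convolution_unit_right)
  finally show ?case by (simp only: antipode_approx.simps(2)[of "Suc n"])
qed

text \<open>The limit of the partial sums, taken at each tree at an index from which the values no
  longer change.\<close>

definition LR_antipode :: "('w tree \<Rightarrow> 'k) \<Rightarrow> 'w tree \<Rightarrow> 'k" where
  "LR_antipode = lin_ext R H (\<lambda>T. antipode_approx (size T) (tree T))"

lemma LR_antipode_linear: "LR_antipode \<in> linear_maps R H H"
  unfolding LR_antipode_def LR_linear_maps
  by (rule lin_ext_linear[OF LR_module_module])
    (auto intro!: linear_closed[OF antipode_approx_linear] tree_closed)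

lemma LR_antipode_low:
  assumes "x \<in> low n"
  shows "LR_antipode x = antipode_approx n x"
proof (rule linear_eq_on_low[OF LR_antipode_linear antipode_approx_linear _ assms])
  fix T assume T: "T \<in> D" "size T \<le> n"
  then have "LR_antipode (tree T) = antipode_approx (size T) (tree T)"
    unfolding LR_antipode_def
    by (intro lin_ext_basis[OF LR_module_module, of T D] linear_closed[OF antipode_approx_linear] tree_closed)
  then show "LR_antipode (tree T) = antipode_approx n (tree T)"
    using antipode_approx_stable_le[OF T(2)] T low_tree by simp
qed

text \<open>In the limit the recursion reads S = u - S \<ast> P with P = id - u, and S \<ast> P = S
  \<ast> id - S; cancelling S leaves S \<ast> id = u.\<close>

lemma LR_antipode_left:
  assumes "x \<in> carrier H"
  shows "convolution R H H LR_antipode (\<lambda>x. x) x = convolution_unit H H x"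
proof (rule LR_linear_eqI[OF LR_module_module H.convolution_linear[OF LR_antipode_linear linear_id]
      H.convolution_unit_linear _ assms])
  fix T assume T: "T \<in> D"
  let ?n = "size T" and ?t = "tree T"
  have t: "?t \<in> low ?n" "?t \<in> carrier H" using T by (auto simp: low_tree tree_closed)
  \<comment> \<open>One index more than necessary is taken, so that the recursion can be unfolded
    once; the approximation of index \<open>?n\<close> left under the convolution still agrees with
    S on all first components of the coproduct.\<close>
  have "LR_antipode ?t = antipode_approx (Suc ?n) ?t"
    by (rule LR_antipode_low[OF low_mono[OF t(1)]]) simp
  also have "\<dots> = convolution_unit H H ?t \<ominus>\<^bsub>H\<^esub> convolution R H H LR_antipode augmentation_part ?t"
    unfolding antipode_approx.simps convolution_def
    by (simp only: lift_eq_on_low[OF antipode_approx_linear LR_antipode_linear augmentation_part_linear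
          augmentation_part_linear LR_antipode_low[symmetric] refl low_comult[OF T]])
  also have "convolution R H H LR_antipode augmentation_part ?t =
      convolution R H H LR_antipode (\<lambda>x. x) ?t \<ominus>\<^bsub>H\<^esub> LR_antipode ?t"
    unfolding augmentation_part_def[abs_def]
    using t by (simp add: H.convolution_minus_right linear_id H.convolution_unit_linear LR_antipode_linear
        H.convolution_unit_right)
  finally have eq: "LR_antipode ?t = convolution_unit H H ?t \<ominus>\<^bsub>H\<^esub>
      (convolution R H H LR_antipode (\<lambda>x. x) ?t \<ominus>\<^bsub>H\<^esub> LR_antipode ?t)" .
  have cl: "LR_antipode ?t \<in> carrier H" "convolution_unit H H ?t \<in> carrier H"
    "convolution R H H LR_antipode (\<lambda>x. x) ?t \<in> carrier H"
    using linear_closed[OF LR_antipode_linear t(2)] linear_closed[OF H.convolution_unit_linear t(2)]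
      linear_closed[OF H.convolution_linear[OF LR_antipode_linear linear_id] t(2)] .
  show "convolution R H H LR_antipode (\<lambda>x. x) ?t = convolution_unit H H ?t"
    by (rule C.M.minus_minus_cancel[OF cl(1,2,3) eq])
qed

text \<open>With the factors exchanged, the approximation acts on the second components, which is
  why \<open>low_comult\<close> bounds both.\<close>

lemma LR_antipode_right:
  assumes "x \<in> carrier H"
  shows "convolution R H H (\<lambda>x. x) LR_antipode x = convolution_unit H H x"
proof (rule LR_linear_eqI[OF LR_module_module H.convolution_linear[OF linear_id LR_antipode_linear]
      H.convolution_unit_linear _ assms])
  fix T assume T: "T \<in> D"
  let ?n = "size T" and ?t = "tree T"
  have t: "?t \<in> low ?n" "?t \<in> carrier H" using T by (auto simp: low_tree tree_closed)
  have "LR_antipode ?t = antipode_approx (Suc ?n) ?t"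
    by (rule LR_antipode_low[OF low_mono[OF t(1)]]) simp
  also have "\<dots> = convolution_unit H H ?t \<ominus>\<^bsub>H\<^esub> convolution R H H augmentation_part LR_antipode ?t"
    unfolding antipode_approx_Suc_left[OF t(2)] convolution_def
    by (simp only: lift_eq_on_low[OF augmentation_part_linear augmentation_part_linear antipode_approx_linear
          LR_antipode_linear refl LR_antipode_low[symmetric] low_comult[OF T]])
  also have "convolution R H H augmentation_part LR_antipode ?t =
      convolution R H H (\<lambda>x. x) LR_antipode ?t \<ominus>\<^bsub>H\<^esub> LR_antipode ?t"
    unfolding augmentation_part_def[abs_def]
    using t by (simp add: H.convolution_minus_left linear_id H.convolution_unit_linear LR_antipode_linear
        H.convolution_unit_left)
  finally have eq: "LR_antipode ?t = convolution_unit H H ?t \<ominus>\<^bsub>H\<^esub>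
      (convolution R H H (\<lambda>x. x) LR_antipode ?t \<ominus>\<^bsub>H\<^esub> LR_antipode ?t)" .
  have cl: "LR_antipode ?t \<in> carrier H" "convolution_unit H H ?t \<in> carrier H"
    "convolution R H H (\<lambda>x. x) LR_antipode ?t \<in> carrier H"
    using linear_closed[OF LR_antipode_linear t(2)] linear_closed[OF H.convolution_unit_linear t(2)]
      linear_closed[OF H.convolution_linear[OF linear_id LR_antipode_linear] t(2)] .
  show "convolution R H H (\<lambda>x. x) LR_antipode ?t = convolution_unit H H ?t"
    by (rule C.M.minus_minus_cancel[OF cl(1,2,3) eq])
qed

lemma LR_cocycle_vee_hopf_algebra: "cocycle_vee_hopf_algebra R \<Omega> H"
proof (intro cocycle_vee_hopf_algebra.intro hopf_algebra.intro hopf_algebra_axioms.intro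
    LR_cocycle_vee_bialgebra C.bialgebra_axioms exI)
  show "antipode R H LR_antipode"
    using LR_antipode_linear LR_antipode_left LR_antipode_right
    by (simp add: antipode_def convolution_def convolution_unit_def)
qed

end

section \<open>Initiality\<close>

locale tree_algebra_target = tree_algebra R \<Omega> + H': cocycle_vee_bialgebra R \<Omega> H'
  for R :: "('k, 'r) ring_scheme" and \<Omega> :: "'w set" and H' :: "('k, 'h, 'w) vee_bialgebra"
begin

interpretation C: cocycle_vee_bialgebra R \<Omega> H by (rule LR_cocycle_vee_bialgebra)

lemmas M = LR_module_module and M' = H'.module_H

primrec eval_tree :: "'w tree \<Rightarrow> 'h" where
  "eval_tree Leaf = \<one>\<^bsub>H'\<^esub>"
| "eval_tree (Node l \<alpha> r) = vee H' \<alpha> (eval_tree l) (eval_tree r)"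

lemma eval_tree_closed: "T \<in> D \<Longrightarrow> eval_tree T \<in> carrier H'"
  by (induction T) (auto simp: Node_decorated H'.vee_closed)

text \<open>The restriction makes the map undefined outside the carrier, as morphisms are required
  to be.\<close>

definition eval_LR :: "('w tree \<Rightarrow> 'k) \<Rightarrow> 'h" where
  "eval_LR = restrict (lin_ext R H' eval_tree) (carrier H)"

lemma eval_LR_linear: "eval_LR \<in> linear_maps R H H'"
proof (rule linear_cong[OF _ M])
  show "lin_ext R H' eval_tree \<in> linear_maps R H H'"
    unfolding LR_linear_maps by (rule lin_ext_linear[OF M']) (use eval_tree_closed in auto)
qed (simp add: eval_LR_def)

lemma eval_LR_basis: "T \<in> D \<Longrightarrow> eval_LR (tree T) = eval_tree T"
  by (simp add: eval_LR_def tree_closed lin_ext_basis[OF M'] eval_tree_closed)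

lemmas eval_rules = linear_closed[OF eval_LR_linear] linear_add[OF eval_LR_linear]
  linear_smult[OF eval_LR_linear]

lemma eval_LR_one: "eval_LR \<one>\<^bsub>H\<^esub> = \<one>\<^bsub>H'\<^esub>"
  by (simp add: one_LR eval_LR_basis Leaf_decorated)

lemma eval_LR_vee:
  assumes \<alpha>: "\<alpha> \<in> \<Omega>" and a: "a \<in> carrier H" and b: "b \<in> carrier H"
  shows "eval_LR (vee H \<alpha> a b) = vee H' \<alpha> (eval_LR a) (eval_LR b)"
proof -
  note rules = \<alpha> vee_rules eval_rules tree_closed bilinear_add_left[OF H'.vee_bilinear]
    bilinear_add_right[OF H'.vee_bilinear] bilinear_smult_left[OF H'.vee_bilinear]
    bilinear_smult_right[OF H'.vee_bilinear]
  show ?thesis using a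
  proof (induction a rule: LR_induct)
    case l: (tree l)
    show ?case using b
    proof (induction b rule: LR_induct)
      case (tree r)
      then show ?case using l \<alpha> by (simp add: H_vee_tree eval_LR_basis Node_decorated)
    qed (use l in \<open>simp_all add: rules\<close>)
  qed (use b in \<open>simp_all add: rules\<close>)
qed

text \<open>Apart from the unit, the product of trees is computed by the \<or>-law alone. The same
  law holds in the target, so preservation of graftings forces preservation of products.\<close>

lemma eval_LR_mult_trees:
  "\<lbrakk>x \<in> D; y \<in> D\<rbrakk> \<Longrightarrow> eval_LR (tree x \<otimes>\<^bsub>H\<^esub> tree y) = eval_LR (tree x) \<otimes>\<^bsub>H'\<^esub> eval_LR (tree y)"
proof (induction "size x + size y" arbitrary: x y rule: less_induct)
  case less
  show ?case
  proof (cases "x = Leaf \<or> y = Leaf")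
    case True
    then show ?thesis using less.prems
      by (auto simp: LR_l_one LR_r_one tree_closed eval_LR_one eval_rules simp flip: one_LR)
  next
    case False
    then obtain l \<alpha> r l' \<beta> r' where xy: "x = Node l \<alpha> r" "y = Node l' \<beta> r'"
      by (cases x; cases y) auto
    have d: "\<alpha> \<in> \<Omega>" "\<beta> \<in> \<Omega>" "l \<in> D" "r \<in> D" "l' \<in> D" "r' \<in> D"
      using less.prems xy by (auto simp: Node_decorated)
    have IH: "eval_LR (tree r \<otimes>\<^bsub>H\<^esub> tree y) = eval_LR (tree r) \<otimes>\<^bsub>H'\<^esub> eval_LR (tree y)"
      "eval_LR (tree x \<otimes>\<^bsub>H\<^esub> tree l') = eval_LR (tree x) \<otimes>\<^bsub>H'\<^esub> eval_LR (tree l')"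
      by (rule less.hyps; use less.prems d in \<open>auto simp: xy\<close>)+
    have V: "tree x = vee H \<alpha> (tree l) (tree r)" "tree y = vee H \<beta> (tree l') (tree r')"
      using d by (simp_all add: xy H_vee_tree)
    have c: "tree x \<in> carrier H" "tree y \<in> carrier H" using less.prems by (auto simp: tree_closed)
    have ev: "eval_LR (tree x) = vee H' \<alpha> (eval_LR (tree l)) (eval_LR (tree r))"
      "eval_LR (tree y) = vee H' \<beta> (eval_LR (tree l')) (eval_LR (tree r'))"
      unfolding V using d by (simp_all add: eval_LR_vee tree_closed)
    have "tree x \<otimes>\<^bsub>H\<^esub> tree y =
        vee H \<alpha> (tree l) (tree r \<otimes>\<^bsub>H\<^esub> tree y) \<oplus>\<^bsub>H\<^esub> vee H \<beta> (tree x \<otimes>\<^bsub>H\<^esub> tree l') (tree r')"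
      unfolding V by (rule LR_vee_mult_trees[OF d])
    then have "eval_LR (tree x \<otimes>\<^bsub>H\<^esub> tree y) =
        vee H' \<alpha> (eval_LR (tree l)) (eval_LR (tree r) \<otimes>\<^bsub>H'\<^esub> eval_LR (tree y)) \<oplus>\<^bsub>H'\<^esub>
        vee H' \<beta> (eval_LR (tree x) \<otimes>\<^bsub>H'\<^esub> eval_LR (tree l')) (eval_LR (tree r'))"
      using d c by (simp add: eval_rules vee_rules mult_rules tree_closed eval_LR_vee IH)
    also have "\<dots> = eval_LR (tree x) \<otimes>\<^bsub>H'\<^esub> eval_LR (tree y)"
      unfolding ev using d by (intro H'.vee_mult[symmetric]) (simp_all add: eval_rules tree_closed)
    finally show ?thesis .
  qed
qed

lemma eval_LR_mult:
  assumes x: "x \<in> carrier H" and y: "y \<in> carrier H"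
  shows "eval_LR (x \<otimes>\<^bsub>H\<^esub> y) = eval_LR x \<otimes>\<^bsub>H'\<^esub> eval_LR y"
proof -
  note bil = H'.mult_bilinear
  note rules = mult_rules eval_rules tree_closed bilinear_add_left[OF bil] bilinear_add_right[OF bil]
    bilinear_smult_left[OF bil] bilinear_smult_right[OF bil]
  show ?thesis using x
  proof (induction x rule: LR_induct)
    case S: (tree S)
    show ?case using y
      by (induction y rule: LR_induct) (use S in \<open>simp_all add: rules eval_LR_mult_trees\<close>)
  qed (use y in \<open>simp_all add: rules\<close>)
qed

lemma eval_LR_algebra_hom: "eval_LR \<in> algebra_hom R H H'"
  by (rule algebra_homI) (simp_all add: eval_LR_linear eval_LR_one eval_LR_mult)

section \<open>Evaluation as a morphism of bialgebras, and its uniqueness\<close>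

abbreviation eval_tensor where
  "eval_tensor \<equiv> tensor_map R H' H' eval_LR eval_LR"

lemmas eval_tensor_linear = tensor_map_linear[OF M M M' M' eval_LR_linear eval_LR_linear]
lemmas eval_tensor_pure = tensor_map_pure[OF M M M' M' eval_LR_linear eval_LR_linear]

lemma eval_tensor_graft:
  assumes "\<alpha> \<in> \<Omega>" "s \<in> carrier (tensor_module R H H)" "t \<in> carrier (tensor_module R H H)"
  shows "eval_tensor (C.tensor_graft \<alpha> s t) = H'.tensor_graft \<alpha> (eval_tensor s) (eval_tensor t)"
  by (rule tensor_map_op[where p = eval_LR and q = eval_LR,
        OF M M M' M' LR_mult_bilinear H_vee_bilinear[OF assms(1)] H'.mult_bilinear
          H'.vee_bilinear[OF assms(1)] eval_LR_linear eval_LR_linear _ _ assms(2,3)])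
    (simp_all add: eval_LR_mult eval_LR_vee assms(1))

text \<open>The cocycle identity holds on both sides, so the two coproducts satisfy the same
  recursion along the tree, and naturality of grafting passes evaluation through it.\<close>

lemma eval_LR_comult:
  assumes "h \<in> carrier H"
  shows "comult H' (eval_LR h) = eval_tensor (comult H h)"
proof (rule LR_linear_eqI[OF H'.module_HH linear_compose[OF eval_LR_linear H'.comult_linear]
      linear_compose[OF LR_comult_linear eval_tensor_linear] _ assms])
  fix T assume "T \<in> D"
  then show "comult H' (eval_LR (tree T)) = eval_tensor (comult H (tree T))"
  proof (induction T)
    case Leaf
    show ?case
      by (simp add: LR_comult_one eval_tensor_pure LR_one_closed eval_LR_one H'.comult_one flip: one_LR)
  next
    case (Node l \<alpha> r)
    then have d: "\<alpha> \<in> \<Omega>" "l \<in> D" "r \<in> D" by (auto simp: Node_decorated)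
    have "comult H' (eval_LR (vee H \<alpha> (tree l) (tree r))) =
        eval_tensor (comult H (vee H \<alpha> (tree l) (tree r)))"
      using d Node.IH
      by (simp add: LR_cocycle tree_closed linear_add[OF eval_tensor_linear] pure_rules graft_rules
          vee_rules LR_one_closed comult_rules eval_tensor_pure eval_tensor_graft eval_LR_one
          eval_LR_vee eval_rules H'.cocycle)
    then show ?case using d by (simp add: H_vee_tree)
  qed
qed

lemma eval_LR_counit:
  assumes "h \<in> carrier H"
  shows "counit H' (eval_LR h) = counit H h"
proof (rule LR_linear_eqI[OF base_algebra_module[OF R] linear_compose[OF eval_LR_linear H'.counit_linear]
      LR_counit_linear _ assms])
  fix T assume T: "T \<in> D"
  then show "counit H' (eval_LR (tree T)) = counit H (tree T)"
    by (cases T)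
      (auto simp: LR_counit_basis eval_LR_basis H'.counit_one H'.counit_vee Node_decorated eval_tree_closed)
qed

lemma eval_LR_hom: "eval_LR \<in> vee_bialgebra_hom R \<Omega> H H'"
proof -
  have "eval_LR \<in> extensional (carrier H)" by (simp add: eval_LR_def)
  then show ?thesis
    by (simp add: vee_bialgebra_hom_def bialgebra_hom_def eval_LR_algebra_hom eval_LR_comult
        eval_LR_counit eval_LR_vee)
qed

text \<open>Unit and graftings fix the values on trees, linearity those on the carrier, and
  extensionality those outside it.\<close>

lemma vee_bialgebra_hom_unique:
  assumes "\<psi> \<in> vee_bialgebra_hom R \<Omega> H H'"
  shows "\<psi> = eval_LR"
proof
  fix x
  have alg: "\<psi> \<in> algebra_hom R H H'" and ext: "\<psi> \<in> extensional (carrier H)"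
    and vee: "\<And>\<alpha> h h'. \<lbrakk>\<alpha> \<in> \<Omega>; h \<in> carrier H; h' \<in> carrier H\<rbrakk> \<Longrightarrow>
      \<psi> (vee H \<alpha> h h') = vee H' \<alpha> (\<psi> h) (\<psi> h')"
    using assms by (auto simp: vee_bialgebra_hom_def bialgebra_hom_def)
  have "\<psi> (tree T) = eval_LR (tree T)" if "T \<in> D" for T
    using that
  proof (induction T)
    case Leaf
    show ?case by (simp add: algebra_hom_one[OF alg] eval_LR_one flip: one_LR)
  next
    case (Node l \<alpha> r)
    then have d: "\<alpha> \<in> \<Omega>" "l \<in> D" "r \<in> D" by (auto simp: Node_decorated)
    then show ?case using Node.IH vee[of \<alpha> "tree l" "tree r"] eval_LR_vee[of \<alpha> "tree l" "tree r"]
      by (simp add: H_vee_tree tree_closed)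
  qed
  then have "\<psi> x = eval_LR x" if "x \<in> carrier H"
    by (rule LR_linear_eqI[OF M' algebra_hom_linear[OF alg] eval_LR_linear _ that])
  then show "\<psi> x = eval_LR x"
    using extensional_arb[OF ext] by (cases "x \<in> carrier H") (simp_all add: eval_LR_def)
qed

lemma ex1_vee_bialgebra_hom: "\<exists>!\<phi>. \<phi> \<in> vee_bialgebra_hom R \<Omega> H H'"
  using eval_LR_hom vee_bialgebra_hom_unique by blast

lemma eval_LR_hopf_hom: "eval_LR \<in> vee_hopf_hom R \<Omega> H H'"
proof -
  have "eval_LR \<in> bialgebra_hom R H H'"
    using eval_LR_hom by (simp add: vee_bialgebra_hom_def)
  then show ?thesis
    using eval_LR_hom bialgebra_hom_antipode[OF C.bialgebra_axioms H'.bialgebra_axioms]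
    by (auto simp: vee_hopf_hom_def hopf_hom_def)
qed

text \<open>A Hopf morphism is in particular a morphism of the underlying bialgebras, so uniqueness
  is inherited from there.\<close>

lemma ex1_vee_hopf_hom: "\<exists>!\<phi>. \<phi> \<in> vee_hopf_hom R \<Omega> H H'"
  using eval_LR_hopf_hom vee_bialgebra_hom_unique by (auto simp: vee_hopf_hom_def)

end

theorem theorem3p10:
  fixes R :: "('k, 'r) ring_scheme"
    and \<Omega> :: "'w set"
    and j :: "'x \<Rightarrow> 'w tree \<Rightarrow> 'k"
  assumes "cring R" and "\<Omega> \<noteq> {}"
  shows "(free_cocycle_vee_bialgebra TYPE('h) R \<Omega> {} j (LR R \<Omega>) \<and>
          initial_cocycle_vee_bialgebra TYPE('h) R \<Omega> (LR R \<Omega>)) \<and>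
         (free_cocycle_vee_hopf_algebra TYPE('h) R \<Omega> {} j (LR R \<Omega>) \<and>
          initial_cocycle_vee_hopf_algebra TYPE('h) R \<Omega> (LR R \<Omega>))"
proof -
  interpret tree_algebra R \<Omega> by (rule tree_algebra.intro) fact
  have target: "tree_algebra_target R \<Omega> H'" if "cocycle_vee_bialgebra R \<Omega> H'"
    for H' :: "('k, 'h, 'w) vee_bialgebra"
    using that by (intro tree_algebra_target.intro tree_algebra_axioms)
  have bialgebra: "\<exists>!\<phi>. \<phi> \<in> vee_bialgebra_hom R \<Omega> (LR R \<Omega>) H'"
    if "cocycle_vee_bialgebra R \<Omega> H'" for H' :: "('k, 'h, 'w) vee_bialgebra"
    by (rule tree_algebra_target.ex1_vee_bialgebra_hom[OF target[OF that]])
  have hopf: "\<exists>!\<phi>. \<phi> \<in> vee_hopf_hom R \<Omega> (LR R \<Omega>) H'"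
    if "cocycle_vee_hopf_algebra R \<Omega> H'" for H' :: "('k, 'h, 'w) vee_bialgebra"
    by (rule tree_algebra_target.ex1_vee_hopf_hom[OF target[OF cocycle_vee_hopf_algebra.axioms(1)[OF that]]])
  \<comment> \<open>For the empty set of generators the conditions on \<open>j\<close> and on the
    prescribed values are vacuous, and freeness becomes initiality.\<close>
  show ?thesis
    unfolding free_cocycle_vee_bialgebra_def initial_cocycle_vee_bialgebra_def
      free_cocycle_vee_hopf_algebra_def initial_cocycle_vee_hopf_algebra_def
    using LR_cocycle_vee_bialgebra LR_cocycle_vee_hopf_algebra bialgebra hopf by simp
qed

end
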